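(* Let $\psi:\mathbb{R}^d\to[0,1]$ be a measurable symmetric connection function with support contained in the closed unit ball, and let $\lambda\in(0,\lambda_c)$. Then the correlation length $\zeta(\lambda)$ is well defined: the limits $$\lim_{n\to\infty}-\frac1n\log\mathbb{P}[|C_o|=n\text{ in }\xi^o_\lambda]\quad\text{and}\quad\lim_{n\to\infty}-\frac1n\log\mathbb{P}[n\le|C_o|<\infty\text{ in }\xi^o_\lambda]$$ exist, are finite and are equal; their common value is $\zeta(\lambda)$. Moreover, $\lambda\mapsto\zeta(\lambda)$ is continuous and non-increasing on $(0,\lambda_c)$, and $\zeta(\lambda)\to\infty$ as $\lambda\to 0$.
   Context: RCM: $\mathcal P_\lambda$ is a homogeneous Poisson point process of intensity $\lambda$ on $\mathbb{R}^d$; each pair of distinct points $x,y$ is independently joined by an edge with probability $\psi(x-y)$. $\xi^o_\lambda$ is this graph on $\mathcal P_\lambda\cup\{o\}$, $o$ the origin, with the origin's edges sampled independently in the same way. $C_o$ is the connected component of $o$ in $\xi^o_\lambda$ and $|C_o|$ its number of vertices. $\Lambda_t=[-t/2,t/2]^d$; $\theta(\lambda)=\lim_{t\to\infty}\mathbb{P}[o\leftrightarrow\Lambda_t^c\text{ in }\xi^o_\lambda]$, and $\lambda_c=\inf\{\lambda:\theta(\lambda)>0\}$.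
   Formalization: The connection function ψ is additionally assumed not to vanish almost everywhere (its integral is positive); if ψ = 0 a.e. the origin is almost surely isolated, P[|C_o|=n]=0 for n≥2, and the limits are infinite, so the claim fails. *)

theory Defs
  imports "HOL-Analysis.Analysis" "HOL-Probability.Probability"
begin

text \<open>Random connection model, built from a concrete realisation of the
homogeneous Poisson point process of intensity lam on real^'d:
every unit cube Q_k = k + [0,1]^d (k in int^'d) receives an independent
Poisson(lam) number N k of points, the j-th point of cube k being X (k,j),
uniformly distributed in Q_k, all independent.  Vertices are indexed by
(int^'d * nat) option, where None is the origin o.  Every unordered pair
{a,b} of indices carries an independent uniform [0,1] variable U {a,b}; the
pair is joined iff U {a,b} < psi (pos a - pos b), i.e. with probability
psi (pos a - pos b), independently over pairs (including the origin's edges).\<close>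

type_synonym 'd vidx = "((int^'d) \<times> nat) option"

type_synonym 'd rcm_outcome =
  "((int^'d \<Rightarrow> nat) \<times> ((int^'d) \<times> nat \<Rightarrow> real^'d)) \<times> ('d vidx set \<Rightarrow> real)"

definition unit_cube :: "int^'d \<Rightarrow> (real^'d) set" where
  "unit_cube k = cbox (\<chi> i. real_of_int (k$i)) (\<chi> i. real_of_int (k$i) + 1)"

definition rcm_space :: "real \<Rightarrow> ('d::finite) rcm_outcome measure" where
  "rcm_space lam =
     (PiM UNIV (\<lambda>k::int^'d. measure_pmf (poisson_pmf lam))
      \<Otimes>\<^sub>M PiM UNIV (\<lambda>kj::(int^'d) \<times> nat. uniform_measure lborel (unit_cube (fst kj))))
     \<Otimes>\<^sub>M PiM UNIV (\<lambda>s::'d vidx set. uniform_measure lborel {0..1::real})"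

definition rcm_vertices :: "('d::finite) rcm_outcome \<Rightarrow> 'd vidx set" where
  "rcm_vertices w = insert None {Some (k, j) | k j. j < fst (fst w) k}"

definition rcm_pos :: "('d::finite) rcm_outcome \<Rightarrow> 'd vidx \<Rightarrow> real^'d" where
  "rcm_pos w a = (case a of None \<Rightarrow> 0 | Some kj \<Rightarrow> snd (fst w) kj)"

definition rcm_edge :: "(real^'d \<Rightarrow> real) \<Rightarrow> ('d::finite) rcm_outcome \<Rightarrow> 'd vidx \<Rightarrow> 'd vidx \<Rightarrow> bool" where
  "rcm_edge psi w a b \<longleftrightarrow> a \<in> rcm_vertices w \<and> b \<in> rcm_vertices w \<and> a \<noteq> b \<and>
     snd w {a, b} < psi (rcm_pos w a - rcm_pos w b)"

definition rcm_cluster :: "(real^'d \<Rightarrow> real) \<Rightarrow> ('d::finite) rcm_outcome \<Rightarrow> 'd vidx set" where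
  "rcm_cluster psi w = {b. (rcm_edge psi w)\<^sup>*\<^sup>* None b}"

definition prob_cluster_eq :: "('d::finite) itself \<Rightarrow> (real^'d \<Rightarrow> real) \<Rightarrow> real \<Rightarrow> nat \<Rightarrow> real" where
  "prob_cluster_eq _ psi lam n =
     measure (rcm_space lam :: 'd rcm_outcome measure)
       {w \<in> space (rcm_space lam). finite (rcm_cluster psi w) \<and> card (rcm_cluster psi w) = n}"

definition prob_cluster_ge_fin :: "('d::finite) itself \<Rightarrow> (real^'d \<Rightarrow> real) \<Rightarrow> real \<Rightarrow> nat \<Rightarrow> real" where
  "prob_cluster_ge_fin _ psi lam n =
     measure (rcm_space lam :: 'd rcm_outcome measure)
       {w \<in> space (rcm_space lam). finite (rcm_cluster psi w) \<and> n \<le> card (rcm_cluster psi w)}"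

definition box_Lambda :: "real \<Rightarrow> (real^'d::finite) set" where
  "box_Lambda t = cbox (\<chi> i. - t / 2) (\<chi> i. t / 2)"

definition theta :: "('d::finite) itself \<Rightarrow> (real^'d \<Rightarrow> real) \<Rightarrow> real \<Rightarrow> real" where
  "theta _ psi lam = Lim at_top (\<lambda>t::real.
     measure (rcm_space lam :: 'd rcm_outcome measure)
       {w \<in> space (rcm_space lam). \<exists>b \<in> rcm_cluster psi w. rcm_pos w b \<notin> box_Lambda t})"

text \<open>Critical intensity (in the extended reals; +\<infinity> if theta vanishes identically).\<close>
definition lambda_c :: "('d::finite) itself \<Rightarrow> (real^'d \<Rightarrow> real) \<Rightarrow> ereal" where
  "lambda_c D psi = Inf {ereal lam | lam. 0 < lam \<and> theta D psi lam > 0}"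

definition zeta :: "('d::finite) itself \<Rightarrow> (real^'d \<Rightarrow> real) \<Rightarrow> real \<Rightarrow> real" where
  "zeta D psi lam = lim (\<lambda>n. - ln (prob_cluster_eq D psi lam n) / real n)"

end

theory Submission
  imports Defs
begin

text \<open>Idea. Conditionally on the cube counts, the points and the edge variables factorise, and summing over
all ways to label the non-root cluster points gives a Mecke-type formula: with \<open>W\<close> the probability that the
random graph on \<open>0, x_1, ..., x_{n-1}\<close> is connected and \<open>V\<close> the volume
\<open>\<integral> (1 - \<Prod>_i (1 - psi (x_i - y))) dy\<close>,
the probability \<open>p_n\<close> of cluster size \<open>n\<close> is \<open>lam^(n-1) / (n-1)!\<close> times the integral of \<open>W * exp (- lam * V)\<close>.
Gluing a cluster of size \<open>n\<close>, translated so that it lies to the right of a cluster of size \<open>m\<close>, shows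
\<open>p_{m+n} \<ge> c * p_m * p_n / n\<close>; Fekete's argument tolerates the factor \<open>1/n\<close> and yields the rate for
every \<open>lam > 0\<close>. The formula also makes \<open>zeta lam + ln lam\<close> Lipschitz in \<open>lam\<close>, whence continuity and the
blow-up at \<open>0\<close>. Only monotonicity uses \<open>lam < lambda_c\<close>: there clusters are almost surely finite, so the
tail probabilities are monotone under thinning.\<close>

subsection \<open>Subadditivity with an error term\<close>

text \<open>The model has infinitely many cubes, but a connected set of \<open>n\<close> vertices
  containing the origin stays within distance \<open>n ^ 2\<close> and \<open>psi\<close> has range
  1. So the event of cluster size \<open>n\<close> is decided by finitely many cubes, and a Mecke
  formula on finite unions of cubes suffices. The gluing is done on integrals over labelled
  positions: \<open>rooted\<close> with \<open>n - 1\<close> labels around a root equals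
  \<open>(n-1)! * p_n / lam^(n-1)\<close>. All \<open>n\<close> vertices of the right block are
  labels of the glued cluster, yet its own integral is rooted at one of them and accounts for
  \<open>(n-1)!\<close> only; this is the lost factor \<open>1/n\<close>. The constant is
  \<open>c = lam * right_mass i\<close>, where \<open>right_mass i\<close> is half of the integral
  of \<open>psi\<close>. The Lipschitz bound rests on two facts: \<open>W\<close> does not involve
  \<open>lam\<close>, and \<open>0 \<le> V \<le> n * ball_volume\<close> whatever the positions.
  Hence \<open>p_n / lam^(n-1)\<close> changes at most by a factor exponential in \<open>n\<close>
  times the change of \<open>lam\<close>.\<close>

lemma fekete_with_error:
  fixes a g :: "nat \<Rightarrow> real"
  assumes a0: "\<And>n. 0 < n \<Longrightarrow> 0 \<le> a n"
    and g0: "\<And>n. 0 < n \<Longrightarrow> 0 \<le> g n"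
    and sub: "\<And>m n. 0 < m \<Longrightarrow> 0 < n \<Longrightarrow> a (m + n) \<le> a m + a n + g n"
    and g: "(\<lambda>n. g n / real n) \<longlonglongrightarrow> 0"
  shows "\<exists>l\<ge>0. (\<lambda>n. a n / real n) \<longlonglongrightarrow> l"
proof -
  \<comment> \<open>The error is charged to the second argument. Splitting off blocks of one fixed
    length \<open>k\<close> costs \<open>g k\<close> per block, that is \<open>g k / k\<close> per
    unit, so the infimum is taken over \<open>a\<close> with its error included; the error of
    \<open>n\<close> itself disappears by \<open>g\<close>.\<close>
  define b where "b n = (a n + g n) / real n" for n
  define l where "l = Inf (b ` {0<..})"
  have b0: "0 \<le> b n" if "0 < n" for n
    unfolding b_def using a0[OF that] g0[OF that] by simp
  have bdd: "bdd_below (b ` {0<..})"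
    by (rule bdd_belowI[of _ 0]) (use b0 in auto)
  have lb: "l \<le> b n" if "0 < n" for n
    unfolding l_def by (rule cInf_lower[OF _ bdd]) (use that in auto)
  have l0: "0 \<le> l"
    unfolding l_def by (rule cInf_greatest) (use b0 in auto)
  have iter: "a (q * k + r) \<le> real q * (a k + g k) + a r" if "0 < k" "0 < r" for q k r
  proof (induction q)
    case (Suc q)
    have "a (Suc q * k + r) = a ((q * k + r) + k)"
      by (simp add: algebra_simps)
    also have "\<dots> \<le> a (q * k + r) + a k + g k"
      by (rule sub) (use that in auto)
    finally show ?case using Suc by (simp add: algebra_simps)
  qed simp
  have upper: "\<exists>C. \<forall>n>0. a n \<le> real n * b k + C" if k: "0 < k" for k
  proof (intro exI allI impI)
    fix n :: nat assume n: "0 < n"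
    \<comment> \<open>The shift by one keeps the remainder \<open>r\<close> in \<open>1..k\<close>
      instead of \<open>0..k-1\<close>, because subadditivity is only available for positive
      arguments.\<close>
    define q where "q = (n - 1) div k"
    define r where "r = (n - 1) mod k + 1"
    have r: "0 < r" "r \<le> k"
      using k by (auto simp: r_def Suc_leI)
    have n_eq: "n = q * k + r"
      using n by (simp add: q_def r_def)
    have "a n \<le> real q * (a k + g k) + a r"
      unfolding n_eq by (rule iter) (use k r in auto)
    also have "real q * (a k + g k) = real (q * k) * b k"
      using k by (simp add: b_def field_simps)
    also have "\<dots> \<le> real n * b k"
      by (rule mult_right_mono) (use b0[OF k] n_eq in auto)
    also have "a r \<le> Max (a ` {..k})"
      by (rule Max_ge) (use r in auto)
    finally show "a n \<le> real n * b k + Max (a ` {..k})" by simp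
  qed
  have "(\<lambda>n. a n / real n) \<longlonglongrightarrow> l"
  proof (rule LIMSEQ_I)
    fix e :: real assume e: "0 < e"
    have "\<exists>x\<in>b ` {0<..}. x < l + e / 2"
      using e cInf_lessD[of "b ` {0<..}" "l + e / 2"] by (auto simp: l_def)
    then obtain k where k: "0 < k" "b k < l + e / 2" by auto
    obtain C where C: "\<And>n. 0 < n \<Longrightarrow> a n \<le> real n * b k + C" using upper[OF k(1)] by blast
    have "(\<lambda>n. C / real n) \<longlonglongrightarrow> 0" by (rule lim_const_over_n)
    then have ev1: "\<forall>\<^sub>F n in sequentially. C / real n < e / 2"
      by (rule order_tendstoD) (use e in simp)
    have ev2: "\<forall>\<^sub>F n in sequentially. g n / real n < e"
      using g by (rule order_tendstoD) (use e in simp)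
    have "\<forall>\<^sub>F n in sequentially. norm (a n / real n - l) < e"
      using ev1 ev2 eventually_gt_at_top[of 0]
    proof eventually_elim
      case (elim n)
      have "a n / real n \<le> b k + C / real n"
        using C[of n] elim by (simp add: field_simps)
      moreover have "l - g n / real n \<le> a n / real n"
        using lb[of n] elim by (simp add: b_def add_divide_distrib)
      ultimately show ?case using elim(1,2) k(2) unfolding real_norm_def by linarith
    qed
    then show "\<exists>no. \<forall>n\<ge>no. norm (a n / real n - l) < e"
      by (simp add: eventually_sequentially)
  qed
  with l0 show ?thesis by blast
qed

subsection \<open>Connectivity weights of finite random graphs\<close>

definition vpairs :: "'v set \<Rightarrow> 'v set set" where
  "vpairs V = {{a, b} | a b. a \<in> V \<and> b \<in> V \<and> a \<noteq> b}"

text \<open>Paths may use every pair in \<open>G\<close>, also pairs that leave \<open>V\<close>;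
  connectivity inside \<open>V\<close> therefore appears below with \<open>G\<close> restricted to
  \<open>vpairs V\<close>.\<close>

definition gconn :: "'v set \<Rightarrow> 'v set set \<Rightarrow> bool" where
  "gconn V G \<longleftrightarrow> (\<forall>a\<in>V. \<forall>b\<in>V. (\<lambda>x y. {x, y} \<in> G)\<^sup>*\<^sup>* a b)"

text \<open>For \<open>p\<close> with values in \<open>[0,1]\<close> this is the probability of
  \<open>Q\<close> for the random subset of \<open>D\<close> that keeps each \<open>e\<close>
  independently with probability \<open>p e\<close>, written as a finite sum so that it can be
  handled without measures.\<close>

definition gwt :: "'e set \<Rightarrow> ('e \<Rightarrow> real) \<Rightarrow> ('e set \<Rightarrow> bool) \<Rightarrow> real" where
  "gwt D p Q = (\<Sum>G\<in>Pow D. (\<Prod>e\<in>D. if e \<in> G then p e else 1 - p e) * of_bool (Q G))"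

lemma finite_vpairs [simp]: "finite V \<Longrightarrow> finite (vpairs V)"
  by (rule finite_subset[of _ "Pow V"]) (auto simp: vpairs_def)

lemma vpairsI: "a \<in> V \<Longrightarrow> b \<in> V \<Longrightarrow> a \<noteq> b \<Longrightarrow> {a, b} \<in> vpairs V"
  by (auto simp: vpairs_def)

lemma gwt_nonneg:
  assumes "\<And>e. e \<in> D \<Longrightarrow> 0 \<le> p e \<and> p e \<le> 1"
  shows "0 \<le> gwt D p Q"
  unfolding gwt_def by (intro sum_nonneg mult_nonneg_nonneg prod_nonneg) (use assms in auto)

lemma gwt_mono:
  assumes "\<And>e. e \<in> D \<Longrightarrow> 0 \<le> p e \<and> p e \<le> 1" "\<And>G. G \<subseteq> D \<Longrightarrow> Q G \<Longrightarrow> Q' G"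
  shows "gwt D p Q \<le> gwt D p Q'"
  unfolding gwt_def
  by (intro sum_mono mult_left_mono prod_nonneg) (use assms in auto)

lemma gwt_cong:
  assumes "\<And>e. e \<in> D \<Longrightarrow> p e = p' e" "\<And>G. G \<subseteq> D \<Longrightarrow> Q G = Q' G"
  shows "gwt D p Q = gwt D p' Q'"
  unfolding gwt_def using assms by (intro sum.cong arg_cong2[where f="(*)"] prod.cong) auto

text \<open>Independence of events on disjoint edge sets: subsets of \<open>D1 \<union> D2\<close>
  correspond to pairs of subsets, and the weight factorises along this bijection.\<close>

lemma gwt_split:
  assumes fin: "finite D1" "finite D2" and disj: "D1 \<inter> D2 = {}"
  shows "gwt (D1 \<union> D2) p (\<lambda>G. Q1 (G \<inter> D1) \<and> Q2 (G \<inter> D2)) = gwt D1 p Q1 * gwt D2 p Q2"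
proof -
  let ?w = "\<lambda>D G. \<Prod>e\<in>D. if e \<in> G then p e else 1 - p e"
  have bij: "bij_betw (\<lambda>(G, H). G \<union> H) (Pow D1 \<times> Pow D2) (Pow (D1 \<union> D2))"
    by (rule bij_betw_byWitness[where f' = "\<lambda>G. (G \<inter> D1, G \<inter> D2)"]) (use disj in auto)
  have "gwt (D1 \<union> D2) p (\<lambda>G. Q1 (G \<inter> D1) \<and> Q2 (G \<inter> D2)) =
    (\<Sum>(G, H)\<in>Pow D1 \<times> Pow D2. ?w (D1 \<union> D2) (G \<union> H) *
       of_bool (Q1 ((G \<union> H) \<inter> D1) \<and> Q2 ((G \<union> H) \<inter> D2)))"
    unfolding gwt_def by (subst sum.reindex_bij_betw[OF bij, symmetric]) (simp add: case_prod_unfold)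
  also have "\<dots> = (\<Sum>(G, H)\<in>Pow D1 \<times> Pow D2. (?w D1 G * of_bool (Q1 G)) * (?w D2 H * of_bool (Q2 H)))"
  proof (intro sum.cong refl, clarify)
    fix G H assume GH: "G \<subseteq> D1" "H \<subseteq> D2"
    have *: "(G \<union> H) \<inter> D1 = G" "(G \<union> H) \<inter> D2 = H" using GH disj by auto
    have "?w (D1 \<union> D2) (G \<union> H) = ?w D1 (G \<union> H) * ?w D2 (G \<union> H)"
      by (rule prod.union_disjoint) (use fin disj in auto)
    also have "?w D1 (G \<union> H) = ?w D1 G" by (intro prod.cong refl) (use GH disj in auto)
    also have "?w D2 (G \<union> H) = ?w D2 H" by (intro prod.cong refl) (use GH disj in auto)
    finally show "?w (D1 \<union> D2) (G \<union> H) * of_bool (Q1 ((G \<union> H) \<inter> D1) \<and> Q2 ((G \<union> H) \<inter> D2)) =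
       (?w D1 G * of_bool (Q1 G)) * (?w D2 H * of_bool (Q2 H))"
      unfolding * by (simp add: of_bool_conj)
  qed
  also have "\<dots> = gwt D1 p Q1 * gwt D2 p Q2"
    unfolding gwt_def by (simp add: sum_product sum.cartesian_product)
  finally show ?thesis .
qed

lemma gwt_singleton: "gwt {e} p Q = p e * of_bool (Q {e}) + (1 - p e) * of_bool (Q {})"
  unfolding gwt_def by (simp add: Pow_insert insert_commute)

lemma gwt_True: "finite D \<Longrightarrow> gwt D p (\<lambda>_. True) = 1"
proof (induction D rule: finite_induct)
  case empty show ?case by (simp add: gwt_def)
next
  case (insert e D)
  have "gwt ({e} \<union> D) p (\<lambda>G. True \<and> True) = gwt {e} p (\<lambda>_. True) * gwt D p (\<lambda>_. True)"
    by (rule gwt_split) (use insert in auto)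
  then show ?case using insert by (simp add: gwt_singleton)
qed

lemma gwt_mem:
  assumes "finite D" "e \<in> D"
  shows "gwt D p (\<lambda>G. e \<in> G) = p e"
proof -
  have D: "D = {e} \<union> (D - {e})" using assms by auto
  have "gwt D p (\<lambda>G. e \<in> G) = gwt ({e} \<union> (D - {e})) p (\<lambda>G. e \<in> G \<inter> {e} \<and> True)"
    using D by (simp add: insert_absorb assms)
  also have "\<dots> = gwt {e} p (\<lambda>G. e \<in> G) * gwt (D - {e}) p (\<lambda>_. True)"
    by (rule gwt_split[where ?Q1.0 = "\<lambda>G. e \<in> G" and ?Q2.0 = "\<lambda>_. True"]) (use assms in auto)
  finally show ?thesis using assms by (simp add: gwt_singleton gwt_True)
qed

lemma gwt_empty:
  assumes "finite D"
  shows "gwt D p (\<lambda>G. G = {}) = (\<Prod>e\<in>D. 1 - p e)"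
proof -
  have "gwt D p (\<lambda>G. G = {}) = (\<Sum>G\<in>{{}}. (\<Prod>e\<in>D. if e \<in> G then p e else 1 - p e) * of_bool (G = {}))"
    unfolding gwt_def by (rule sum.mono_neutral_right) (use assms in auto)
  then show ?thesis by simp
qed

lemma gwt_reindex:
  assumes h: "inj_on h D"
  shows "gwt (h ` D) p Q = gwt D (p \<circ> h) (\<lambda>G. Q (h ` G))"
proof -
  have bij: "bij_betw ((`) h) (Pow D) (Pow (h ` D))"
    by (rule bij_betw_Pow) (use h in \<open>simp add: bij_betw_def\<close>)
  have "gwt (h ` D) p Q = (\<Sum>G\<in>Pow D. (\<Prod>e\<in>h ` D. if e \<in> h ` G then p e else 1 - p e) * of_bool (Q (h ` G)))"
    unfolding gwt_def by (rule sum.reindex_bij_betw[OF bij, symmetric])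
  also have "\<dots> = gwt D (p \<circ> h) (\<lambda>G. Q (h ` G))"
    unfolding gwt_def
  proof (intro sum.cong refl arg_cong2[where f="(*)"])
    fix G assume G: "G \<in> Pow D"
    have "(\<Prod>e\<in>h ` D. if e \<in> h ` G then p e else 1 - p e) =
        (\<Prod>e\<in>D. if h e \<in> h ` G then p (h e) else 1 - p (h e))"
      by (simp add: prod.reindex[OF h])
    also have "\<dots> = (\<Prod>e\<in>D. if e \<in> G then (p \<circ> h) e else 1 - (p \<circ> h) e)"
      by (intro prod.cong refl) (use G h in \<open>auto dest: inj_onD\<close>)
    finally show "(\<Prod>e\<in>h ` D. if e \<in> h ` G then p e else 1 - p e) = \<dots>" .
  qed
  finally show ?thesis .
qed

lemma gconn_image: "gconn V G \<Longrightarrow> gconn (f ` V) ((`) f ` G)"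
proof -
  have "(\<lambda>x y. {x, y} \<in> (`) f ` G)\<^sup>*\<^sup>* (f a) (f b)" if "(\<lambda>x y. {x, y} \<in> G)\<^sup>*\<^sup>* a b" for a b
    using that
  proof (induction rule: rtranclp_induct)
    case (step y z)
    have "{f y, f z} \<in> (`) f ` G" using step(2) by (force intro!: image_eqI[of _ _ "{y, z}"])
    with step(3) show ?case by (rule rtranclp.rtrancl_into_rtrancl)
  qed simp
  then show "gconn V G \<Longrightarrow> gconn (f ` V) ((`) f ` G)" by (auto simp: gconn_def)
qed

text \<open>Renaming vertices is a bijection on pairs that preserves connectivity in both
  directions, the backward one through \<open>inv_into\<close>. It later replaces the indices of the
  model by abstract labels.\<close>

lemma gwt_gconn_reindex:
  assumes f: "inj_on f V"
  shows "gwt (vpairs (f ` V)) p (gconn (f ` V)) = gwt (vpairs V) (\<lambda>e. p (f ` e)) (gconn V)"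
proof -
  have img: "vpairs (f ` V) = (`) f ` vpairs V"
  proof (intro set_eqI iffI)
    fix e assume "e \<in> vpairs (f ` V)"
    then obtain a b where "a \<in> V" "b \<in> V" "f a \<noteq> f b" "e = {f a, f b}"
      by (auto simp: vpairs_def)
    then show "e \<in> (`) f ` vpairs V"
      by (intro image_eqI[of _ _ "{a, b}"] vpairsI) auto
  next
    fix e assume "e \<in> (`) f ` vpairs V"
    then obtain a b where ab: "a \<in> V" "b \<in> V" "a \<noteq> b" "e = f ` {a, b}"
      unfolding vpairs_def by blast
    then have "f a \<noteq> f b" using f by (auto dest: inj_onD)
    with ab show "e \<in> vpairs (f ` V)"
      by (simp add: vpairsI)
  qed
  have sub: "e \<subseteq> V" if "e \<in> vpairs V" for e using that by (auto simp: vpairs_def)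
  have inj: "inj_on ((`) f) (vpairs V)"
    by (rule inj_on_subset[OF inj_on_image_Pow[OF f]]) (use sub in auto)
  have conn: "gconn (f ` V) ((`) f ` G) = gconn V G" if G: "G \<subseteq> vpairs V" for G
  proof
    assume "gconn (f ` V) ((`) f ` G)"
    from gconn_image[OF this, of "inv_into V f"]
    have "gconn (inv_into V f ` f ` V) ((`) (inv_into V f) ` (`) f ` G)" .
    moreover have "inv_into V f ` f ` V = V" using f by (simp add: inv_into_image_cancel)
    moreover have "(`) (inv_into V f) ` (`) f ` G = G"
    proof -
      have "inv_into V f ` f ` e = e" if "e \<in> G" for e
        using that G sub f by (intro inv_into_image_cancel) auto
      then show ?thesis by (simp add: image_image)
    qed
    ultimately show "gconn V G" by simp
  qed (rule gconn_image)
  show ?thesis unfolding img gwt_reindex[OF inj] by (rule gwt_cong) (auto simp: conn)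
qed

lemma gconn_rtrancl_mono:
  assumes "gconn V G" "G \<subseteq> H" "a \<in> V" "b \<in> V"
  shows "(\<lambda>x y. {x, y} \<in> H)\<^sup>*\<^sup>* a b"
proof -
  have "(\<lambda>x y. {x, y} \<in> G)\<^sup>*\<^sup>* a b" using assms by (auto simp: gconn_def)
  then show ?thesis by (rule rtranclp_mono[THEN predicate2D, rotated]) (use assms in auto)
qed

lemma gconn_Un:
  assumes c: "gconn X (G \<inter> vpairs X)" "gconn Y (G \<inter> vpairs Y)"
    and ab: "a \<in> X" "b \<in> Y" "{a, b} \<in> G"
  shows "gconn (X \<union> Y) G"
proof -
  let ?R = "(\<lambda>x y. {x, y} \<in> G)\<^sup>*\<^sup>*"
  have X: "?R x y" if "x \<in> X" "y \<in> X" for x y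
    using gconn_rtrancl_mono[OF c(1) _ that] by auto
  have Y: "?R x y" if "x \<in> Y" "y \<in> Y" for x y
    using gconn_rtrancl_mono[OF c(2) _ that] by auto
  have R: "?R a b" "?R b a" using ab by (auto intro!: r_into_rtranclp simp: insert_commute)
  have "?R x a \<and> ?R a x" if "x \<in> X \<union> Y" for x
  proof (cases "x \<in> X")
    case False
    with that have "?R x b" "?R b x" using Y ab by auto
    with R show ?thesis
      using rtranclp_trans[of _ x b a] rtranclp_trans[of _ a b x] by auto
  qed (use X ab in auto)
  then have "?R x y" if "x \<in> X \<union> Y" "y \<in> X \<union> Y" for x y
    using that rtranclp_trans[of _ x a y] by simp
  then show ?thesis unfolding gconn_def by simp
qed

text \<open>Both blocks connected within themselves and the one cross pair \<open>{a, b}\<close>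
  open imply that the union is connected. These three events concern disjoint sets of pairs, so
  their probabilities multiply; the other cross pairs stay free.\<close>

lemma gwt_gconn_Un:
  assumes fin: "finite X" "finite Y" and disj: "X \<inter> Y = {}"
    and p: "\<And>e. 0 \<le> p e \<and> p e \<le> 1" and ab: "a \<in> X" "b \<in> Y"
  shows "gwt (vpairs X) p (gconn X) * gwt (vpairs Y) p (gconn Y) * p {a, b}
      \<le> gwt (vpairs (X \<union> Y)) p (gconn (X \<union> Y))"
proof -
  define C where "C = {{x, y} | x y. x \<in> X \<and> y \<in> Y}"
  have D: "vpairs (X \<union> Y) = vpairs X \<union> (vpairs Y \<union> C)"
    (is "?L = ?R")
  proof (intro equalityI subsetI)
    fix e assume "e \<in> ?L"
    then obtain x y where xy: "x \<in> X \<union> Y" "y \<in> X \<union> Y" "x \<noteq> y" "e = {x, y}"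
      unfolding vpairs_def by blast
    have "e \<in> C" if "(x \<in> X \<and> y \<in> Y) \<or> (x \<in> Y \<and> y \<in> X)"
    proof -
      have "e = {y, x}" using xy(4) by auto
      with that xy(4) show ?thesis unfolding C_def by blast
    qed
    with xy show "e \<in> ?R" using vpairsI[of x _ y] by auto
  next
    fix e assume "e \<in> ?R"
    then show "e \<in> ?L"
    proof (elim UnE)
      assume "e \<in> C"
      then obtain x y where "x \<in> X" "y \<in> Y" "e = {x, y}" by (auto simp: C_def)
      moreover have "x \<noteq> y" using disj calculation by blast
      ultimately show ?thesis by (simp add: vpairsI)
    qed (auto simp: vpairs_def)
  qed
  have finC: "finite C"
    by (rule finite_subset[of _ "Pow (X \<union> Y)"]) (use fin in \<open>auto simp: C_def\<close>)
  have d1: "vpairs Y \<inter> C = {}" using disj by (auto simp: vpairs_def C_def doubleton_eq_iff)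
  have d2: "vpairs X \<inter> (vpairs Y \<union> C) = {}" using disj by (auto simp: vpairs_def C_def doubleton_eq_iff)
  have abC: "{a, b} \<in> C" using ab by (auto simp: C_def)
  have "gwt (vpairs X) p (gconn X) * (gwt (vpairs Y) p (gconn Y) * gwt C p (\<lambda>G. {a, b} \<in> G)) =
    gwt (vpairs X \<union> (vpairs Y \<union> C)) p (\<lambda>G. gconn X (G \<inter> vpairs X) \<and>
       (gconn Y ((G \<inter> (vpairs Y \<union> C)) \<inter> vpairs Y) \<and> {a, b} \<in> (G \<inter> (vpairs Y \<union> C)) \<inter> C))"
    using fin finC d1 d2
      gwt_split[of "vpairs Y" C p "gconn Y" "\<lambda>G. {a,b} \<in> G"]
      gwt_split[of "vpairs X" "vpairs Y \<union> C" p "gconn X" "\<lambda>G. gconn Y (G \<inter> vpairs Y) \<and> {a, b} \<in> G \<inter> C"]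
    by simp
  also have "\<dots> \<le> gwt (vpairs X \<union> (vpairs Y \<union> C)) p (gconn (X \<union> Y))"
  proof (rule gwt_mono)
    fix G assume G: "gconn X (G \<inter> vpairs X) \<and>
       (gconn Y ((G \<inter> (vpairs Y \<union> C)) \<inter> vpairs Y) \<and> {a, b} \<in> (G \<inter> (vpairs Y \<union> C)) \<inter> C)"
    have "(G \<inter> (vpairs Y \<union> C)) \<inter> vpairs Y = G \<inter> vpairs Y" by auto
    with G show "gconn (X \<union> Y) G" using gconn_Un[of X G Y a b] ab by auto
  qed (use p in auto)
  finally show ?thesis by (simp add: gwt_mem[OF finC abC] D mult.assoc)
qed

section \<open>Law of the open pairs under independent uniform edge variables\<close>

definition edge_space :: "('d::finite vidx set \<Rightarrow> real) measure" where
  "edge_space = PiM UNIV (\<lambda>s::'d vidx set. uniform_measure lborel {0..1::real})"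

lemma prob_space_uniform01: "prob_space (uniform_measure lborel {0..1::real})"
  by (rule prob_space_uniform_measure) auto

lemma product_prob_edge_space: "product_prob_space (\<lambda>s::'d::finite vidx set. uniform_measure lborel {0..1::real})"
  by (simp add: product_prob_space_def product_sigma_finite_def product_prob_space_axioms_def
      prob_space_uniform01 prob_space_imp_sigma_finite)

lemma emeasure_uniform01_less:
  assumes "0 \<le> p" "p \<le> 1"
  shows "emeasure (uniform_measure lborel {0..1::real}) {..<p} = ennreal p"
    "emeasure (uniform_measure lborel {0..1::real}) {p..} = ennreal (1 - p)"
proof -
  have sets: "{0..1} \<inter> {..<p} = {0..<p}" "{0..1} \<inter> {p..} = {p..1}" using assms by auto
  have "emeasure (uniform_measure lborel {0..1::real}) {..<p} = emeasure lborel {0..<p} / emeasure lborel {0..1::real}"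
    by (subst emeasure_uniform_measure) (simp_all only: sets, simp_all)
  then show "emeasure (uniform_measure lborel {0..1::real}) {..<p} = ennreal p"
    using assms by (simp add: divide_ennreal_def del: emeasure_uniform_measure)
  have "emeasure (uniform_measure lborel {0..1::real}) {p..} = emeasure lborel {p..1} / emeasure lborel {0..1::real}"
    by (subst emeasure_uniform_measure) (simp_all only: sets, simp_all)
  then show "emeasure (uniform_measure lborel {0..1::real}) {p..} = ennreal (1 - p)"
    using assms by (simp add: divide_ennreal_def del: emeasure_uniform_measure)
qed

text \<open>The event is split according to the exact set \<open>G\<close> of open pairs. Each cell
  is a cylinder with factors \<open>p e\<close> for \<open>e \<in> G\<close> and
  \<open>1 - p e\<close> otherwise, which are the summands of \<open>gwt\<close>.\<close>

lemma emeasure_edge_space_gwt: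
  fixes D :: "'d::finite vidx set set"
  assumes fin: "finite D" and p: "\<And>e. e \<in> D \<Longrightarrow> 0 \<le> p e \<and> p e \<le> 1"
  shows "{U \<in> space edge_space. Q {e\<in>D. U e < p e}} \<in> sets edge_space"
    and "emeasure edge_space {U \<in> space edge_space. Q {e\<in>D. U e < p e}} = ennreal (gwt D p Q)"
proof -
  interpret product_prob_space "\<lambda>s::'d vidx set. uniform_measure lborel {0..1::real}" UNIV
    by (rule product_prob_edge_space)
  define c where "c G = {U \<in> space edge_space. \<forall>e\<in>D. U e \<in> (if e \<in> G then {..<p e} else {p e..})}" for G
  have c_sets: "c G \<in> sets edge_space" for G
    unfolding c_def edge_space_def
    by (rule sets.sets_Collect_finite_All[OF sets_Collect_single'])
      (use fin in auto)
  have c_em: "emeasure edge_space (c G) = ennreal (\<Prod>e\<in>D. if e \<in> G then p e else 1 - p e)" for G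
  proof -
    have "emeasure edge_space (c G) = (\<Prod>e\<in>D. emeasure (uniform_measure lborel {0..1::real}) (if e \<in> G then {..<p e} else {p e..}))"
      unfolding c_def edge_space_def by (rule emeasure_PiM_Collect) (use fin in auto)
    also have "\<dots> = (\<Prod>e\<in>D. ennreal (if e \<in> G then p e else 1 - p e))"
      by (intro prod.cong refl) (use p in \<open>auto simp: emeasure_uniform01_less simp del: emeasure_uniform_measure\<close>)
    also have "\<dots> = ennreal (\<Prod>e\<in>D. if e \<in> G then p e else 1 - p e)"
      by (rule prod_ennreal) (use p in auto)
    finally show ?thesis .
  qed
  have c_iff: "U \<in> c G \<longleftrightarrow> U \<in> space edge_space \<and> {e\<in>D. U e < p e} = G" if "G \<subseteq> D" for U G
    unfolding c_def using that by (auto split: if_splits)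
  have eq: "{U \<in> space edge_space. Q {e\<in>D. U e < p e}} = (\<Union>G\<in>{G\<in>Pow D. Q G}. c G)"
    using c_iff by auto
  have disj: "disjoint_family_on c {G\<in>Pow D. Q G}"
    by (auto simp: disjoint_family_on_def c_iff)
  show "{U \<in> space edge_space. Q {e\<in>D. U e < p e}} \<in> sets edge_space"
    unfolding eq by (rule sets.finite_UN) (use fin c_sets in auto)
  have "emeasure edge_space {U \<in> space edge_space. Q {e\<in>D. U e < p e}} =
     (\<Sum>G\<in>{G\<in>Pow D. Q G}. emeasure edge_space (c G))"
    unfolding eq by (rule sum_emeasure[symmetric]) (use c_sets disj fin in auto)
  also have "\<dots> = ennreal (\<Sum>G\<in>{G\<in>Pow D. Q G}. (\<Prod>e\<in>D. if e \<in> G then p e else 1 - p e))"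
    unfolding c_em by (rule sum_ennreal) (use p in \<open>auto intro!: prod_nonneg\<close>)
  also have "(\<Sum>G\<in>{G\<in>Pow D. Q G}. (\<Prod>e\<in>D. if e \<in> G then p e else 1 - p e)) = gwt D p Q"
    unfolding gwt_def using fin by (intro sum.mono_neutral_cong_left) auto
  finally show "emeasure edge_space {U \<in> space edge_space. Q {e\<in>D. U e < p e}} = ennreal (gwt D p Q)" .
qed

subsection \<open>Half-open cubes\<close>

text \<open>The closed cubes of the model share faces, whereas these cubes partition the space.
  Faces are null sets, so the uniform measure is the same
  (\<open>cube_measure_eq_density\<close>).\<close>

definition hcube :: "int^'d \<Rightarrow> (real^'d) set" where
  "hcube k = {x. \<forall>i. \<lfloor>x $ i\<rfloor> = k $ i}"

definition cube_measure :: "int^'d \<Rightarrow> (real^'d::finite) measure" where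
  "cube_measure k = uniform_measure lborel (unit_cube k)"

lemma AE_lborel_component_neq: "AE x in (lborel :: (real^'d::finite) measure). x $ i \<noteq> c"
proof -
  have "{x::real^'d. x $ i = c} = {x. x \<bullet> axis i 1 = c}" by (simp add: inner_axis)
  then have "negligible {x::real^'d. x $ i = c}"
    using negligible_standard_hyperplane[of "axis i 1 :: real^'d" c] by (simp add: axis_in_Basis_iff)
  moreover have "{x::real^'d. x $ i = c} \<in> sets lborel" by simp
  ultimately have "{x::real^'d. x $ i = c} \<in> null_sets lborel"
    by (simp add: negligible_iff_null_sets null_sets_completion_iff)
  from AE_not_in[OF this] show ?thesis by simp
qed

lemma hcube_sets [measurable]: "hcube k \<in> sets borel"
  unfolding hcube_def by measurable

lemma emeasure_unit_cube: "emeasure lborel (unit_cube k) = 1"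
proof -
  have "emeasure lborel (unit_cube k) = ennreal (measure lborel (unit_cube k))"
    unfolding unit_cube_def by (rule emeasure_eq_ennreal_measure) (use emeasure_lborel_cbox_finite in \<open>auto simp: less_top\<close>)
  also have "measure lborel (unit_cube k) = 1"
  proof -
    have ne: "cbox (\<chi> i. real_of_int (k$i)) (\<chi> i. real_of_int (k$i) + 1) \<noteq> {}"
      by (simp add: interval_ne_empty_cart)
    show ?thesis unfolding unit_cube_def by (simp add: content_cbox_cart[OF ne])
  qed
  finally show ?thesis by simp
qed

lemma cube_measure_eq_density: "cube_measure k = density lborel (indicator (hcube k))"
proof -
  have ae: "AE x in (lborel :: (real^'a) measure). \<forall>i. x $ i \<noteq> real_of_int (k $ i) + 1"
    by (subst AE_all_countable) (auto intro: AE_lborel_component_neq)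
  have "AE x in lborel. indicator (unit_cube k) x / emeasure lborel (unit_cube k) = (indicator (hcube k) x :: ennreal)"
    using ae
  proof eventually_elim
    case (elim x)
    have "x \<in> unit_cube k \<longleftrightarrow> (\<forall>i. real_of_int (k $ i) \<le> x $ i \<and> x $ i \<le> real_of_int (k $ i) + 1)"
      by (simp add: unit_cube_def mem_box_cart)
    also have "\<dots> \<longleftrightarrow> (\<forall>i. real_of_int (k $ i) \<le> x $ i \<and> x $ i < real_of_int (k $ i) + 1)"
      using elim by (simp add: order_less_le)
    also have "\<dots> \<longleftrightarrow> x \<in> hcube k" by (simp add: hcube_def floor_eq_iff)
    finally show ?case by (simp add: indicator_def emeasure_unit_cube divide_ennreal_def)
  qed
  then show ?thesis unfolding cube_measure_def uniform_measure_def
    by (intro density_cong) (auto simp: unit_cube_def)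
qed

lemma sets_cube_measure [measurable_cong, simp]: "sets (cube_measure k) = sets borel"
  by (simp add: cube_measure_def)

lemma space_cube_measure [simp]: "space (cube_measure k) = UNIV"
  by (simp add: cube_measure_def)

lemma prob_space_cube_measure: "prob_space (cube_measure k)"
  unfolding cube_measure_def by (rule prob_space_uniform_measure) (simp_all add: emeasure_unit_cube)

lemma AE_cube_measure: "AE x in cube_measure k. x \<in> hcube k"
  unfolding cube_measure_eq_density by (subst AE_density) (auto intro!: AE_I2 simp: indicator_def)

subsection \<open>Integration over product measures\<close>

lemma product_prob_spaceI: "(\<And>i. prob_space (M i)) \<Longrightarrow> product_prob_space M"
  by (simp add: product_prob_space_def product_sigma_finite_def product_prob_space_axioms_def
      prob_space_imp_sigma_finite)

lemma nn_integral_PiM_UNIV_restrict: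
  assumes M: "\<And>i. prob_space (M i)" and J: "finite J"
    and G: "G \<in> borel_measurable (PiM J M)"
  shows "(\<integral>\<^sup>+X. G (restrict X J) \<partial>PiM UNIV M) = (\<integral>\<^sup>+X. G X \<partial>PiM J M)"
proof -
  interpret product_prob_space M UNIV by (rule product_prob_spaceI) (rule M)
  have "(\<integral>\<^sup>+X. G X \<partial>PiM J M) = (\<integral>\<^sup>+X. G X \<partial>distr (PiM UNIV M) (PiM J M) (\<lambda>x. restrict x J))"
    using distr_PiM_restrict_finite[of J] J by simp
  also have "\<dots> = (\<integral>\<^sup>+X. G (restrict X J) \<partial>PiM UNIV M)"
    by (rule nn_integral_distr) (use G in \<open>auto intro!: measurable_restrict_subset\<close>)
  finally show ?thesis by simp
qed

lemma nn_integral_PiM_UNIV_prod: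
  assumes M: "\<And>i. prob_space (M i)" and J: "finite J"
    and f [measurable]: "\<And>i. i \<in> J \<Longrightarrow> f i \<in> borel_measurable (M i)"
  shows "(\<integral>\<^sup>+X. (\<Prod>i\<in>J. f i (X i)) \<partial>PiM UNIV M) = (\<Prod>i\<in>J. \<integral>\<^sup>+x. f i x \<partial>M i)"
proof -
  interpret product_prob_space M UNIV by (rule product_prob_spaceI) (rule M)
  have meas: "(\<lambda>X. \<Prod>i\<in>J. f i (X i)) \<in> borel_measurable (PiM J M)"
    by measurable
  have "(\<integral>\<^sup>+X. (\<Prod>i\<in>J. f i (X i)) \<partial>PiM UNIV M) = (\<integral>\<^sup>+X. (\<Prod>i\<in>J. f i (restrict X J i)) \<partial>PiM UNIV M)"
    by (intro nn_integral_cong prod.cong) auto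
  also have "\<dots> = (\<integral>\<^sup>+X. (\<Prod>i\<in>J. f i (X i)) \<partial>PiM J M)"
    by (rule nn_integral_PiM_UNIV_restrict[OF M J meas])
  also have "\<dots> = (\<Prod>i\<in>J. \<integral>\<^sup>+x. f i x \<partial>M i)"
    by (rule product_nn_integral_prod) (use J f in auto)
  finally show ?thesis .
qed

lemma nn_integral_PiM_UNIV_split:
  fixes M :: "'i \<Rightarrow> 'b measure" and f :: "'l \<Rightarrow> 'i"
  assumes M: "\<And>i. prob_space (M i)" and fin: "finite L" "finite R"
    and f: "inj_on f L" "R \<inter> f ` L = {}"
    and Phi [measurable]: "Phi \<in> borel_measurable (PiM L (\<lambda>l. M (f l)))"
    and g: "\<And>b. b \<in> R \<Longrightarrow> (\<lambda>(x, y). g b x y) \<in> borel_measurable (PiM L (\<lambda>l. M (f l)) \<Otimes>\<^sub>M M b)"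
  shows "(\<integral>\<^sup>+X. Phi (\<lambda>l\<in>L. X (f l)) * (\<Prod>b\<in>R. g b (\<lambda>l\<in>L. X (f l)) (X b)) \<partial>PiM UNIV M) =
     (\<integral>\<^sup>+x. Phi x * (\<Prod>b\<in>R. \<integral>\<^sup>+y. g b x y \<partial>M b) \<partial>PiM L (\<lambda>l. M (f l)))"
proof -
  interpret product_prob_space M UNIV by (rule product_prob_spaceI) (rule M)
  define J where "J = f ` L"
  have finJ: "finite J" using fin by (simp add: J_def)
  define r :: "('i \<Rightarrow> 'b) \<Rightarrow> 'l \<Rightarrow> 'b" where "r = (\<lambda>X. \<lambda>l\<in>L. X (f l))"
  define G where "G X = Phi (r X) * (\<Prod>b\<in>R. g b (r X) (X b))" for X
  have r_meas: "r \<in> measurable (PiM J' M) (PiM L (\<lambda>l. M (f l)))" if "J \<subseteq> J'" for J'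
    unfolding r_def
    by (intro measurable_restrict measurable_component_singleton) (use that in \<open>auto simp: J_def\<close>)
  have gm: "(\<lambda>X. g b (r X) (X b)) \<in> borel_measurable (PiM (J \<union> R) M)" if "b \<in> R" for b
  proof -
    have "(\<lambda>X. (r X, X b)) \<in> measurable (PiM (J \<union> R) M) (PiM L (\<lambda>l. M (f l)) \<Otimes>\<^sub>M M b)"
      by (intro measurable_Pair r_meas measurable_component_singleton) (use that in auto)
    from measurable_compose[OF this g[OF that]] show ?thesis by simp
  qed
  have gm': "(\<lambda>y. g b x y) \<in> borel_measurable (M b)" if "b \<in> R" "x \<in> space (PiM L (\<lambda>l. M (f l)))" for b x
    using measurable_Pair2[OF g[OF that(1)] that(2)] by simp
  have Gm: "G \<in> borel_measurable (PiM (J \<union> R) M)"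
    unfolding G_def
    by (intro borel_measurable_times_ennreal borel_measurable_prod_ennreal gm
        measurable_compose[OF r_meas Phi]) auto
  have "(\<integral>\<^sup>+X. Phi (\<lambda>l\<in>L. X (f l)) * (\<Prod>b\<in>R. g b (\<lambda>l\<in>L. X (f l)) (X b)) \<partial>PiM UNIV M)
     = (\<integral>\<^sup>+X. G (restrict X (J \<union> R)) \<partial>PiM UNIV M)"
  proof (intro nn_integral_cong)
    fix X
    have "r (restrict X (J \<union> R)) = r X" by (auto simp: r_def J_def)
    then show "Phi (\<lambda>l\<in>L. X (f l)) * (\<Prod>b\<in>R. g b (\<lambda>l\<in>L. X (f l)) (X b)) = G (restrict X (J \<union> R))"
      unfolding G_def by (simp add: r_def)
  qed
  also have "\<dots> = (\<integral>\<^sup>+X. G X \<partial>PiM (J \<union> R) M)"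
    by (rule nn_integral_PiM_UNIV_restrict[OF M _ Gm]) (use fin finJ in auto)
  also have "\<dots> = (\<integral>\<^sup>+u. (\<integral>\<^sup>+v. G (merge J R (u, v)) \<partial>PiM R M) \<partial>PiM J M)"
    by (rule product_nn_integral_fold[OF _ _ _ Gm]) (use fin finJ f(2) in \<open>auto simp: J_def\<close>)
  also have "\<dots> = (\<integral>\<^sup>+u. Phi (r u) * (\<Prod>b\<in>R. \<integral>\<^sup>+y. g b (r u) y \<partial>M b) \<partial>PiM J M)"
  proof (intro nn_integral_cong)
    fix u assume u: "u \<in> space (PiM J M)"
    have ru: "r u \<in> space (PiM L (\<lambda>l. M (f l)))"
      by (rule measurable_space[OF r_meas u]) simp
    have "(\<integral>\<^sup>+v. G (merge J R (u, v)) \<partial>PiM R M) = (\<integral>\<^sup>+v. Phi (r u) * (\<Prod>b\<in>R. g b (r u) (v b)) \<partial>PiM R M)"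
    proof (intro nn_integral_cong)
      fix v
      have "r (merge J R (u, v)) = r u" by (auto simp: r_def J_def merge_def)
      moreover have "merge J R (u, v) b = v b" if "b \<in> R" for b
        using that f(2) by (auto simp: merge_def J_def)
      ultimately show "G (merge J R (u, v)) = Phi (r u) * (\<Prod>b\<in>R. g b (r u) (v b))"
        by (simp add: G_def)
    qed
    also have "\<dots> = Phi (r u) * (\<integral>\<^sup>+v. (\<Prod>b\<in>R. g b (r u) (v b)) \<partial>PiM R M)"
    proof (rule nn_integral_cmult)
      have "(\<lambda>v. g b (r u) (v b)) \<in> borel_measurable (PiM R M)" if b: "b \<in> R" for b
        using measurable_component_singleton[OF b, of M] gm'[OF b ru] by (rule measurable_compose)
      then show "(\<lambda>v. \<Prod>b\<in>R. g b (r u) (v b)) \<in> borel_measurable (PiM R M)"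
        by (rule borel_measurable_prod_ennreal)
    qed
    also have "(\<integral>\<^sup>+v. (\<Prod>b\<in>R. g b (r u) (v b)) \<partial>PiM R M) = (\<Prod>b\<in>R. \<integral>\<^sup>+y. g b (r u) y \<partial>M b)"
      by (rule product_nn_integral_prod) (use fin gm'[OF _ ru] in auto)
    finally show "(\<integral>\<^sup>+v. G (merge J R (u, v)) \<partial>PiM R M) = Phi (r u) * (\<Prod>b\<in>R. \<integral>\<^sup>+y. g b (r u) y \<partial>M b)" .
  qed
  also have "\<dots> = (\<integral>\<^sup>+x. Phi x * (\<Prod>b\<in>R. \<integral>\<^sup>+y. g b x y \<partial>M b)
      \<partial>distr (PiM J M) (PiM L (\<lambda>l. M (f l))) r)"
  proof (rule nn_integral_distr[symmetric])
    show "r \<in> measurable (PiM J M) (PiM L (\<lambda>l. M (f l)))" by (rule r_meas) simp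
    have "(\<lambda>x. \<integral>\<^sup>+y. g b x y \<partial>M b) \<in> borel_measurable (PiM L (\<lambda>l. M (f l)))" if "b \<in> R" for b
      by (rule sigma_finite_measure.borel_measurable_nn_integral)
        (use g[OF that] M in \<open>auto intro: prob_space_imp_sigma_finite\<close>)
    then show "(\<lambda>x. Phi x * (\<Prod>b\<in>R. \<integral>\<^sup>+y. g b x y \<partial>M b)) \<in>
        borel_measurable (distr (PiM J M) (PiM L (\<lambda>l. M (f l))) r)"
      unfolding measurable_distr_eq1
      by (intro borel_measurable_times_ennreal borel_measurable_prod_ennreal Phi)
  qed
  also have "distr (PiM J M) (PiM L (\<lambda>l. M (f l))) r = PiM L (\<lambda>l. M (f l))"
    unfolding r_def by (rule distr_PiM_reindex) (use M f in \<open>auto simp: J_def\<close>)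
  finally show ?thesis .
qed

text \<open>Serves to write the law of points in prescribed cubes as Lebesgue measure restricted to
  a product of cubes; the restrictions for different prescriptions can then be added up.\<close>

lemma PiM_density_indicator:
  assumes N: "\<And>l. sigma_finite_measure (N l)" and L: "finite L"
    and A: "\<And>l. l \<in> L \<Longrightarrow> A l \<in> sets (N l)"
    and M: "\<And>l. sigma_finite_measure (M l)" "\<And>l. l \<in> L \<Longrightarrow> M l = density (N l) (indicator (A l))"
  shows "PiM L M = density (PiM L N) (\<lambda>x. \<Prod>l\<in>L. indicator (A l) (x l))"
proof -
  interpret N: product_sigma_finite N using N by (simp add: product_sigma_finite_def)
  interpret M: product_sigma_finite M using M by (simp add: product_sigma_finite_def)
  have sets_eq: "sets (PiM L M) = sets (PiM L N)"
    by (rule sets_PiM_cong) (use M(2) in auto)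
  have ind_meas: "(\<lambda>x. \<Prod>l\<in>L. indicator (A l) (x l) :: ennreal) \<in> borel_measurable (PiM L N)"
    using A by measurable
  show ?thesis
  proof (rule M.PiM_eqI[OF L, symmetric])
    show "sets (density (PiM L N) (\<lambda>x. \<Prod>l\<in>L. indicator (A l) (x l))) = sets (PiM L M)"
      by (simp add: sets_eq)
  next
    fix B assume B: "\<And>i. i \<in> L \<Longrightarrow> B i \<in> sets (M i)"
    have B': "\<And>i. i \<in> L \<Longrightarrow> B i \<in> sets (N i)" using B M(2) by auto
    have "emeasure (density (PiM L N) (\<lambda>x. \<Prod>l\<in>L. indicator (A l) (x l))) (Pi\<^sub>E L B) =
      (\<integral>\<^sup>+x. (\<Prod>l\<in>L. indicator (A l) (x l)) * indicator (Pi\<^sub>E L B) x \<partial>PiM L N)"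
      by (rule emeasure_density[OF ind_meas]) (use L B' in \<open>auto intro!: sets_PiM_I_finite\<close>)
    also have "\<dots> = (\<integral>\<^sup>+x. (\<Prod>l\<in>L. indicator (A l) (x l) * indicator (B l) (x l)) \<partial>PiM L N)"
    proof (intro nn_integral_cong)
      fix x assume x: "x \<in> space (PiM L N)"
      have "indicator (Pi\<^sub>E L B) x = (\<Prod>l\<in>L. indicator (B l) (x l) :: ennreal)"
        using x L by (auto simp: indicator_def space_PiM PiE_def Pi_def prod_zero_iff)
      then show "(\<Prod>l\<in>L. indicator (A l) (x l)) * indicator (Pi\<^sub>E L B) x =
          (\<Prod>l\<in>L. indicator (A l) (x l) * indicator (B l) (x l) :: ennreal)"
        by (simp add: prod.distrib)
    qed
    also have "\<dots> = (\<Prod>l\<in>L. \<integral>\<^sup>+y. indicator (A l) y * indicator (B l) y \<partial>N l)"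
      by (rule N.product_nn_integral_prod[OF L]) (use A B' in auto)
    also have "\<dots> = (\<Prod>l\<in>L. emeasure (M l) (B l))"
    proof (intro prod.cong refl)
      fix l assume l: "l \<in> L"
      show "(\<integral>\<^sup>+y. indicator (A l) y * indicator (B l) y \<partial>N l) = emeasure (M l) (B l)"
        unfolding M(2)[OF l] by (rule emeasure_density[symmetric]) (use A B' l in auto)
    qed
    finally show "emeasure (density (PiM L N) (\<lambda>x. \<Prod>l\<in>L. indicator (A l) (x l))) (Pi\<^sub>E L B) = (\<Prod>l\<in>L. emeasure (M l) (B l))" .
  qed
qed

subsection \<open>Factorial moments of the Poisson distribution\<close>

text \<open>The falling factorial. Truncated subtraction makes it vanish for \<open>n < s\<close>,
  as the number of injections should.\<close>

definition ffact :: "nat \<Rightarrow> nat \<Rightarrow> nat" where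
  "ffact n s = (\<Prod>i<s. n - i)"

lemma ffact_Suc: "ffact n (Suc s) = ffact n s * (n - s)"
  by (simp add: ffact_def)

lemma ffact_add_mult_fact: "ffact (m + s) s * fact m = (fact (m + s) :: nat)"
proof (induction s)
  case (Suc s)
  have "ffact (m + Suc s) (Suc s) = (m + Suc s) * ffact (m + s) s"
    unfolding ffact_def by (subst prod.lessThan_Suc_shift) simp
  then show ?case using Suc by (simp add: algebra_simps)
qed (simp add: ffact_def)

lemma ffact_eq_0: "n < s \<Longrightarrow> ffact n s = 0"
  unfolding ffact_def by (rule prod_zero) auto

text \<open>The falling factorial counts the choices of \<open>s\<close> labelled points in a cube,
  and \<open>h\<close> is the acceptance probability of each of the other \<open>n - s\<close>. It
  cancels the first \<open>s\<close> factors of \<open>n!\<close>, so after a shift by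
  \<open>s\<close> the exponential series of \<open>lam * h\<close> remains.\<close>

lemma nn_integral_poisson_ffact:
  assumes lam: "0 < lam" and h: "0 \<le> h"
  shows "(\<integral>\<^sup>+n. ennreal (real (ffact n s) * h ^ (n - s)) \<partial>measure_pmf (poisson_pmf lam)) =
     ennreal (lam ^ s * exp (- lam * (1 - h)))"
proof -
  define t where "t n = lam ^ n / fact n * exp (- lam) * (real (ffact n s) * h ^ (n - s))" for n
  have "(\<lambda>m. (lam ^ s * exp (- lam)) * ((lam * h) ^ m /\<^sub>R fact m)) sums ((lam ^ s * exp (- lam)) * exp (lam * h))"
    by (intro sums_mult exp_converges)
  also have "(\<lambda>m. (lam ^ s * exp (- lam)) * ((lam * h) ^ m /\<^sub>R fact m)) = (\<lambda>m. t (m + s))"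
  proof
    fix m
    have "real (ffact (m + s) s) * fact m = fact (m + s)"
      using arg_cong[OF ffact_add_mult_fact[of m s], of real] by (simp only: of_nat_mult of_nat_fact)
    then have "real (ffact (m + s) s) / fact (m + s) = 1 / fact m"
      by (simp add: field_simps)
    moreover have "t (m + s) = (real (ffact (m + s) s) / fact (m + s)) * (lam ^ (m + s) * exp (- lam) * h ^ m)"
      by (simp add: t_def divide_inverse mult_ac)
    ultimately have "t (m + s) = (1 / fact m) * (lam ^ (m + s) * exp (- lam) * h ^ m)"
      by (simp only:)
    then show "(lam ^ s * exp (- lam)) * ((lam * h) ^ m /\<^sub>R fact m) = t (m + s)"
      by (simp add: power_add power_mult_distrib divide_inverse mult_ac scaleR_conv_of_real)
  qed
  also have "(\<lambda>m. t (m + s)) sums ((lam ^ s * exp (- lam)) * exp (lam * h)) \<longleftrightarrow>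
      t sums ((lam ^ s * exp (- lam)) * exp (lam * h))"
    by (rule sums_zero_iff_shift) (simp add: t_def ffact_eq_0)
  finally have sums: "t sums (lam ^ s * exp (- lam * (1 - h)))"
    by (simp add: exp_add[symmetric] algebra_simps)
  have t0: "0 \<le> t n" for n using lam h by (simp add: t_def)
  have "(\<integral>\<^sup>+n. ennreal (real (ffact n s) * h ^ (n - s)) \<partial>measure_pmf (poisson_pmf lam)) = (\<Sum>n. ennreal (t n))"
  proof -
    have "ennreal (pmf (poisson_pmf lam) n) * ennreal (real (ffact n s) * h ^ (n - s)) = ennreal (t n)" for n
      unfolding pmf_poisson[OF lam] t_def
      by (rule ennreal_mult'[symmetric]) (use lam in \<open>simp add: less_imp_le\<close>)
    then show ?thesis by (simp add: nn_integral_measure_pmf nn_integral_count_space_nat)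
  qed
  also have "\<dots> = ennreal (lam ^ s * exp (- lam * (1 - h)))"
    using suminf_ennreal_eq[OF t0 sums] by simp
  finally show ?thesis .
qed

text \<open>Labels destined for the same cube need distinct indices below its count, which gives one
  falling factorial per cube. The induction adds a label \<open>l0\<close> and excludes the indices
  that earlier labels occupy in its cube.\<close>

lemma card_injections_fibred:
  fixes kap :: "'l \<Rightarrow> 'k" and N :: "'k \<Rightarrow> nat"
  assumes L: "finite L" and K: "finite K" "kap ` L \<subseteq> K"
  defines "S \<equiv> \<lambda>L. {f \<in> L \<rightarrow>\<^sub>E UNIV. inj_on f L \<and> (\<forall>l\<in>L. fst (f l) = kap l \<and> snd (f l) < N (kap l))}"
  shows "finite (S L) \<and> card (S L) = (\<Prod>k\<in>K. ffact (N k) (card {l\<in>L. kap l = k}))"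
  using L K(2)
proof (induction L rule: finite_induct)
  case empty
  have "S {} = {\<lambda>_. undefined}" by (auto simp: S_def)
  then show ?case by (simp add: ffact_def)
next
  case (insert l0 L)
  let ?s = "\<lambda>L k. card {l\<in>L. kap l = k}"
  define k0 where "k0 = kap l0"
  have IH: "finite (S L)" "card (S L) = (\<Prod>k\<in>K. ffact (N k) (?s L k))" using insert by auto
  define C where "C f = {k0} \<times> {..<N k0} - f ` L" for f :: "'l \<Rightarrow> 'k \<times> nat"
  have cardC: "card (C f) = N k0 - ?s L k0" if f: "f \<in> S L" for f
  proof -
    have inj: "inj_on f L" using f by (simp add: S_def)
    have "{k0} \<times> {..<N k0} \<inter> f ` L = f ` {l\<in>L. kap l = k0}"
    proof (intro equalityI subsetI)
      fix y assume "y \<in> {k0} \<times> {..<N k0} \<inter> f ` L"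
      then obtain l where l: "l \<in> L" "y = f l" and "y \<in> {k0} \<times> {..<N k0}" by blast
      then have "fst y = k0" by (simp add: mem_Times_iff)
      then have "kap l = k0" using f l by (auto simp: S_def)
      with l show "y \<in> f ` {l\<in>L. kap l = k0}" by auto
    next
      fix y assume "y \<in> f ` {l\<in>L. kap l = k0}"
      then obtain l where l: "l \<in> L" "kap l = k0" "y = f l" by auto
      then have "fst y = k0" "snd y < N k0" using f by (auto simp: S_def)
      with l show "y \<in> {k0} \<times> {..<N k0} \<inter> f ` L" by (simp add: mem_Times_iff)
    qed
    moreover have "card (f ` {l\<in>L. kap l = k0}) = ?s L k0"
      by (rule card_image) (use inj in \<open>auto intro: inj_on_subset\<close>)
    ultimately show ?thesis unfolding C_def
      using insert.hyps by (subst card_Diff_subset_Int) (auto simp: card_cartesian_product)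
  qed
  have img: "S (insert l0 L) = (\<lambda>(f, y). f(l0 := y)) ` (SIGMA f:S L. C f)"
  proof (intro equalityI subsetI)
    fix f assume f: "f \<in> S (insert l0 L)"
    have "restrict f L \<in> S L" using f by (auto simp: S_def inj_on_def)
    moreover have "f l0 \<in> C (restrict f L)"
      using f insert.hyps by (cases "f l0") (auto simp: S_def C_def k0_def inj_on_def)
    moreover have "f = (restrict f L)(l0 := f l0)"
      using f by (auto simp: S_def fun_eq_iff PiE_def extensional_def restrict_def)
    ultimately show "f \<in> (\<lambda>(f, y). f(l0 := y)) ` (SIGMA f:S L. C f)"
      by (intro image_eqI[of _ _ "(restrict f L, f l0)"]) auto
  next
    fix f assume "f \<in> (\<lambda>(f, y). f(l0 := y)) ` (SIGMA f:S L. C f)"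
    then obtain g y where g: "g \<in> S L" "y \<in> C g" "f = g(l0 := y)" by auto
    have "inj_on f (insert l0 L)"
    proof -
      have "inj_on g L" "y \<notin> g ` L" using g by (auto simp: S_def C_def)
      moreover have "f l = g l" if "l \<in> L" for l using that g(3) insert.hyps by auto
      ultimately have "inj_on f L" "f l0 \<notin> f ` L"
        using g(3) inj_on_cong[of L f g] by auto
      then show ?thesis using insert.hyps by (simp add: inj_on_insert)
    qed
    moreover have "f \<in> insert l0 L \<rightarrow>\<^sub>E UNIV" using g by (auto simp: S_def PiE_def extensional_def)
    moreover have "\<forall>l\<in>insert l0 L. fst (f l) = kap l \<and> snd (f l) < N (kap l)"
      using g insert.hyps by (auto simp: S_def C_def k0_def)
    ultimately show "f \<in> S (insert l0 L)" by (simp add: S_def)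
  qed
  have inj: "inj_on (\<lambda>(f, y). f(l0 := y)) (SIGMA f:S L. C f)"
  proof (rule inj_onI, clarify)
    fix f y f' y' assume *: "f \<in> S L" "f' \<in> S L" "f(l0 := y) = f'(l0 := y')"
    then have "f l = f' l" for l
    proof (cases "l = l0")
      case True
      then show ?thesis using * insert.hyps by (auto simp: S_def PiE_def extensional_def)
    next
      case False
      then show ?thesis using fun_cong[OF *(3), of l] by simp
    qed
    with fun_cong[OF *(3), of l0] show "f = f' \<and> y = y'" by auto
  qed
  have finC: "finite (C f)" for f by (auto simp: C_def)
  have "card (S (insert l0 L)) = (\<Sum>f\<in>S L. card (C f))"
    unfolding img by (subst card_image[OF inj], subst card_SigmaI) (use IH finC in auto)
  also have "\<dots> = card (S L) * (N k0 - ?s L k0)" by (simp add: cardC)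
  also have "\<dots> = (\<Prod>k\<in>K. ffact (N k) (?s (insert l0 L) k))"
  proof -
    have k0: "k0 \<in> K" using insert by (simp add: k0_def)
    have s0: "?s (insert l0 L) k0 = Suc (?s L k0)"
    proof -
      have "{l\<in>insert l0 L. kap l = k0} = insert l0 {l\<in>L. kap l = k0}" by (auto simp: k0_def)
      then show ?thesis using insert by simp
    qed
    have s1: "?s (insert l0 L) k = ?s L k" if "k \<noteq> k0" for k
    proof -
      have "{l\<in>insert l0 L. kap l = k} = {l\<in>L. kap l = k}" using that by (auto simp: k0_def)
      then show ?thesis by simp
    qed
    have "(\<Prod>k\<in>K. ffact (N k) (?s (insert l0 L) k)) =
        ffact (N k0) (Suc (?s L k0)) * (\<Prod>k\<in>K-{k0}. ffact (N k) (?s L k))"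
      unfolding prod.remove[OF K(1) k0] s0
      by (intro arg_cong2[where f="(*)"] refl prod.cong) (use s1 in auto)
    also have "\<dots> = card (S L) * (N k0 - ?s L k0)"
      unfolding IH(2) prod.remove[OF K(1) k0] by (simp add: ffact_Suc)
    finally show ?thesis by simp
  qed
  finally show ?case using IH(1) finC by (simp add: img finite_SigmaI)
qed

subsection \<open>A Mecke formula\<close>

definition poisson_counts :: "real \<Rightarrow> (int^'d::finite \<Rightarrow> nat) measure" where
  "poisson_counts lam = PiM UNIV (\<lambda>k::int^'d. measure_pmf (poisson_pmf lam))"

definition pos_space :: "((int^'d) \<times> nat \<Rightarrow> real^'d::finite) measure" where
  "pos_space = PiM UNIV (\<lambda>kj. cube_measure (fst kj))"

definition box_points :: "(int^'d) set \<Rightarrow> (int^'d \<Rightarrow> nat) \<Rightarrow> ((int^'d) \<times> nat) set" where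
  "box_points K N = {(k, j). k \<in> K \<and> j < N k}"

definition labellings :: "'l set \<Rightarrow> 'b set \<Rightarrow> ('l \<Rightarrow> 'b) set" where
  "labellings L B = {f \<in> L \<rightarrow>\<^sub>E B. inj_on f L}"

lemma finite_box_points [simp]: "finite K \<Longrightarrow> finite (box_points K N)"
  by (rule finite_subset[of _ "\<Union>k\<in>K. {k} \<times> {..<N k}"]) (auto simp: box_points_def)

lemma finite_labellings [simp]: "finite L \<Longrightarrow> finite B \<Longrightarrow> finite (labellings L B)"
  unfolding labellings_def by (rule finite_subset[of _ "L \<rightarrow>\<^sub>E B"]) (auto intro: finite_PiE)

lemma prob_space_poisson_counts: "prob_space (poisson_counts lam)"
  unfolding poisson_counts_def by (rule prob_space_PiM) (rule prob_space_measure_pmf)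

lemma prob_space_pos_space: "prob_space pos_space"
  unfolding pos_space_def by (rule prob_space_PiM) (rule prob_space_cube_measure)

lemma poisson_counts_component:
  "(\<lambda>N. N k) \<in> measurable (poisson_counts lam) (count_space UNIV)"
proof -
  have "(\<lambda>N. N k) \<in> measurable (poisson_counts lam) (measure_pmf (poisson_pmf lam))"
    unfolding poisson_counts_def by (rule measurable_component_singleton) simp
  then show ?thesis by (simp cong: measurable_cong_sets)
qed

lemma pos_space_component: "(\<lambda>X. X b) \<in> borel_measurable pos_space"
proof -
  have "(\<lambda>X. X b) \<in> measurable pos_space (cube_measure (fst b))"
    unfolding pos_space_def by (rule measurable_component_singleton) simp
  then show ?thesis by (simp cong: measurable_cong_sets)
qed

lemma prod_box_points_Diff:
  fixes h :: "int^'d \<Rightarrow> 'a::comm_monoid_mult"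
  assumes K: "finite K" and L: "finite L" and f: "f \<in> labellings L (box_points K N)"
  shows "(\<Prod>b\<in>box_points K N - f ` L. h (fst b)) = (\<Prod>k\<in>K. h k ^ (N k - card {l\<in>L. fst (f l) = k}))"
proof -
  let ?B = "box_points K N - f ` L"
  have "(\<Prod>b\<in>?B. h (fst b)) = (\<Prod>k\<in>K. \<Prod>b\<in>{b\<in>?B. fst b = k}. h (fst b))"
    by (rule prod.group[symmetric]) (use K in \<open>auto simp: box_points_def intro!: finite_Diff finite_box_points[unfolded box_points_def]\<close>)
  also have "\<dots> = (\<Prod>k\<in>K. h k ^ (N k - card {l\<in>L. fst (f l) = k}))"
  proof (intro prod.cong refl)
    fix k assume k: "k \<in> K"
    have fl: "f l \<in> box_points K N" if "l \<in> L" for l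
      using that f by (auto simp: labellings_def)
    have inj: "inj_on f {l\<in>L. fst (f l) = k}"
      using f by (auto simp: labellings_def intro: inj_on_subset)
    have eq: "{b\<in>?B. fst b = k} = {k} \<times> {..<N k} - f ` {l\<in>L. fst (f l) = k}"
    proof (intro equalityI subsetI)
      fix b assume "b \<in> {b\<in>?B. fst b = k}"
      then show "b \<in> {k} \<times> {..<N k} - f ` {l\<in>L. fst (f l) = k}" by (auto simp: box_points_def)
    next
      fix b assume b: "b \<in> {k} \<times> {..<N k} - f ` {l\<in>L. fst (f l) = k}"
      then have "fst b = k" "b \<in> box_points K N" using k by (auto simp: box_points_def)
      with b show "b \<in> {b\<in>?B. fst b = k}" by blast
    qed
    have sub: "f ` {l\<in>L. fst (f l) = k} \<subseteq> {k} \<times> {..<N k}"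
    proof
      fix b assume "b \<in> f ` {l\<in>L. fst (f l) = k}"
      then have "b \<in> box_points K N" "fst b = k" using fl by auto
      then show "b \<in> {k} \<times> {..<N k}" by (auto simp: box_points_def)
    qed
    have "card {b\<in>?B. fst b = k} = N k - card {l\<in>L. fst (f l) = k}"
      unfolding eq using sub L
      by (subst card_Diff_subset) (auto simp: card_image[OF inj] card_cartesian_product)
    moreover have "(\<Prod>b\<in>{b\<in>?B. fst b = k}. h (fst b)) = (\<Prod>b\<in>{b\<in>?B. fst b = k}. h k)"
      by (intro prod.cong) auto
    ultimately show "(\<Prod>b\<in>{b\<in>?B. fst b = k}. h (fst b)) = h k ^ (N k - card {l\<in>L. fst (f l) = k})"
      by simp
  qed
  finally show ?thesis .
qed

text \<open>A position integral depends on a labelling only through the cubes of the labelled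
  points. Grouping by this assignment \<open>kap\<close> leaves a product of falling factorials, the
  form that Poisson moments evaluate.\<close>

lemma sum_labellings_eq:
  fixes T :: "('l \<Rightarrow> int^'d) \<Rightarrow> ennreal"
  assumes K: "finite K" and L: "finite L"
  shows "(\<Sum>f\<in>labellings L (box_points K N). T (\<lambda>l\<in>L. fst (f l))) =
    (\<Sum>kap\<in>L \<rightarrow>\<^sub>E K. of_nat (\<Prod>k\<in>K. ffact (N k) (card {l\<in>L. kap l = k})) * T kap)"
proof -
  let ?F = "labellings L (box_points K N)"
  let ?p = "\<lambda>f. \<lambda>l\<in>L. fst (f l)"
  have finF: "finite ?F" using K L by simp
  have "(\<Sum>f\<in>?F. T (?p f)) = (\<Sum>kap\<in>L \<rightarrow>\<^sub>E K. \<Sum>f\<in>{f\<in>?F. ?p f = kap}. T (?p f))"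
  proof (rule sum.group[symmetric, OF finF])
    show "finite (L \<rightarrow>\<^sub>E K)" using K L by (auto intro: finite_PiE)
    show "?p ` ?F \<subseteq> L \<rightarrow>\<^sub>E K"
      by (auto simp: labellings_def box_points_def PiE_def Pi_def split: prod.splits) (metis fst_conv prod.exhaust)
  qed
  also have "\<dots> = (\<Sum>kap\<in>L \<rightarrow>\<^sub>E K. of_nat (\<Prod>k\<in>K. ffact (N k) (card {l\<in>L. kap l = k})) * T kap)"
  proof (intro sum.cong refl)
    fix kap assume kap: "kap \<in> L \<rightarrow>\<^sub>E K"
    have "{f\<in>?F. ?p f = kap} =
      {f \<in> L \<rightarrow>\<^sub>E UNIV. inj_on f L \<and> (\<forall>l\<in>L. fst (f l) = kap l \<and> snd (f l) < N (kap l))}" (is "?X = ?Y")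
    proof (intro equalityI subsetI)
      fix f assume f: "f \<in> ?X"
      have "fst (f l) = kap l" if "l \<in> L" for l
        using f that by (auto simp: fun_eq_iff split: if_splits)
      moreover have "snd (f l) < N (fst (f l))" if "l \<in> L" for l
      proof -
        have "f l \<in> box_points K N" using f that by (auto simp: labellings_def)
        then show ?thesis by (auto simp: box_points_def)
      qed
      ultimately show "f \<in> ?Y" using f by (auto simp: labellings_def)
    next
      fix f assume f: "f \<in> ?Y"
      have "f l \<in> box_points K N" if "l \<in> L" for l
      proof -
        have "fst (f l) \<in> K" "snd (f l) < N (fst (f l))" using f that kap by (auto simp: PiE_iff)
        then show ?thesis by (simp add: box_points_def case_prod_unfold)
      qed
      moreover have "?p f = kap" using f kap by (auto simp: fun_eq_iff PiE_def extensional_def)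
      ultimately show "f \<in> ?X" using f by (auto simp: labellings_def)
    qed
    then have "card {f\<in>?F. ?p f = kap} = (\<Prod>k\<in>K. ffact (N k) (card {l\<in>L. kap l = k}))"
      using conjunct2[OF card_injections_fibred[OF L K, of kap N]] kap by (simp only:) (auto simp: PiE_iff)
    moreover have "(\<Sum>f\<in>{f\<in>?F. ?p f = kap}. T (?p f)) = (\<Sum>f\<in>{f\<in>?F. ?p f = kap}. T kap)"
      by (intro sum.cong) auto
    ultimately show "(\<Sum>f\<in>{f\<in>?F. ?p f = kap}. T (?p f)) = of_nat (\<Prod>k\<in>K. ffact (N k) (card {l\<in>L. kap l = k})) * T kap"
      by simp
  qed
  finally show ?thesis .
qed

lemma sum_card_fibres: "finite K \<Longrightarrow> finite L \<Longrightarrow> kap ` L \<subseteq> K \<Longrightarrow> (\<Sum>k\<in>K. card {l\<in>L. kap l = k}) = card L"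
  using sum.group[of L K kap "\<lambda>_. 1::nat"] by simp

text \<open>The multivariate Mecke equation on the cubes \<open>K\<close>, combined with the
  generating functional of the unlabelled points: \<open>g x y\<close> is the probability that a
  further point at \<open>y\<close> is harmless to the labelled ones at \<open>x\<close>. Positions
  are integrated for fixed counts, the counts follow by Poisson factorial moments, and the cubes are
  reassembled into Lebesgue measure.\<close>

lemma mecke_formula:
  fixes Phi :: "('l \<Rightarrow> real^'d::finite) \<Rightarrow> ennreal" and g :: "('l \<Rightarrow> real^'d) \<Rightarrow> real^'d \<Rightarrow> real"
  assumes L: "finite L" and K: "finite K" and lam: "0 < lam"
    and Phi: "Phi \<in> borel_measurable (PiM L (\<lambda>_. borel))"
    and g: "(\<lambda>(x, y). g x y) \<in> borel_measurable (PiM L (\<lambda>_. borel) \<Otimes>\<^sub>M borel)"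
    and g01: "\<And>x y. 0 \<le> g x y" "\<And>x y. g x y \<le> 1"
  shows "(\<integral>\<^sup>+N. \<integral>\<^sup>+X. (\<Sum>f\<in>labellings L (box_points K N). Phi (\<lambda>l\<in>L. X (f l)) *
        (\<Prod>b\<in>box_points K N - f ` L. ennreal (g (\<lambda>l\<in>L. X (f l)) (X b)))) \<partial>pos_space \<partial>poisson_counts lam) =
     ennreal (lam ^ card L) * (\<integral>\<^sup>+x. indicator (Pi\<^sub>E L (\<lambda>_. \<Union>k\<in>K. hcube k)) x * (Phi x *
        ennreal (exp (- lam * (\<Sum>k\<in>K. 1 - (LINT y|cube_measure k. g x y))))) \<partial>PiM L (\<lambda>_. lborel))"
proof -
  let ?t = "\<lambda>N f X. Phi (\<lambda>l\<in>L. X (f l)) * (\<Prod>b\<in>box_points K N - f ` L. ennreal (g (\<lambda>l\<in>L. X (f l)) (X b)))"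
  let ?u = "\<lambda>R f X. Phi (\<lambda>l\<in>L. X (f l)) * (\<Prod>b\<in>R. ennreal (g (\<lambda>l\<in>L. X (f l)) (X b)))"
  let ?F = "\<lambda>N. labellings L (box_points K N)"
  let ?N = "poisson_counts lam :: (int^'d \<Rightarrow> nat) measure"
  let ?B = "PiM L (\<lambda>_::'l. lborel :: (real^'d) measure)"
  let ?i = "\<lambda>kap x. \<Prod>l\<in>L. indicator (hcube (kap l :: int^'d)) (x l) :: ennreal"
  let ?P = "PiM L (\<lambda>_::'l. borel :: (real^'d) measure)"
  let ?M = "\<lambda>kap. PiM L (\<lambda>l. cube_measure (kap l :: int^'d))"
  let ?s = "\<lambda>kap k. card {l\<in>L. kap l = (k::int^'d)}"
  have sets_M: "sets (?M kap) = sets ?P" for kap by (rule sets_PiM_cong) auto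
  have sets_lb: "sets (PiM L (\<lambda>_::'l. lborel :: (real^'d) measure)) = sets ?P" by (rule sets_PiM_cong) auto
  interpret C: prob_space "cube_measure k" for k :: "int^'d" by (rule prob_space_cube_measure)
  interpret PN: prob_space "poisson_counts lam :: (int^'d \<Rightarrow> nat) measure"
    by (rule prob_space_poisson_counts)
  have psM: "prob_space (?M kap)" for kap
    by (rule prob_space_PiM) (rule prob_space_cube_measure)
  \<comment> \<open>The probability that one unlabelled point of cube \<open>k\<close> is harmless;
    only this number survives when its position is integrated out.\<close>
  define h where "h k x = (LINT y|cube_measure k. g x y)" for k x
  have g_y: "g x \<in> borel_measurable borel" if "x \<in> space ?P" for x
    using measurable_Pair2[OF g that] by simp
  have int_g: "integrable (cube_measure k) (g x)" if "x \<in> space ?P" for k x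
  proof (rule C.integrable_const_bound[of _ 1])
    show "g x \<in> borel_measurable (cube_measure k)"
      by (subst measurable_cong_sets[OF sets_cube_measure refl]) (rule g_y[OF that])
  qed (use g01 in auto)
  have h0: "0 \<le> h k x" for k x unfolding h_def by (rule Bochner_Integration.integral_nonneg) (use g01 in auto)
  have nn_h: "(\<integral>\<^sup>+y. ennreal (g x y) \<partial>cube_measure k) = ennreal (h k x)" if "x \<in> space ?P" for k x
    unfolding h_def by (rule nn_integral_eq_integral[OF int_g[OF that]]) (use g01 in auto)
  have h_meas: "h k \<in> borel_measurable ?P" for k
  proof -
    have "(\<lambda>(x, y). g x y) \<in> borel_measurable (?P \<Otimes>\<^sub>M cube_measure k)"
      using g by (subst measurable_cong_sets[OF sets_pair_measure_cong[OF refl sets_cube_measure] refl])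
    then show ?thesis unfolding h_def by (rule C.borel_measurable_lebesgue_integral)
  qed
  let ?w = "\<lambda>kap N k x. ennreal (real (ffact (N k) (?s kap k)) * h k x ^ (N k - ?s kap k))"
  let ?e = "\<lambda>x. exp (- lam * (\<Sum>k\<in>K. 1 - h k x))"
  \<comment> \<open>The integrand once all unlabelled positions are gone and the labellings with
    cube assignment \<open>kap\<close> have been counted.\<close>
  define W where "W kap N x = Phi x * (\<Prod>k\<in>K. ?w kap N k x)"
    for kap N x
  let ?I = "\<lambda>kap. \<integral>\<^sup>+N. \<integral>\<^sup>+x. W kap N x \<partial>?M kap \<partial>?N"
  have inner: "(\<integral>\<^sup>+X. (\<Sum>f\<in>?F N. ?t N f X) \<partial>pos_space) =
      (\<Sum>kap\<in>L \<rightarrow>\<^sub>E K. \<integral>\<^sup>+x. W kap N x \<partial>?M kap)" for N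
  proof -
    let ?T = "\<lambda>kap. \<integral>\<^sup>+x. Phi x * (\<Prod>k\<in>K. ennreal (h k x) ^ (N k - ?s kap k)) \<partial>?M kap"
    have r_meas: "(\<lambda>X. \<lambda>l\<in>L. X (f l)) \<in> measurable pos_space ?P" for f :: "'l \<Rightarrow> (int^'d) \<times> nat"
      by (intro measurable_restrict pos_space_component)
    have term_meas: "(\<lambda>X. ?u R f X) \<in> borel_measurable pos_space" for f R
    proof (intro borel_measurable_times_ennreal borel_measurable_prod_ennreal measurable_compose[OF _ measurable_ennreal])
      show "(\<lambda>X. Phi (\<lambda>l\<in>L. X (f l))) \<in> borel_measurable pos_space"
        by (rule measurable_compose[OF r_meas Phi])
      fix b :: "(int^'d) \<times> nat"
      from r_meas pos_space_component have "(\<lambda>X. (\<lambda>l\<in>L. X (f l), X b)) \<in> measurable pos_space (?P \<Otimes>\<^sub>M borel)"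
        by (rule measurable_Pair)
      from measurable_compose[OF this g] show "(\<lambda>X. g (\<lambda>l\<in>L. X (f l)) (X b)) \<in> borel_measurable pos_space"
        by simp
    qed
    have "(\<integral>\<^sup>+X. (\<Sum>f\<in>?F N. ?t N f X) \<partial>pos_space) =
      (\<Sum>f\<in>?F N. \<integral>\<^sup>+X. ?t N f X \<partial>pos_space)"
      by (rule nn_integral_sum) (rule term_meas)
    also have "\<dots> = (\<Sum>f\<in>?F N. ?T (\<lambda>l\<in>L. fst (f l)))"
    proof (intro sum.cong refl)
      fix f assume f: "f \<in> ?F N"
      have M_eq: "?M (\<lambda>l\<in>L. fst (f l)) = PiM L (\<lambda>l. cube_measure (fst (f l)))"
        by (rule PiM_cong) auto
      have sets_eq: "sets (PiM L (\<lambda>l. cube_measure (fst (f l)))) = sets ?P"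
        by (rule sets_PiM_cong) auto
      have "(\<integral>\<^sup>+X. ?t N f X \<partial>pos_space) =
        (\<integral>\<^sup>+x. Phi x * (\<Prod>b\<in>box_points K N - f ` L. \<integral>\<^sup>+y. ennreal (g x y) \<partial>cube_measure (fst b))
           \<partial>PiM L (\<lambda>l. cube_measure (fst (f l))))"
        unfolding pos_space_def
      proof (rule nn_integral_PiM_UNIV_split)
        show "inj_on f L" using f by (simp add: labellings_def)
        show "Phi \<in> borel_measurable (PiM L (\<lambda>l. cube_measure (fst (f l))))"
          using Phi by (simp add: measurable_cong_sets[OF sets_eq refl])
        show "(\<lambda>(x, y). ennreal (g x y)) \<in> borel_measurable (PiM L (\<lambda>l. cube_measure (fst (f l))) \<Otimes>\<^sub>M cube_measure (fst b))" for b
        proof -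
          have "(\<lambda>z. ennreal (case z of (x, y) \<Rightarrow> g x y)) \<in> borel_measurable (?P \<Otimes>\<^sub>M borel)"
            by (rule measurable_compose[OF g measurable_ennreal])
          also have "?this \<longleftrightarrow> ?thesis"
            by (subst measurable_cong_sets[OF sets_pair_measure_cong[OF sets_eq sets_cube_measure] refl])
              (simp add: case_prod_unfold)
          finally show ?thesis .
        qed
      qed (use K L prob_space_cube_measure in auto)
      also have "\<dots> = (\<integral>\<^sup>+x. Phi x * (\<Prod>k\<in>K. ennreal (h k x) ^ (N k - card {l\<in>L. fst (f l) = k}))
           \<partial>PiM L (\<lambda>l. cube_measure (fst (f l))))"
      proof (intro nn_integral_cong)
        fix x assume "x \<in> space (PiM L (\<lambda>l. cube_measure (fst (f l))))"
        then have x: "x \<in> space ?P" using sets_eq_imp_space_eq[OF sets_eq] by simp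
        show "Phi x * (\<Prod>b\<in>box_points K N - f ` L. \<integral>\<^sup>+y. ennreal (g x y) \<partial>cube_measure (fst b)) =
          Phi x * (\<Prod>k\<in>K. ennreal (h k x) ^ (N k - card {l\<in>L. fst (f l) = k}))"
          unfolding nn_h[OF x] prod_box_points_Diff[OF K L f, of "\<lambda>k. ennreal (h k x)"] ..
      qed
      also have "\<dots> = ?T (\<lambda>l\<in>L. fst (f l))"
      proof -
        have "{l\<in>L. (\<lambda>l\<in>L. fst (f l)) l = k} = {l\<in>L. fst (f l) = k}" for k by auto
        then show ?thesis unfolding M_eq by simp
      qed
      finally show "(\<integral>\<^sup>+X. ?t N f X \<partial>pos_space) = ?T (\<lambda>l\<in>L. fst (f l))" .
    qed
    also have "\<dots> = (\<Sum>kap\<in>L \<rightarrow>\<^sub>E K. of_nat (\<Prod>k\<in>K. ffact (N k) (?s kap k)) * ?T kap)"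
      by (rule sum_labellings_eq[OF K L])
    also have "\<dots> = (\<Sum>kap\<in>L \<rightarrow>\<^sub>E K. \<integral>\<^sup>+x. W kap N x \<partial>?M kap)"
    proof (intro sum.cong refl)
      fix kap
      have "of_nat (\<Prod>k\<in>K. ffact (N k) (?s kap k)) * ?T kap =
        (\<integral>\<^sup>+x. of_nat (\<Prod>k\<in>K. ffact (N k) (?s kap k)) * (Phi x * (\<Prod>k\<in>K. ennreal (h k x) ^ (N k - ?s kap k))) \<partial>?M kap)"
        by (rule nn_integral_cmult[symmetric], subst measurable_cong_sets[OF sets_M refl])
          (use Phi h_meas in measurable)
      also have "\<dots> = (\<integral>\<^sup>+x. W kap N x \<partial>?M kap)"
      proof (intro nn_integral_cong)
        fix x
        have "(\<Prod>k\<in>K. ?w kap N k x) =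
           (\<Prod>k\<in>K. of_nat (ffact (N k) (?s kap k)) * ennreal (h k x) ^ (N k - ?s kap k))"
          by (intro prod.cong refl) (simp add: ennreal_mult' ennreal_power h0 ennreal_of_nat_eq_real_of_nat)
        then show "of_nat (\<Prod>k\<in>K. ffact (N k) (?s kap k)) * (Phi x * (\<Prod>k\<in>K. ennreal (h k x) ^ (N k - ?s kap k))) = W kap N x"
          unfolding W_def by (simp add: prod.distrib mult_ac)
      qed
      finally show "of_nat (\<Prod>k\<in>K. ffact (N k) (?s kap k)) * ?T kap = (\<integral>\<^sup>+x. W kap N x \<partial>?M kap)" .
    qed
    finally show ?thesis .
  qed
  have W_meas: "(\<lambda>(N, x). W kap N x) \<in> borel_measurable (?N \<Otimes>\<^sub>M ?M kap)" for kap
  proof -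
    note poisson_counts_component [measurable]
    have [measurable]: "Phi \<in> borel_measurable (?M kap)" "h k \<in> borel_measurable (?M kap)" for k
      using Phi h_meas by (simp_all add: measurable_cong_sets[OF sets_M refl])
    have "(\<lambda>z. ennreal (real (ffact (fst z k) (?s kap k)) * h k (snd z) ^ (fst z k - ?s kap k)))
        \<in> borel_measurable (?N \<Otimes>\<^sub>M ?M kap)" for k
      by (rule measurable_compose_countable[where g = "\<lambda>z. fst z k" and
            f = "\<lambda>n z. ennreal (real (ffact n (?s kap k)) * h k (snd z) ^ (n - ?s kap k))"]) measurable
    then show ?thesis unfolding W_def case_prod_unfold
      by (intro borel_measurable_times_ennreal borel_measurable_prod_ennreal) measurable
  qed
  \<comment> \<open>With the counts as inner integral, independence over cubes gives a product of
    factorial moments; the exponents \<open>?s kap k\<close> add up to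
    \<open>card L\<close>.\<close>
  have swap: "?I kap =
      (\<integral>\<^sup>+x. ennreal (lam ^ card L) * (Phi x * ennreal (?e x)) \<partial>?M kap)"
    if kap: "kap \<in> L \<rightarrow>\<^sub>E K" for kap
  proof -
    interpret pair_sigma_finite "?M kap" ?N
      by (simp add: pair_sigma_finite_def psM[THEN prob_space_imp_sigma_finite] PN.sigma_finite_measure_axioms)
    have "?I kap =
       (\<integral>\<^sup>+x. \<integral>\<^sup>+N. W kap N x \<partial>?N \<partial>?M kap)"
      using Fubini'[of "\<lambda>x N. W kap N x"] measurable_compose[OF measurable_pair_swap' W_meas, of kap]
      by (simp add: case_prod_unfold)
    also have "\<dots> = (\<integral>\<^sup>+x. ennreal (lam ^ card L) * (Phi x * ennreal (?e x)) \<partial>?M kap)"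
    proof (intro nn_integral_cong)
      fix x
      have "(\<integral>\<^sup>+N. W kap N x \<partial>?N) = Phi x *
         (\<integral>\<^sup>+N. (\<Prod>k\<in>K. ?w kap N k x) \<partial>?N)"
        unfolding W_def poisson_counts_def by (rule nn_integral_cmult) simp
      also have "(\<integral>\<^sup>+N. (\<Prod>k\<in>K. ?w kap N k x) \<partial>?N) =
        (\<Prod>k\<in>K. \<integral>\<^sup>+n. ennreal (real (ffact n (?s kap k)) * h k x ^ (n - ?s kap k)) \<partial>measure_pmf (poisson_pmf lam))"
        unfolding poisson_counts_def
        by (rule nn_integral_PiM_UNIV_prod[where f = "\<lambda>k n. ennreal (real (ffact n (?s kap k)) * h k x ^ (n - ?s kap k))"])
          (use K in \<open>auto intro: prob_space_measure_pmf\<close>)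
      also have "\<dots> = (\<Prod>k\<in>K. ennreal (lam ^ ?s kap k * exp (- lam * (1 - h k x))))"
        by (intro prod.cong refl nn_integral_poisson_ffact lam h0)
      also have "\<dots> = ennreal (\<Prod>k\<in>K. lam ^ ?s kap k * exp (- lam * (1 - h k x)))"
        by (rule prod_ennreal) (use lam in auto)
      also have "(\<Prod>k\<in>K. lam ^ ?s kap k * exp (- lam * (1 - h k x))) = lam ^ card L * ?e x"
      proof -
        have "(\<Prod>k\<in>K. lam ^ ?s kap k) = lam ^ card L"
        proof -
          have "kap ` L \<subseteq> K" using kap by (auto simp: PiE_iff)
          from sum_card_fibres[OF K L this] show ?thesis by (simp add: power_sum[symmetric])
        qed
        moreover have "(\<Prod>k\<in>K. exp (- lam * (1 - h k x))) = ?e x"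
          by (simp add: exp_sum[OF K, symmetric] sum_distrib_left)
        ultimately show ?thesis by (simp add: prod.distrib)
      qed
      also have "ennreal (lam ^ card L * ?e x) =
          ennreal (lam ^ card L) * ennreal (?e x)"
        by (rule ennreal_mult) (use lam in auto)
      finally show "(\<integral>\<^sup>+N. W kap N x \<partial>?N) =
         ennreal (lam ^ card L) * (Phi x * ennreal (?e x))"
        by (simp add: mult_ac)
    qed
    finally show ?thesis .
  qed
  define Q where "Q x = Phi x * ennreal (?e x)" for x
  have Q_meas: "Q \<in> borel_measurable ?P"
    unfolding Q_def using Phi h_meas by measurable
  have Q_lb: "Q \<in> borel_measurable (?B)"
    using Q_meas by (simp add: measurable_cong_sets[OF sets_lb refl])
  have ind_lb: "(\<lambda>x. \<Prod>l\<in>L. indicator (hcube (kap l)) (x l) :: ennreal) \<in> borel_measurable (?B)" for kap :: "'l \<Rightarrow> int^'d"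
    by measurable
  have dens: "?M kap = density (?B) (\<lambda>x. \<Prod>l\<in>L. indicator (hcube (kap l)) (x l))" for kap
    by (rule PiM_density_indicator)
      (use L in \<open>auto simp: cube_measure_eq_density[symmetric] intro: sigma_finite_lborel
        prob_space_cube_measure[THEN prob_space_imp_sigma_finite]\<close>)
  have "(\<integral>\<^sup>+N. (\<Sum>kap\<in>L \<rightarrow>\<^sub>E K. \<integral>\<^sup>+x. W kap N x \<partial>?M kap) \<partial>?N) =
     (\<Sum>kap\<in>L \<rightarrow>\<^sub>E K. \<integral>\<^sup>+N. \<integral>\<^sup>+x. W kap N x \<partial>?M kap \<partial>?N)"
  proof (rule nn_integral_sum)
    fix kap
    interpret M: prob_space "?M kap" by (rule psM)
    show "(\<lambda>N. \<integral>\<^sup>+x. W kap N x \<partial>?M kap) \<in> borel_measurable (?N)"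
      by (rule M.borel_measurable_nn_integral[OF W_meas])
  qed
  also have "\<dots> = (\<Sum>kap\<in>L \<rightarrow>\<^sub>E K. ennreal (lam ^ card L) * (\<integral>\<^sup>+x. ?i kap x * Q x \<partial>?B))"
  proof (intro sum.cong refl)
    fix kap assume kap: "kap \<in> L \<rightarrow>\<^sub>E K"
    have "?I kap =
       (\<integral>\<^sup>+x. ennreal (lam ^ card L) * Q x \<partial>?M kap)"
      unfolding swap[OF kap] Q_def ..
    also have "\<dots> = ennreal (lam ^ card L) * (\<integral>\<^sup>+x. Q x \<partial>?M kap)"
      by (rule nn_integral_cmult) (use Q_meas in \<open>simp add: measurable_cong_sets[OF sets_M refl]\<close>)
    also have "(\<integral>\<^sup>+x. Q x \<partial>?M kap) = (\<integral>\<^sup>+x. ?i kap x * Q x \<partial>?B)"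
      unfolding dens by (rule nn_integral_density[OF ind_lb Q_lb])
    finally show "?I kap = ennreal (lam ^ card L) * \<dots>" .
  qed
  also have "\<dots> = ennreal (lam ^ card L) * (\<integral>\<^sup>+x. (\<Sum>kap\<in>L \<rightarrow>\<^sub>E K. ?i kap x * Q x) \<partial>?B)"
    unfolding sum_distrib_left[symmetric]
    by (subst nn_integral_sum) (use ind_lb Q_lb in auto)
  \<comment> \<open>Expanding a product of sums: since the half-open cubes are disjoint, summing
    over all assignments \<open>kap\<close> yields the indicator that every label lies in the union
    of the cubes.\<close>
  also have "(\<integral>\<^sup>+x. (\<Sum>kap\<in>L \<rightarrow>\<^sub>E K. ?i kap x * Q x) \<partial>?B) =
     (\<integral>\<^sup>+x. indicator (Pi\<^sub>E L (\<lambda>_. \<Union>k\<in>K. hcube k)) x * Q x \<partial>?B)"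
  proof (intro nn_integral_cong)
    fix x assume x: "x \<in> space (PiM L (\<lambda>_::'l. lborel :: (real^'d) measure))"
    have ind1: "(\<Sum>k\<in>K. indicator (hcube k) y :: ennreal) = indicator (\<Union>k\<in>K. hcube k) y" for y :: "real^'d"
      by (rule indicator_UN_disjoint[symmetric, OF K]) (auto simp: disjoint_family_on_def hcube_def vec_eq_iff)
    have "(\<Sum>kap\<in>L \<rightarrow>\<^sub>E K. ?i kap x) = (\<Prod>l\<in>L. \<Sum>k\<in>K. indicator (hcube k) (x l) :: ennreal)"
      by (rule prod_sum_PiE[symmetric]) (use L K in auto)
    also have "\<dots> = indicator (Pi\<^sub>E L (\<lambda>_. \<Union>k\<in>K. hcube k)) x"
      unfolding ind1 using L x by (auto simp: indicator_def space_PiM PiE_def Pi_def prod_zero_iff)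
    finally show "(\<Sum>kap\<in>L \<rightarrow>\<^sub>E K. ?i kap x * Q x) =
        indicator (Pi\<^sub>E L (\<lambda>_. \<Union>k\<in>K. hcube k)) x * Q x"
      by (simp add: sum_distrib_right[symmetric])
  qed
  finally show ?thesis unfolding inner Q_def h_def .
qed

subsection \<open>Connection functions\<close>

text \<open>Pairs are sets, so some orientation has to be chosen; symmetry of \<open>psi\<close>
  makes the choice immaterial (\<open>edge_prob_pair\<close>).\<close>

definition edge_prob :: "(real^'d \<Rightarrow> real) \<Rightarrow> ('v \<Rightarrow> real^'d) \<Rightarrow> 'v set \<Rightarrow> real" where
  "edge_prob psi x e = (let p = (SOME p. e = {fst p, snd p}) in psi (x (fst p) - x (snd p)))"

definition conn_weight :: "(real^'d \<Rightarrow> real) \<Rightarrow> 'v set \<Rightarrow> ('v \<Rightarrow> real^'d) \<Rightarrow> real" where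
  "conn_weight psi V x = gwt (vpairs V) (edge_prob psi x) (gconn V)"

definition avoid :: "(real^'d \<Rightarrow> real) \<Rightarrow> 'v set \<Rightarrow> ('v \<Rightarrow> real^'d) \<Rightarrow> real^'d \<Rightarrow> real" where
  "avoid psi V x y = (\<Prod>a\<in>V. 1 - psi (x a - y))"

text \<open>The volume \<open>V\<close> of the overview: \<open>lam * cover psi V x\<close> is the
  mean number of points of a Poisson process joined to at least one of the positions in
  \<open>V\<close>.\<close>

definition cover :: "(real^'d::finite \<Rightarrow> real) \<Rightarrow> 'v set \<Rightarrow> ('v \<Rightarrow> real^'d) \<Rightarrow> real" where
  "cover psi V x = (LINT y|lborel. 1 - avoid psi V x y)"

text \<open>Reach of a cluster with \<open>n\<close> vertices: \<open>n ^ 2\<close> bounds the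
  cluster itself (\<open>gconn_norm_bound\<close>), one unit is the range of \<open>psi\<close>, and
  one more absorbs rounding down to the cube index.\<close>

definition near_cubes :: "nat \<Rightarrow> (int^'d::finite) set" where
  "near_cubes n = {k. \<forall>i. \<bar>k $ i\<bar> \<le> int (n ^ 2) + 2}"

lemma finite_near_cubes [simp]: "finite (near_cubes n :: (int^'d::finite) set)"
proof -
  have "near_cubes n \<subseteq> (\<lambda>f. \<chi> i. f i) ` ((UNIV :: 'd set) \<rightarrow>\<^sub>E {- (int (n ^ 2) + 2)..int (n ^ 2) + 2})"
  proof
    fix k :: "int^'d" assume k: "k \<in> near_cubes n"
    have "k = (\<chi> i. (\<lambda>i. k $ i) i)" by (simp add: vec_eq_iff)
    moreover have "(\<lambda>i. k $ i) \<in> (UNIV :: 'd set) \<rightarrow>\<^sub>E {- (int (n ^ 2) + 2)..int (n ^ 2) + 2}"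
      using k by (auto simp: near_cubes_def abs_le_iff) (metis add.commute minus_add_distrib minus_le_iff uminus_add_conv_diff)
    ultimately show "k \<in> (\<lambda>f. \<chi> i. f i) ` ((UNIV :: 'd set) \<rightarrow>\<^sub>E {- (int (n ^ 2) + 2)..int (n ^ 2) + 2})"
      by (rule image_eqI)
  qed
  then show ?thesis by (rule finite_subset) (intro finite_imageI finite_PiE; simp)
qed

lemma hcube_near_cubes:
  assumes y: "y \<in> hcube k" and n: "norm y \<le> real (n ^ 2) + 1"
  shows "k \<in> near_cubes n"
  unfolding near_cubes_def
proof (intro CollectI allI)
  fix i
  have "\<bar>y $ i\<bar> \<le> real (n ^ 2) + 1" using n component_le_norm_cart[of y i] by linarith
  moreover have "k $ i = \<lfloor>y $ i\<rfloor>" using y by (simp add: hcube_def)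
  ultimately show "\<bar>k $ i\<bar> \<le> int (n ^ 2) + 2" by linarith
qed

text \<open>The length of a connecting path is bounded by the number of ordered open pairs, hence by
  \<open>card V ^ 2\<close>, and each step has length at most 1. The bound is crude, but any finite
  bound would do.\<close>

lemma gconn_norm_bound:
  fixes x :: "'v \<Rightarrow> real^'d::finite"
  assumes V: "finite V" and G: "gconn V G" "G \<subseteq> vpairs V"
    and step: "\<And>a b. {a, b} \<in> G \<Longrightarrow> norm (x a - x b) \<le> 1"
    and rv: "r \<in> V" "v \<in> V"
  shows "norm (x v - x r) \<le> real (card V ^ 2)"
proof -
  define R where "R = {(a, b). {a, b} \<in> G}"
  have sub: "R \<subseteq> V \<times> V"
  proof (clarsimp simp: R_def)
    fix a b assume "{a, b} \<in> G"
    then have "{a, b} \<in> vpairs V" using G by auto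
    then show "a \<in> V \<and> b \<in> V" by (auto simp: vpairs_def doubleton_eq_iff)
  qed
  then have fin: "finite R" using V by (auto intro: finite_subset)
  have "card R \<le> card (V \<times> V)" by (rule card_mono) (use V sub in auto)
  then have card: "card R \<le> card V ^ 2" by (simp add: card_cartesian_product power2_eq_square)
  have "(r, v) \<in> R\<^sup>*"
    using G(1) rv by (simp add: gconn_def R_def rtranclp_rtrancl_eq[symmetric])
  then obtain n where n: "n \<le> card R" "(r, v) \<in> R ^^ n" by (auto simp: rtrancl_finite_eq_relpow[OF fin])
  have "norm (x b - x r) \<le> real m" if "(r, b) \<in> R ^^ m" for m b
    using that
  proof (induction m arbitrary: b)
    case (Suc m)
    then obtain c where c: "(r, c) \<in> R ^^ m" "(c, b) \<in> R" by auto
    have "norm (x b - x r) \<le> norm (x b - x c) + norm (x c - x r)"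
      by (metis dist_norm dist_triangle)
    moreover have "norm (x b - x c) \<le> 1"
      using c(2) step[of c b] by (simp add: R_def norm_minus_commute)
    ultimately show ?case using Suc.IH[OF c(1)] by simp
  qed simp
  from this[OF n(2)] have "norm (x v - x r) \<le> real n" .
  also have "real n \<le> real (card V ^ 2)" using n(1) card by (simp only: of_nat_le_iff order_trans)
  finally show ?thesis .
qed

section \<open>The model as a product space, and its almost sure properties\<close>

declare poisson_counts_component [measurable] pos_space_component [measurable]

lemma edge_space_component [measurable]: "(\<lambda>U. U s) \<in> borel_measurable edge_space"
proof -
  have "(\<lambda>U. U s) \<in> measurable edge_space (uniform_measure lborel {0..1::real})"
    unfolding edge_space_def by (rule measurable_component_singleton) simp
  then show ?thesis by (simp cong: measurable_cong_sets)
qed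

lemma rcm_space_eq: "rcm_space lam = (poisson_counts lam \<Otimes>\<^sub>M pos_space) \<Otimes>\<^sub>M edge_space"
  by (simp add: rcm_space_def poisson_counts_def pos_space_def cube_measure_def edge_space_def)

lemma prob_space_edge_space: "prob_space edge_space"
  unfolding edge_space_def by (rule prob_space_PiM) (rule prob_space_uniform01)

lemma prob_space_pair_space: "prob_space (poisson_counts lam \<Otimes>\<^sub>M pos_space)"
  by (rule prob_space_pair) (rule prob_space_poisson_counts prob_space_pos_space)+

lemma prob_space_rcm_space: "prob_space (rcm_space lam)"
  unfolding rcm_space_eq by (rule prob_space_pair) (rule prob_space_pair_space prob_space_edge_space)+

lemma nn_integral_rcm_space:
  assumes F: "F \<in> borel_measurable (rcm_space lam)"
  shows "(\<integral>\<^sup>+w. F w \<partial>rcm_space lam) =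
    (\<integral>\<^sup>+N. \<integral>\<^sup>+X. \<integral>\<^sup>+U. F ((N, X), U) \<partial>edge_space \<partial>pos_space \<partial>poisson_counts lam)"
proof -
  interpret E: prob_space edge_space by (rule prob_space_edge_space)
  interpret P: prob_space pos_space by (rule prob_space_pos_space)
  have F': "F \<in> borel_measurable ((poisson_counts lam \<Otimes>\<^sub>M pos_space) \<Otimes>\<^sub>M edge_space)"
    using F by (simp add: rcm_space_eq)
  have "(\<integral>\<^sup>+w. F w \<partial>rcm_space lam) = (\<integral>\<^sup>+z. \<integral>\<^sup>+U. F (z, U) \<partial>edge_space \<partial>(poisson_counts lam \<Otimes>\<^sub>M pos_space))"
    unfolding rcm_space_eq by (rule E.nn_integral_fst[OF F', symmetric])
  also have "\<dots> = (\<integral>\<^sup>+N. \<integral>\<^sup>+X. \<integral>\<^sup>+U. F ((N, X), U) \<partial>edge_space \<partial>pos_space \<partial>poisson_counts lam)"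
    by (rule P.nn_integral_fst[symmetric]) (rule E.borel_measurable_nn_integral_fst[OF F'])
  finally show ?thesis .
qed

lemma AE_pos_space: "AE X in pos_space. \<forall>b. X b \<in> hcube (fst b)"
proof (subst AE_all_countable, rule allI)
  fix b :: "(int^'a) \<times> nat"
  interpret product_prob_space "\<lambda>kj :: (int^'a) \<times> nat. cube_measure (fst kj)" UNIV
    by (rule product_prob_spaceI) (rule prob_space_cube_measure)
  show "AE X in pos_space. X b \<in> hcube (fst b)"
    unfolding pos_space_def by (rule AE_component) (use AE_cube_measure in auto)
qed

lemma AE_edge_space: "AE U in (edge_space :: ('d::finite vidx set \<Rightarrow> real) measure). \<forall>a b. 0 \<le> U {a, b}"
proof (subst AE_all_countable, rule allI, subst AE_all_countable, rule allI)
  fix a b :: "'d vidx"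
  interpret product_prob_space "\<lambda>s::'d vidx set. uniform_measure lborel {0..1::real}" UNIV
    by (rule product_prob_edge_space)
  have "AE u in uniform_measure lborel {0..1::real}. 0 \<le> u"
    by (rule AE_uniform_measureI) auto
  then show "AE U in edge_space. 0 \<le> U {a, b}"
    unfolding edge_space_def by (intro AE_component) auto
qed

text \<open>Origin of the factorial in the cluster size formula: each set of non-root cluster points
  is labelled in this many ways.\<close>

lemma card_labellings_onto:
  assumes L: "finite L" and S: "S \<subseteq> B" "finite S" "card S = card L"
  shows "card {f \<in> labellings L B. f ` L = S} = fact (card L)"
proof -
  have "{f \<in> labellings L B. f ` L = S} = {f \<in> L \<rightarrow>\<^sub>E S. inj_on f L}"
  proof (intro equalityI subsetI)
    fix f assume "f \<in> {f \<in> L \<rightarrow>\<^sub>E S. inj_on f L}"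
    then have f: "f \<in> L \<rightarrow>\<^sub>E S" "inj_on f L" by auto
    have "f ` L = S"
      by (rule card_subset_eq) (use f S in \<open>auto simp: card_image\<close>)
    with f S show "f \<in> {f \<in> labellings L B. f ` L = S}" by (auto simp: labellings_def PiE_iff)
  qed (auto simp: labellings_def PiE_iff)
  then have "card {f \<in> labellings L B. f ` L = S} = prod ((-) (card L)) {0..<card L}"
    using card_inj_on_subset_funcset[of L S L] L S by simp
  also have "\<dots> = ffact (0 + card L) (card L) * fact 0"
    by (simp add: ffact_def lessThan_atLeast0)
  also have "\<dots> = fact (card L)" by (subst ffact_add_mult_fact) simp
  finally show ?thesis .
qed

locale connection_function =
  fixes psi :: "real^'d::finite \<Rightarrow> real"
  assumes psi_meas [measurable]: "psi \<in> borel_measurable borel"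
    and psi01: "0 \<le> psi x \<and> psi x \<le> 1"
    and psi_symm: "psi (- x) = psi x"
    and psi_supp: "psi x \<noteq> 0 \<Longrightarrow> norm x \<le> 1"
begin

lemma psi_minus: "psi (x - y) = psi (y - x)"
  using psi_symm[of "x - y"] by simp

lemma edge_prob_pair [simp]: "edge_prob psi x {a, b} = psi (x a - x b)"
proof -
  define p where "p = (SOME p. {a, b} = {fst p, snd p})"
  have "{a, b} = {fst p, snd p}" unfolding p_def by (rule someI[of _ "(a, b)"]) simp
  then consider "fst p = a" "snd p = b" | "fst p = b" "snd p = a"
    by (auto simp: doubleton_eq_iff)
  then show ?thesis
    unfolding edge_prob_def p_def[symmetric] by cases (auto simp: psi_minus)
qed

lemma edge_prob01: "0 \<le> edge_prob psi x e \<and> edge_prob psi x e \<le> 1"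
  using psi01 by (auto simp: edge_prob_def Let_def)

lemma conn_weight_nonneg: "0 \<le> conn_weight psi V x"
  unfolding conn_weight_def by (rule gwt_nonneg) (rule edge_prob01)

lemma conn_weight_cong:
  assumes "\<And>a b. a \<in> V \<Longrightarrow> b \<in> V \<Longrightarrow> x a - x b = x' a - x' b"
  shows "conn_weight psi V x = conn_weight psi V x'"
  unfolding conn_weight_def by (rule gwt_cong) (auto simp: vpairs_def assms)

lemma conn_weight_reindex:
  assumes "inj_on f V"
  shows "conn_weight psi (f ` V) x = conn_weight psi V (x \<circ> f)"
  unfolding conn_weight_def gwt_gconn_reindex[OF assms]
  by (rule gwt_cong) (auto simp: vpairs_def)

lemma avoid01: "0 \<le> avoid psi V x y" "avoid psi V x y \<le> 1"
  unfolding avoid_def using psi01 by (auto intro!: prod_nonneg prod_le_1)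

text \<open>A nonzero weight has a nonzero summand, that is a connected \<open>G\<close> all of
  whose pairs have positive edge probability and therefore length at most 1.\<close>

lemma conn_weight_norm_bound:
  assumes V: "finite V" and W: "conn_weight psi V x \<noteq> 0" and rv: "r \<in> V" "v \<in> V"
  shows "norm (x v - x r) \<le> real (card V ^ 2)"
proof -
  obtain G where G: "G \<subseteq> vpairs V" "gconn V G"
    and nz: "(\<Prod>e\<in>vpairs V. if e \<in> G then edge_prob psi x e else 1 - edge_prob psi x e) \<noteq> 0"
    using W unfolding conn_weight_def gwt_def by (auto elim!: sum.not_neutral_contains_not_neutral)
  show ?thesis
  proof (rule gconn_norm_bound[OF V G(2,1) _ rv])
    fix a b assume ab: "{a, b} \<in> G"
    then have "edge_prob psi x {a, b} \<noteq> 0"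
    proof -
      have "(if {a, b} \<in> G then edge_prob psi x {a, b} else 1 - edge_prob psi x {a, b}) \<noteq> 0"
      proof
        assume "(if {a, b} \<in> G then edge_prob psi x {a, b} else 1 - edge_prob psi x {a, b}) = 0"
        then have "(\<Prod>e\<in>vpairs V. if e \<in> G then edge_prob psi x e else 1 - edge_prob psi x e) = 0"
          using V G(1) ab by (intro prod_zero bexI[of _ "{a, b}"]) auto
        with nz show False by contradiction
      qed
      with ab show ?thesis by simp
    qed
    then show "norm (x a - x b) \<le> 1" using psi_supp by simp
  qed
qed

lemma measurable_conn_weight:
  assumes V: "finite V" and x [measurable]: "\<And>v. v \<in> V \<Longrightarrow> (\<lambda>w. x w v) \<in> borel_measurable M"
  shows "(\<lambda>w. conn_weight psi V (x w)) \<in> borel_measurable M"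
proof -
  have [measurable]: "(\<lambda>w. edge_prob psi (x w) e) \<in> borel_measurable M" if "e \<in> vpairs V" for e
  proof -
    obtain a b where ab: "e = {a, b}" "a \<in> V" "b \<in> V" using \<open>e \<in> vpairs V\<close> by (auto simp: vpairs_def)
    have [measurable]: "(\<lambda>w. x w a) \<in> borel_measurable M" "(\<lambda>w. x w b) \<in> borel_measurable M"
      using ab x by auto
    show ?thesis unfolding ab by simp
  qed
  show ?thesis unfolding conn_weight_def gwt_def
    by (intro borel_measurable_sum borel_measurable_times borel_measurable_prod) (auto intro!: borel_measurable_diff)
qed

lemma measurable_avoid:
  assumes "\<And>v. v \<in> V \<Longrightarrow> (\<lambda>w. x w v) \<in> borel_measurable M" and [measurable]: "y \<in> borel_measurable M"
  shows "(\<lambda>w. avoid psi V (x w) (y w)) \<in> borel_measurable M"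
  unfolding avoid_def
proof (intro borel_measurable_prod)
  fix a assume "a \<in> V"
  then have [measurable]: "(\<lambda>w. x w a) \<in> borel_measurable M" by (rule assms)
  show "(\<lambda>w. 1 - psi (x w a - y w)) \<in> borel_measurable M" by measurable
qed

lemma measurable_avoid_const: "avoid psi V x \<in> borel_measurable borel"
  by (rule measurable_avoid[where x = "\<lambda>_. x" and y = "\<lambda>y. y"]) auto

lemma measurable_cover:
  assumes x: "\<And>v. v \<in> V \<Longrightarrow> (\<lambda>w. x w v) \<in> borel_measurable M"
  shows "(\<lambda>w. cover psi V (x w)) \<in> borel_measurable M"
  unfolding cover_def
proof (rule lborel.borel_measurable_lebesgue_integral)
  have "(\<lambda>z. avoid psi V (x (fst z)) (snd z)) \<in> borel_measurable (M \<Otimes>\<^sub>M lborel)"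
    by (rule measurable_avoid) (auto intro: measurable_compose[OF measurable_fst x])
  then show "(\<lambda>(w, y). 1 - avoid psi V (x w) y) \<in> borel_measurable (M \<Otimes>\<^sub>M lborel)"
    by (simp add: case_prod_unfold)
qed

lemma avoid_eq_1:
  assumes "\<And>a. a \<in> V \<Longrightarrow> norm (x a) \<le> real (n ^ 2)" "y \<in> hcube k" "k \<notin> near_cubes n"
  shows "avoid psi V x y = 1"
  unfolding avoid_def
proof (intro prod.neutral ballI)
  fix a assume a: "a \<in> V"
  have "psi (x a - y) = 0"
  proof (rule ccontr)
    assume "psi (x a - y) \<noteq> 0"
    then have "norm (x a - y) \<le> 1" by (rule psi_supp)
    moreover have "norm y \<le> norm (x a) + norm (x a - y)"
      using norm_triangle_ineq4[of "x a" "x a - y"] by simp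
    ultimately have "norm y \<le> real (n ^ 2) + 1" using assms(1)[OF a] by linarith
    with assms(2,3) show False using hcube_near_cubes by blast
  qed
  then show "1 - psi (x a - y) = 1" by simp
qed

lemma integrable_avoid: "integrable (cube_measure k) (avoid psi V x)"
proof -
  interpret prob_space "cube_measure k" by (rule prob_space_cube_measure)
  show ?thesis
  proof (rule integrable_const_bound[of _ 1])
    show "AE y in cube_measure k. norm (avoid psi V x y) \<le> 1"
      using avoid01[of V x] by (intro AE_I2) simp
    show "avoid psi V x \<in> borel_measurable (cube_measure k)"
      by (subst measurable_cong_sets[OF sets_cube_measure refl]) (rule measurable_avoid_const)
  qed
qed

text \<open>\<open>1 - avoid\<close> vanishes outside the near cubes and the half-open cubes are
  disjoint, so the finite sum produced by \<open>mecke_formula\<close> is already the integral over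
  the whole space.\<close>

lemma sum_cubes_eq_cover:
  assumes x: "\<And>a. a \<in> V \<Longrightarrow> norm (x a) \<le> real (n ^ 2)"
  shows "(\<Sum>k\<in>near_cubes n. 1 - (LINT y|cube_measure k. avoid psi V x y)) = cover psi V x"
proof -
  have am: "avoid psi V x \<in> borel_measurable borel"
    by (rule measurable_avoid_const)
  have 1: "1 - (LINT y|cube_measure k. avoid psi V x y) =
      (LINT y|lborel. indicator (hcube k) y * (1 - avoid psi V x y))"
    and int: "integrable lborel (\<lambda>y. indicator (hcube k) y * (1 - avoid psi V x y))" for k
  proof -
    interpret prob_space "cube_measure k" by (rule prob_space_cube_measure)
    have i: "integrable (cube_measure k) (avoid psi V x)" by (rule integrable_avoid)
    have dens: "cube_measure k = density lborel (\<lambda>y. ennreal (indicator (hcube k) y))"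
      by (simp add: cube_measure_eq_density ennreal_indicator)
    have "1 - (LINT y|cube_measure k. avoid psi V x y) = (LINT y|cube_measure k. 1 - avoid psi V x y)"
      using i prob_space by (subst Bochner_Integration.integral_diff) auto
    also have "\<dots> = (LINT y|lborel. indicator (hcube k) y *\<^sub>R (1 - avoid psi V x y))"
      unfolding dens by (rule integral_density) (use am in auto)
    finally show "1 - (LINT y|cube_measure k. avoid psi V x y) =
      (LINT y|lborel. indicator (hcube k) y * (1 - avoid psi V x y))" by simp
    have "integrable (cube_measure k) (\<lambda>y. 1 - avoid psi V x y)" using i by auto
    then have "integrable lborel (\<lambda>y. indicator (hcube k) y *\<^sub>R (1 - avoid psi V x y))"
      unfolding dens by (subst (asm) integrable_density) (use am in auto)
    then show "integrable lborel (\<lambda>y. indicator (hcube k) y * (1 - avoid psi V x y))" by simp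
  qed
  have "(\<Sum>k\<in>near_cubes n. 1 - (LINT y|cube_measure k. avoid psi V x y)) =
     (LINT y|lborel. (\<Sum>k\<in>near_cubes n. indicator (hcube k) y * (1 - avoid psi V x y)))"
    unfolding 1 by (rule Bochner_Integration.integral_sum[symmetric]) (rule int)
  also have "\<dots> = cover psi V x"
    unfolding cover_def
  proof (intro Bochner_Integration.integral_cong refl)
    fix y :: "real^'d"
    define k :: "int^'d" where "k = (\<chi> i. \<lfloor>y $ i\<rfloor>)"
    have yk: "y \<in> hcube j \<longleftrightarrow> j = k" for j by (auto simp: hcube_def k_def vec_eq_iff)
    show "(\<Sum>k\<in>near_cubes n. indicator (hcube k) y * (1 - avoid psi V x y)) = 1 - avoid psi V x y"
    proof (cases "k \<in> near_cubes n")
      case True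
      have "(\<Sum>k\<in>near_cubes n. indicator (hcube k) y * (1 - avoid psi V x y)) =
          (\<Sum>j\<in>near_cubes n. if j = k then 1 - avoid psi V x y else 0)"
        by (intro sum.cong refl) (simp add: indicator_def yk)
      then show ?thesis using True by simp
    next
      case False
      then have "avoid psi V x y = 1" using x by (intro avoid_eq_1[of V x n y k]) (auto simp: yk)
      then show ?thesis by simp
    qed
  qed
  finally show ?thesis .
qed

subsection \<open>Measurability of cluster events\<close>

lemma measurable_rcm_count [measurable]: "(\<lambda>w. fst (fst w) k) \<in> measurable (rcm_space lam) (count_space UNIV)"
  unfolding rcm_space_eq by measurable

lemma measurable_rcm_pos [measurable]: "(\<lambda>w. rcm_pos w a) \<in> borel_measurable (rcm_space lam)"
  unfolding rcm_space_eq rcm_pos_def by (cases a) (simp_all, measurable)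

lemma measurable_rcm_unif [measurable]: "(\<lambda>w. snd w s) \<in> borel_measurable (rcm_space lam)"
  unfolding rcm_space_eq by measurable

lemma pred_rcm_vertices [measurable]: "Measurable.pred (rcm_space lam) (\<lambda>w. a \<in> rcm_vertices w)"
proof (cases a)
  case None then show ?thesis by (simp add: rcm_vertices_def)
next
  case (Some kj)
  then have "(\<lambda>w. a \<in> rcm_vertices w) = (\<lambda>w. snd kj < fst (fst w) (fst kj))"
    by (cases kj) (auto simp: rcm_vertices_def fun_eq_iff)
  then show ?thesis by simp
qed

lemma pred_rcm_edge [measurable]: "Measurable.pred (rcm_space lam) (\<lambda>w. rcm_edge psi w a b)"
  unfolding rcm_edge_def by measurable

lemma pred_rcm_cluster [measurable]: "Measurable.pred (rcm_space lam) (\<lambda>w. b \<in> rcm_cluster psi w)"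
proof -
  have [measurable]: "Measurable.pred (rcm_space lam) (\<lambda>w. (rcm_edge psi w ^^ n) None b)" for n b
  proof (induction n arbitrary: b)
    case (Suc n)
    note Suc [measurable]
    have "(\<lambda>w. (rcm_edge psi w ^^ Suc n) None b) = (\<lambda>w. \<exists>y. (rcm_edge psi w ^^ n) None y \<and> rcm_edge psi w y b)"
      by (auto simp: fun_eq_iff relcompp_apply)
    then show ?case by simp
  qed simp
  show ?thesis unfolding rcm_cluster_def mem_Collect_eq rtranclp_power by measurable
qed

text \<open>The index type is countable, so it has only countably many finite subsets, and the event
  is a countable union over the possible values \<open>S\<close> of the cluster.\<close>

lemma pred_cluster_finite_card [measurable]:
  "Measurable.pred (rcm_space lam) (\<lambda>w. finite (rcm_cluster psi w) \<and> Q (card (rcm_cluster psi w)))"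
proof -
  have eq: "(\<lambda>w. finite (rcm_cluster psi w) \<and> Q (card (rcm_cluster psi w))) =
    (\<lambda>w. \<exists>S\<in>{S. finite S \<and> Q (card S)}. \<forall>b. b \<in> rcm_cluster psi w \<longleftrightarrow> b \<in> S)"
    by (auto simp: fun_eq_iff set_eq_iff[symmetric])
  have "countable {S :: 'd vidx set. finite S \<and> Q (card S)}"
    by (rule countable_subset[OF _ countable_Collect_finite]) auto
  then show ?thesis unfolding eq by measurable
qed

subsection \<open>The law of the cluster size\<close>

lemma rcm_edge_iff:
  "rcm_edge psi w a b \<longleftrightarrow> a \<in> rcm_vertices w \<and> b \<in> rcm_vertices w \<and> a \<noteq> b \<and>
     snd w {a, b} < edge_prob psi (rcm_pos w) {a, b}"
  by (simp add: rcm_edge_def)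

definition open_pairs :: "'d rcm_outcome \<Rightarrow> 'd vidx set \<Rightarrow> 'd vidx set set" where
  "open_pairs w V = {e \<in> vpairs V. snd w e < edge_prob psi (rcm_pos w) e}"

lemma rcm_cluster_subset: "rcm_cluster psi w \<subseteq> rcm_vertices w"
proof
  fix b assume "b \<in> rcm_cluster psi w"
  then have "(rcm_edge psi w)\<^sup>*\<^sup>* None b" by (simp add: rcm_cluster_def)
  then show "b \<in> rcm_vertices w"
    by (induction rule: rtranclp_induct) (auto simp: rcm_vertices_def rcm_edge_def)
qed

lemma None_in_cluster: "None \<in> rcm_cluster psi w"
  by (simp add: rcm_cluster_def)

lemma open_pairs_iff:
  "{a, b} \<in> open_pairs w V \<longleftrightarrow> a \<in> V \<and> b \<in> V \<and> a \<noteq> b \<and> snd w {a, b} < edge_prob psi (rcm_pos w) {a, b}"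
  unfolding open_pairs_def vpairs_def by (auto simp: doubleton_eq_iff insert_commute psi_minus)

lemma gconn_cluster: "gconn (rcm_cluster psi w) (open_pairs w (rcm_cluster psi w))"
proof -
  let ?R = "\<lambda>x y. {x, y} \<in> open_pairs w (rcm_cluster psi w)"
  have sym: "?R\<^sup>*\<^sup>* b a" if "?R\<^sup>*\<^sup>* a b" for a b
  proof -
    have "symp ?R" by (auto simp: symp_def insert_commute)
    then have "symp ?R\<^sup>*\<^sup>*" by (rule symp_rtranclp)
    with that show ?thesis by (auto dest: sympD)
  qed
  have root: "?R\<^sup>*\<^sup>* None b" if "b \<in> rcm_cluster psi w" for b
  proof -
    have "(rcm_edge psi w)\<^sup>*\<^sup>* None b" using that by (simp add: rcm_cluster_def)
    then show ?thesis
    proof (induction rule: rtranclp_induct)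
      case (step y z)
      have "y \<in> rcm_cluster psi w" "z \<in> rcm_cluster psi w"
        using step by (auto simp: rcm_cluster_def intro: rtranclp.rtrancl_into_rtrancl)
      then have "?R y z" using step(2) by (simp add: open_pairs_iff rcm_edge_iff)
      with step.IH show ?case by (rule rtranclp.rtrancl_into_rtrancl)
    qed simp
  qed
  show ?thesis unfolding gconn_def
    using root sym rtranclp_trans[of ?R] by meson
qed

text \<open>Separates the event into a condition on the pairs inside \<open>V\<close> and one on the
  pairs leaving \<open>V\<close>. These are disjoint sets of pairs, hence independent under the edge
  variables.\<close>

lemma cluster_eq_iff:
  assumes V: "None \<in> V" "V \<subseteq> rcm_vertices w"
  shows "rcm_cluster psi w = V \<longleftrightarrow> gconn V (open_pairs w V) \<and>
     (\<forall>a\<in>V. \<forall>b\<in>rcm_vertices w - V. \<not> snd w {a, b} < edge_prob psi (rcm_pos w) {a, b})"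
proof
  assume eq: "rcm_cluster psi w = V"
  have "\<not> snd w {a, b} < edge_prob psi (rcm_pos w) {a, b}" if "a \<in> V" "b \<in> rcm_vertices w - V" for a b
  proof
    assume "snd w {a, b} < edge_prob psi (rcm_pos w) {a, b}"
    then have "rcm_edge psi w a b" unfolding rcm_edge_iff using that V by auto
    moreover have "(rcm_edge psi w)\<^sup>*\<^sup>* None a" using that eq by (auto simp: rcm_cluster_def)
    ultimately have "b \<in> rcm_cluster psi w"
      by (auto simp: rcm_cluster_def intro: rtranclp.rtrancl_into_rtrancl)
    with that eq show False by auto
  qed
  then show "gconn V (open_pairs w V) \<and>
     (\<forall>a\<in>V. \<forall>b\<in>rcm_vertices w - V. \<not> snd w {a, b} < edge_prob psi (rcm_pos w) {a, b})"
    using gconn_cluster[of w] eq by auto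
next
  assume *: "gconn V (open_pairs w V) \<and>
     (\<forall>a\<in>V. \<forall>b\<in>rcm_vertices w - V. \<not> snd w {a, b} < edge_prob psi (rcm_pos w) {a, b})"
  show "rcm_cluster psi w = V"
  proof (intro equalityI subsetI)
    fix b assume "b \<in> V"
    then have "(\<lambda>x y. {x, y} \<in> open_pairs w V)\<^sup>*\<^sup>* None b" using * V by (simp add: gconn_def)
    then have "(rcm_edge psi w)\<^sup>*\<^sup>* None b"
      by (rule rtranclp_mono[THEN predicate2D, rotated])
        (use V in \<open>auto simp only: open_pairs_iff rcm_edge_iff\<close>)
    then show "b \<in> rcm_cluster psi w" by (simp add: rcm_cluster_def)
  next
    fix b assume "b \<in> rcm_cluster psi w"
    then have "(rcm_edge psi w)\<^sup>*\<^sup>* None b" by (simp add: rcm_cluster_def)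
    then show "b \<in> V"
    proof (induction rule: rtranclp_induct)
      case (step y z)
      show ?case
      proof (rule ccontr)
        assume "z \<notin> V"
        with * step show False by (auto simp only: rcm_edge_iff)
      qed
    qed (use V in simp)
  qed
qed

lemma near_cluster_in_box:
  assumes X: "\<And>b. X b \<in> hcube (fst b)" and U: "\<And>a b. 0 \<le> U {a, b}"
    and V: "finite V" "None \<in> V" "gconn V (open_pairs ((N, X), U) V)" and v: "v \<in> V"
    and w: "w = ((N, X), U)"
  shows "norm (rcm_pos w v) \<le> real (card V ^ 2)"
proof -
  have "norm (rcm_pos w v - rcm_pos w None) \<le> real (card V ^ 2)"
  proof (rule gconn_norm_bound[OF V(1,3) _ _ V(2) v])
    fix a b assume "{a, b} \<in> open_pairs ((N, X), U) V"
    \<comment> \<open>An open pair satisfies \<open>U {a, b} < psi (...)\<close>; as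
      \<open>U\<close> is nonnegative, \<open>psi\<close> cannot vanish there.\<close>
    then have "psi (rcm_pos w a - rcm_pos w b) \<noteq> 0"
      using U[of a b] by (auto simp: open_pairs_iff w)
    then show "norm (rcm_pos w a - rcm_pos w b) \<le> 1" by (rule psi_supp)
  qed (auto simp: open_pairs_def)
  then show ?thesis by (simp add: rcm_pos_def)
qed

lemma rcm_pos_Some [simp]: "rcm_pos ((N, X), U) (Some b) = X b" "rcm_pos ((N, X), U) None = 0"
  by (simp_all add: rcm_pos_def)

definition label_cluster :: "('l \<Rightarrow> (int^'d) \<times> nat) \<Rightarrow> 'l set \<Rightarrow> 'd vidx set" where
  "label_cluster f L = insert None (Some ` f ` L)"

text \<open>Of the infinitely many vertices outside \<open>V\<close> only those in the near cubes
  have to be tested: once \<open>V\<close> is connected it is confined, so \<open>psi\<close> is 0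
  between \<open>V\<close> and any farther vertex, and nonnegative \<open>U\<close> keeps that pair
  closed.\<close>

lemma cluster_eq_iff_box:
  assumes X: "\<And>b. X b \<in> hcube (fst b)" and U: "\<And>a b. 0 \<le> U {a, b}"
    and f: "f \<in> labellings L (box_points (near_cubes (Suc (card L))) N)" and L: "finite L"
    and w: "w = ((N, X), U)"
  defines "V \<equiv> label_cluster f L"
  shows "rcm_cluster psi w = V \<longleftrightarrow> gconn V (open_pairs w V) \<and>
     (\<forall>a\<in>V. \<forall>b\<in>Some ` (box_points (near_cubes (Suc (card L))) N - f ` L). \<not> U {a, b} < edge_prob psi (rcm_pos w) {a, b})"
proof -
  let ?B = "box_points (near_cubes (Suc (card L))) N"
  have finj: "inj_on f L" "f ` L \<subseteq> ?B" using f by (auto simp: labellings_def)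
  have cardV: "card V = Suc (card L)" and finV: "finite V" and NV: "None \<in> V"
    using L finj by (auto simp: V_def label_cluster_def card_image)
  have V: "V \<subseteq> rcm_vertices w"
    using finj by (auto simp: V_def label_cluster_def rcm_vertices_def w box_points_def)
  have R: "Some ` (?B - f ` L) \<subseteq> rcm_vertices w - V"
    by (auto simp: V_def label_cluster_def rcm_vertices_def w box_points_def)
  have far: "\<not> snd w {a, b} < edge_prob psi (rcm_pos w) {a, b}"
    if c: "gconn V (open_pairs w V)" and a: "a \<in> V" and b: "b \<in> rcm_vertices w - V" "b \<notin> Some ` (?B - f ` L)" for a b
  proof -
    obtain kj where kj: "b = Some kj" "snd kj < N (fst kj)"
      using b NV by (auto simp: rcm_vertices_def w)
    moreover have "kj \<notin> f ` L" using b kj by (auto simp: V_def label_cluster_def)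
    ultimately have "kj \<notin> ?B" using b by auto
    then have notin: "fst kj \<notin> near_cubes (Suc (card L))" using kj by (auto simp: box_points_def case_prod_unfold)
    have na: "norm (rcm_pos w a) \<le> real (Suc (card L) ^ 2)"
      using near_cluster_in_box[of X U V N a w, OF X U finV NV _ a w] c cardV by (simp add: w)
    have "avoid psi {a} (rcm_pos w) (X kj) = 1"
      by (rule avoid_eq_1[OF _ X notin]) (use na in simp)
    then have "psi (rcm_pos w a - X kj) = 0" by (simp add: avoid_def)
    then show ?thesis using U[of a b] by (simp add: w kj)
  qed
  show ?thesis unfolding cluster_eq_iff[OF NV V] using far R by (auto simp only: w snd_conv) blast+
qed

text \<open>A cluster of the right size lies in the near cubes, so its non-root points are the image
  of exactly \<open>fact (card L)\<close> labellings; otherwise no labelling matches.\<close>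

lemma sum_labellings_cluster:
  assumes X: "\<And>b. X b \<in> hcube (fst b)" and U: "\<And>a b. 0 \<le> U {a, b}"
    and L: "finite L" and w: "w = ((N, X), U)"
  shows "(\<Sum>f\<in>labellings L (box_points (near_cubes (Suc (card L))) N). of_bool (rcm_cluster psi w = label_cluster f L)) =
    (of_nat (fact (card L)) * of_bool (finite (rcm_cluster psi w) \<and> card (rcm_cluster psi w) = Suc (card L)) :: ennreal)"
proof -
  let ?B = "box_points (near_cubes (Suc (card L))) N" and ?C = "rcm_cluster psi w"
  have fin: "finite (labellings L ?B)" using L by simp
  have "(\<Sum>f\<in>labellings L ?B. of_bool (?C = label_cluster f L) :: ennreal) = of_nat (card {f\<in>labellings L ?B. ?C = label_cluster f L})"
    using fin by (subst sum_of_bool_eq) (auto simp: Int_def)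
  also have "card {f\<in>labellings L ?B. ?C = label_cluster f L} =
     fact (card L) * of_bool (finite ?C \<and> card ?C = Suc (card L))"
  proof (cases "finite ?C \<and> card ?C = Suc (card L)")
    case True
    define S where "S = Some -` ?C"
    have C_eq: "?C = insert None (Some ` S)"
      using None_in_cluster[of w] by (auto simp: S_def image_iff split: option.splits intro: option.exhaust)
    have finS: "finite S" using True by (auto simp: S_def intro: finite_vimageI)
    have "card ?C = Suc (card S)"
      unfolding C_eq using finS by (subst card_insert_disjoint) (auto simp: card_image)
    then have cS: "card S = card L" using True by simp
    have sub: "S \<subseteq> ?B"
    proof
      fix kj assume "kj \<in> S"
      then have c: "Some kj \<in> ?C" by (simp add: S_def)
      then have "snd kj < N (fst kj)" using rcm_cluster_subset[of w] by (auto simp: rcm_vertices_def w)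
      moreover have "norm (X kj) \<le> real (Suc (card L) ^ 2)"
        using near_cluster_in_box[of X U ?C N "Some kj" w, OF X U _ None_in_cluster _ c w] True gconn_cluster[of w]
        by (simp add: w)
      then have "fst kj \<in> near_cubes (Suc (card L))" using hcube_near_cubes[OF X, of kj "Suc (card L)"] by simp
      ultimately show "kj \<in> ?B" by (simp add: box_points_def case_prod_unfold)
    qed
    have "{f\<in>labellings L ?B. ?C = label_cluster f L} = {f\<in>labellings L ?B. f ` L = S}"
    proof -
      have "?C = label_cluster f L \<longleftrightarrow> f ` L = S" for f
      proof -
        have "?C = label_cluster f L \<longleftrightarrow> Some ` S = Some ` f ` L"
          unfolding C_eq label_cluster_def by (rule insert_ident) auto
        then show ?thesis by (auto simp: inj_image_eq_iff)
      qed
      then show ?thesis by simp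
    qed
    then show ?thesis using card_labellings_onto[OF L sub finS cS] True by simp
  next
    case False
    have "finite (label_cluster f L) \<and> card (label_cluster f L) = Suc (card L)" if "f \<in> labellings L ?B" for f
      using that L by (auto simp: labellings_def label_cluster_def card_image)
    then have "{f\<in>labellings L ?B. ?C = label_cluster f L} = {}" using False by auto
    then have "card {f\<in>labellings L ?B. ?C = label_cluster f L} = 0" by (simp only: card.empty)
    then show ?thesis using False by (simp only: of_bool_eq mult_0_right)
  qed
  finally show ?thesis by simp
qed

text \<open>The pairs inside \<open>V\<close> and the pairs from \<open>V\<close> to the unlabelled
  points are disjoint. The first contribute the connectivity weight; the second must all be closed,
  which factorises over the unlabelled points into \<open>avoid\<close>.\<close>

lemma emeasure_edge_space_cluster:
  fixes r :: 'l
  assumes f: "f \<in> labellings L B" and fin: "finite L" "finite B" and r: "r \<notin> L"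
    and w: "\<And>U. w U = ((N, X), U)"
  defines "V \<equiv> label_cluster f L" and "x \<equiv> (\<lambda>l\<in>L. X (f l))(r := 0)"
  shows "{U \<in> space edge_space. gconn V (open_pairs (w U) V) \<and>
       (\<forall>a\<in>V. \<forall>b\<in>Some ` (B - f ` L). \<not> U {a, b} < edge_prob psi (rcm_pos (w U)) {a, b})} \<in> sets edge_space" (is "?E \<in> _")
    and "emeasure edge_space {U \<in> space edge_space. gconn V (open_pairs (w U) V) \<and>
       (\<forall>a\<in>V. \<forall>b\<in>Some ` (B - f ` L). \<not> U {a, b} < edge_prob psi (rcm_pos (w U)) {a, b})} =
     ennreal (conn_weight psi (insert r L) x) * (\<Prod>b\<in>B - f ` L. ennreal (avoid psi (insert r L) x (X b)))"
proof -
  define pos where "pos = rcm_pos ((N, X), \<lambda>_. 0)"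
  have pos: "rcm_pos (w U) = pos" for U unfolding pos_def rcm_pos_def fun_eq_iff w by (simp only: fst_conv simp_thms)
  have pos_simps [simp]: "pos None = 0" "pos (Some b) = X b" for b by (simp_all add: pos_def)
  define R where "R = Some ` (B - f ` L)"
  define D where "D = (\<lambda>(a, b). {a, b}) ` (V \<times> R)"
  let ?p = "edge_prob psi pos"
  have finV: "finite V" using fin by (simp add: V_def label_cluster_def)
  have finR: "finite R" using fin by (simp add: R_def)
  have VR: "V \<inter> R = {}" by (auto simp: V_def R_def label_cluster_def)
  have finD: "finite D" using finV finR by (simp add: D_def)
  have disj: "vpairs V \<inter> D = {}" using VR by (auto simp: vpairs_def D_def doubleton_eq_iff)
  let ?Q = "\<lambda>G. gconn V (G \<inter> vpairs V) \<and> G \<inter> D = {}"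
  have E_eq: "?E = {U \<in> space edge_space. ?Q {e\<in>vpairs V \<union> D. U e < ?p e}}"
  proof (intro Collect_cong conj_cong refl)
    fix U
    have "open_pairs (w U) V = {e\<in>vpairs V \<union> D. U e < ?p e} \<inter> vpairs V"
      using pos[of U] by (auto simp: open_pairs_def w)
    then show "gconn V (open_pairs (w U) V) \<longleftrightarrow> gconn V ({e\<in>vpairs V \<union> D. U e < ?p e} \<inter> vpairs V)" by simp
    have "{e\<in>vpairs V \<union> D. U e < ?p e} \<inter> D = {} \<longleftrightarrow> (\<forall>e\<in>D. \<not> U e < ?p e)" by blast
    also have "\<dots> \<longleftrightarrow> (\<forall>a\<in>V. \<forall>b\<in>R. \<not> U {a, b} < ?p {a, b})"
      unfolding D_def by (simp add: split_paired_all)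
    finally show "(\<forall>a\<in>V. \<forall>b\<in>Some ` (B - f ` L). \<not> U {a, b} < edge_prob psi (rcm_pos (w U)) {a, b}) \<longleftrightarrow>
       {e\<in>vpairs V \<union> D. U e < ?p e} \<inter> D = {}" unfolding pos R_def by simp
  qed
  have finVD: "finite (vpairs V \<union> D)" using finV finD by simp
  show "?E \<in> sets edge_space"
    unfolding E_eq by (rule emeasure_edge_space_gwt[OF finVD edge_prob01])
  have "emeasure edge_space ?E = ennreal (gwt (vpairs V \<union> D) ?p ?Q)"
    unfolding E_eq by (rule emeasure_edge_space_gwt[OF finVD edge_prob01])
  also have "gwt (vpairs V \<union> D) ?p ?Q = conn_weight psi V pos * gwt D ?p (\<lambda>G. G = {})"
    unfolding conn_weight_def
    by (rule gwt_split[where ?Q1.0 = "gconn V" and ?Q2.0 = "\<lambda>G. G = {}"]) (use finV finD disj in auto)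
  also have "gwt D ?p (\<lambda>G. G = {}) = (\<Prod>e\<in>D. 1 - ?p e)" by (rule gwt_empty[OF finD])
  \<comment> \<open>\<open>V\<close> and \<open>R\<close> are disjoint, so every unordered boundary
    pair comes from exactly one element of \<open>V \<times> R\<close>.\<close>
  also have "\<dots> = (\<Prod>(a, b)\<in>V \<times> R. 1 - psi (pos a - pos b))"
  proof -
    have inj: "inj_on (\<lambda>(a, b). {a, b}) (V \<times> R)"
      using VR by (auto simp: inj_on_def doubleton_eq_iff)
    show ?thesis unfolding D_def by (subst prod.reindex[OF inj]) (simp add: case_prod_unfold)
  qed
  also have "\<dots> = (\<Prod>b\<in>R. avoid psi V pos (pos b))"
    unfolding avoid_def prod.cartesian_product[symmetric] by (rule prod.swap)
  also have "\<dots> = (\<Prod>b\<in>B - f ` L. avoid psi V pos (X b))"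
    unfolding R_def by (subst prod.reindex) auto
  finally have *: "emeasure edge_space ?E = ennreal (conn_weight psi V pos * (\<Prod>b\<in>B - f ` L. avoid psi V pos (X b)))" .
  \<comment> \<open>Translates labels into model indices, with the fresh label \<open>r\<close>
    standing for the origin \<open>None\<close>.\<close>
  define F where "F = (\<lambda>l. if l = r then None else Some (f l))"
  have inj: "inj_on F (insert r L)"
    using f r by (auto simp: F_def labellings_def inj_on_def)
  have V_eq: "V = F ` insert r L"
    using r by (auto simp: V_def label_cluster_def F_def image_iff)
  have posF: "(pos \<circ> F) l = x l" if "l \<in> insert r L" for l
    using that by (auto simp: F_def x_def)
  have 1: "conn_weight psi V pos = conn_weight psi (insert r L) x"
    unfolding V_eq conn_weight_reindex[OF inj] by (rule conn_weight_cong) (simp add: posF del: o_apply)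
  have 2: "avoid psi V pos y = avoid psi (insert r L) x y" for y
    unfolding avoid_def V_eq prod.reindex[OF inj] by (rule prod.cong) (use posF in auto)
  show "emeasure edge_space ?E =
     ennreal (conn_weight psi (insert r L) x) * (\<Prod>b\<in>B - f ` L. ennreal (avoid psi (insert r L) x (X b)))"
    unfolding * 1 2 by (simp add: ennreal_mult conn_weight_nonneg prod_nonneg avoid01 prod_ennreal)
qed

definition weight :: "real \<Rightarrow> 'l set \<Rightarrow> ('l \<Rightarrow> real^'d) \<Rightarrow> real" where
  "weight lam V x = conn_weight psi V x * exp (- lam * cover psi V x)"

lemma measurable_upd:
  assumes "v \<in> insert r L"
  shows "(\<lambda>x. (x(r := (0::real^'d))) v) \<in> borel_measurable (PiM L (\<lambda>_. borel))"
  using assms by (cases "v = r") (auto intro: measurable_component_singleton)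

text \<open>The sum over labellings of the event that the cluster is the labelled set is evaluated
  twice: \<open>sum_labellings_cluster\<close> gives the factorial times the size event, and
  \<open>mecke_formula\<close> with the connectivity weight and \<open>avoid\<close> gives the
  integral. The root \<open>r\<close> is pinned at the origin and not integrated.\<close>

theorem cluster_size_formula:
  fixes L :: "'l set"
  assumes L: "finite L" and r: "r \<notin> L" and lam: "0 < lam"
  shows "of_nat (fact (card L)) * emeasure (rcm_space lam)
      {w \<in> space (rcm_space lam). finite (rcm_cluster psi w) \<and> card (rcm_cluster psi w) = Suc (card L)} =
    ennreal (lam ^ card L) *
      (\<integral>\<^sup>+x. ennreal (weight lam (insert r L) (x(r := 0))) \<partial>PiM L (\<lambda>_. lborel))"
proof -
  let ?n = "Suc (card L)" and ?P = "PiM L (\<lambda>_::'l. borel :: (real^'d) measure)"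
  let ?A = "{w \<in> space (rcm_space lam). finite (rcm_cluster psi w) \<and> card (rcm_cluster psi w) = ?n}"
  let ?B = "box_points (near_cubes ?n)"
  define Phi where "Phi x = ennreal (conn_weight psi (insert r L) (x(r := 0)))" for x :: "'l \<Rightarrow> real^'d"
  define g where "g x y = avoid psi (insert r L) (x(r := 0)) y" for x :: "'l \<Rightarrow> real^'d" and y
  let ?S = "\<lambda>N X. \<Sum>f\<in>labellings L (?B N). Phi (\<lambda>l\<in>L. X (f l)) * (\<Prod>b\<in>?B N - f ` L. ennreal (g (\<lambda>l\<in>L. X (f l)) (X b)))"
  let ?I = "\<lambda>N X. \<integral>\<^sup>+U. of_nat (fact (card L)) * indicator ?A ((N, X), U) \<partial>edge_space"
  let ?R = "\<lambda>x. indicator (Pi\<^sub>E L (\<lambda>_. \<Union>k\<in>near_cubes ?n. hcube k)) x * (Phi x *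
     ennreal (exp (- lam * (\<Sum>k\<in>near_cubes ?n. 1 - (LINT y|cube_measure k. g x y)))))"
  have A: "?A \<in> sets (rcm_space lam)"
    using pred_cluster_finite_card[of "\<lambda>m. m = ?n" lam] by (simp add: pred_def)
  have Phi_meas: "Phi \<in> borel_measurable ?P"
    unfolding Phi_def using L
    by (intro measurable_compose[OF _ measurable_ennreal] measurable_conn_weight measurable_upd) auto
  have g_meas: "(\<lambda>(x, y). g x y) \<in> borel_measurable (?P \<Otimes>\<^sub>M borel)"
    unfolding g_def case_prod_unfold
  proof (rule measurable_avoid)
    fix v assume "v \<in> insert r L"
    from measurable_compose[OF measurable_fst measurable_upd[OF this]]
    show "(\<lambda>z. ((fst z)(r := 0)) v) \<in> borel_measurable (?P \<Otimes>\<^sub>M borel)" .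
  qed simp
  interpret E: prob_space edge_space by (rule prob_space_edge_space)
  have U_int: "?I N X =
      ?S N X"
    if X: "\<forall>b. X b \<in> hcube (fst b)" for N X
  proof -
    let ?w = "\<lambda>U. ((N, X), U)"
    let ?ev = "\<lambda>f. {U \<in> space edge_space. gconn (label_cluster f L) (open_pairs (?w U) (label_cluster f L)) \<and>
       (\<forall>a\<in>label_cluster f L. \<forall>b\<in>Some ` (?B N - f ` L). \<not> U {a, b} < edge_prob psi (rcm_pos (?w U)) {a, b})}"
    have ev: "?ev f \<in> sets edge_space"
       "emeasure edge_space (?ev f) = Phi (\<lambda>l\<in>L. X (f l)) * (\<Prod>b\<in>?B N - f ` L. ennreal (g (\<lambda>l\<in>L. X (f l)) (X b)))"
      if "f \<in> labellings L (?B N)" for f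
      using emeasure_edge_space_cluster[OF that L _ r, of ?w N X] by (simp_all add: Phi_def g_def)
    have "?I N X =
       (\<integral>\<^sup>+U. (\<Sum>f\<in>labellings L (?B N). indicator (?ev f) U) \<partial>edge_space)"
    proof (rule nn_integral_cong_AE)
      show "AE U in edge_space. of_nat (fact (card L)) * indicator ?A ((N, X), U) =
          (\<Sum>f\<in>labellings L (?B N). indicator (?ev f) U :: ennreal)"
        using AE_edge_space AE_space
      proof eventually_elim
        case (elim U)
        have sp: "((N, X), U) \<in> space (rcm_space lam)"
          using elim(2) by (simp add: rcm_space_eq space_pair_measure poisson_counts_def pos_space_def edge_space_def space_PiM)
        have "(\<Sum>f\<in>labellings L (?B N). indicator (?ev f) U :: ennreal) =
          (\<Sum>f\<in>labellings L (?B N). of_bool (rcm_cluster psi (?w U) = label_cluster f L))"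
        proof (intro sum.cong refl)
          fix f assume f: "f \<in> labellings L (?B N)"
          have "U \<in> ?ev f \<longleftrightarrow> rcm_cluster psi (?w U) = label_cluster f L"
            unfolding cluster_eq_iff_box[of X U f L N "?w U", OF X[rule_format] elim(1)[rule_format] f L refl]
            using elim(2) by simp
          then show "(indicator (?ev f) U :: ennreal) = of_bool (rcm_cluster psi (?w U) = label_cluster f L)"
            by (simp add: indicator_def)
        qed
        also have "\<dots> = of_nat (fact (card L)) * of_bool (finite (rcm_cluster psi (?w U)) \<and> card (rcm_cluster psi (?w U)) = ?n)"
          by (rule sum_labellings_cluster[of X U L "?w U" N, OF X[rule_format] elim(1)[rule_format] L refl])
        also have "of_bool (finite (rcm_cluster psi (?w U)) \<and> card (rcm_cluster psi (?w U)) = ?n) = (indicator ?A ((N, X), U) :: ennreal)"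
          using sp by (simp add: indicator_def)
        finally show ?case by simp
      qed
    qed
    also have "\<dots> = (\<Sum>f\<in>labellings L (?B N). emeasure edge_space (?ev f))"
      using ev(1) by (subst nn_integral_sum) auto
    finally show ?thesis using ev(2) by simp
  qed
  have "of_nat (fact (card L)) * emeasure (rcm_space lam) ?A = (\<integral>\<^sup>+w. of_nat (fact (card L)) * indicator ?A w \<partial>rcm_space lam)"
    using A by (simp add: nn_integral_cmult)
  also have "\<dots> = (\<integral>\<^sup>+N. \<integral>\<^sup>+X. ?I N X \<partial>pos_space \<partial>poisson_counts lam)"
    using A by (intro nn_integral_rcm_space) auto
  also have "\<dots> = (\<integral>\<^sup>+N. \<integral>\<^sup>+X. ?S N X \<partial>pos_space \<partial>poisson_counts lam)"
  proof (rule nn_integral_cong, rule nn_integral_cong_AE)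
    fix N :: "int^'d \<Rightarrow> nat"
    show "AE X in pos_space. ?I N X =
      ?S N X"
      using AE_pos_space by eventually_elim (rule U_int)
  qed
  also have "\<dots> = ennreal (lam ^ card L) * (\<integral>\<^sup>+x. ?R x \<partial>PiM L (\<lambda>_. lborel))"
    by (rule mecke_formula[OF L finite_near_cubes lam Phi_meas g_meas]) (simp_all add: g_def avoid01)
  also have "(\<integral>\<^sup>+x. ?R x \<partial>PiM L (\<lambda>_. lborel)) =
     (\<integral>\<^sup>+x. ennreal (weight lam (insert r L) (x(r := 0))) \<partial>PiM L (\<lambda>_. lborel))"
  proof (intro nn_integral_cong)
    fix x assume x: "x \<in> space (PiM L (\<lambda>_::'l. lborel :: (real^'d) measure))"
    let ?x = "x(r := 0)"
    show "?R x =
      ennreal (weight lam (insert r L) ?x)"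
    proof (cases "conn_weight psi (insert r L) ?x = 0")
      case True
      then show ?thesis by (simp add: Phi_def weight_def)
    next
      case False
      have bound: "norm (?x a) \<le> real (?n ^ 2)" if "a \<in> insert r L" for a
        using conn_weight_norm_bound[OF _ False, of r a] that L r by simp
      have "x l \<in> (\<Union>k\<in>near_cubes ?n. hcube k)" if l: "l \<in> L" for l
      proof -
        define k :: "int^'d" where "k = (\<chi> i. \<lfloor>x l $ i\<rfloor>)"
        have k: "x l \<in> hcube k" by (simp add: hcube_def k_def)
        have "l \<noteq> r" using l r by auto
        then have "norm (x l) \<le> real (?n ^ 2) + 1" using bound[of l] l by simp
        from hcube_near_cubes[OF k this] k show ?thesis by auto
      qed
      then have "x \<in> Pi\<^sub>E L (\<lambda>_. \<Union>k\<in>near_cubes ?n. hcube k)" using x by (auto simp: space_PiM PiE_def)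
      moreover have "(\<Sum>k\<in>near_cubes ?n. 1 - (LINT y|cube_measure k. g x y)) = cover psi (insert r L) ?x"
        unfolding g_def by (rule sum_cubes_eq_cover) (rule bound)
      ultimately show ?thesis
        by (simp add: Phi_def weight_def ennreal_mult conn_weight_nonneg)
    qed
  qed
  finally show ?thesis .
qed

end

subsection \<open>Translation invariance\<close>

lemma nn_integral_lborel_translate:
  fixes c :: "'a::euclidean_space"
  assumes [measurable]: "f \<in> borel_measurable borel"
  shows "(\<integral>\<^sup>+u. f (u + c) \<partial>lborel) = (\<integral>\<^sup>+u. f u \<partial>lborel)"
proof -
  have "(\<integral>\<^sup>+u. f u \<partial>lborel) = (\<integral>\<^sup>+u. f u \<partial>distr lborel borel ((+) c))"
    by (simp add: lborel_distr_plus)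
  also have "\<dots> = (\<integral>\<^sup>+u. f (c + u) \<partial>lborel)" by (rule nn_integral_distr) auto
  finally show ?thesis by (simp add: add.commute)
qed

lemma product_sigma_finite_lborel: "product_sigma_finite (\<lambda>_. lborel :: 'a::euclidean_space measure)"
  by (simp add: product_sigma_finite_def sigma_finite_lborel)

lemma nn_integral_PiM_lborel_translate:
  fixes G :: "('l \<Rightarrow> 'a::euclidean_space) \<Rightarrow> ennreal"
  assumes L: "finite L" and G: "G \<in> borel_measurable (PiM L (\<lambda>_. lborel))"
  shows "(\<integral>\<^sup>+y. G (\<lambda>b\<in>L. y b + u) \<partial>PiM L (\<lambda>_. lborel)) = (\<integral>\<^sup>+y. G y \<partial>PiM L (\<lambda>_. lborel))"
proof -
  interpret product_sigma_finite "\<lambda>_. lborel :: 'a measure" by (rule product_sigma_finite_lborel)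
  let ?P = "PiM L (\<lambda>_::'l. lborel :: 'a measure)" and ?t = "\<lambda>y. \<lambda>b\<in>L. y b + u"
  have t [measurable]: "?t \<in> measurable ?P ?P"
    by (intro measurable_restrict) measurable
  have "distr ?P ?P ?t = ?P"
  proof (rule PiM_eqI[OF L])
    fix A :: "'l \<Rightarrow> 'a set" assume A: "\<And>i. i \<in> L \<Longrightarrow> A i \<in> sets lborel"
    have A': "(\<lambda>y. y + u) -` A i \<in> sets lborel" if "i \<in> L" for i
      using measurable_sets[of "\<lambda>y. y + u" lborel lborel "A i"] A[OF that] by simp
    have "emeasure (distr ?P ?P ?t) (Pi\<^sub>E L A) = emeasure ?P (?t -` Pi\<^sub>E L A \<inter> space ?P)"
      by (rule emeasure_distr[OF t]) (use L A in \<open>auto intro!: sets_PiM_I_finite\<close>)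
    also have "?t -` Pi\<^sub>E L A \<inter> space ?P = Pi\<^sub>E L (\<lambda>i. (\<lambda>y. y + u) -` A i)"
      by (auto simp: space_PiM PiE_iff extensional_def)
    also have "emeasure ?P \<dots> = (\<Prod>i\<in>L. emeasure lborel ((\<lambda>y. y + u) -` A i))"
      by (rule emeasure_PiM[OF L]) (use A' in auto)
    also have "\<dots> = (\<Prod>i\<in>L. emeasure lborel (A i))"
    proof (intro prod.cong refl)
      fix i assume i: "i \<in> L"
      have "emeasure lborel (A i) = emeasure (distr lborel borel ((+) u)) (A i)"
        by (simp add: lborel_distr_plus)
      also have "\<dots> = emeasure lborel ((+) u -` A i \<inter> space lborel)"
        by (rule emeasure_distr) (use A[OF i] in auto)
      finally show "emeasure lborel ((\<lambda>y. y + u) -` A i) = emeasure lborel (A i)"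
        by (simp add: add.commute[of u] vimage_def)
    qed
    finally show "emeasure (distr ?P ?P ?t) (Pi\<^sub>E L A) = (\<Prod>i\<in>L. emeasure lborel (A i))" .
  qed simp
  then have "(\<integral>\<^sup>+y. G y \<partial>?P) = (\<integral>\<^sup>+y. G y \<partial>distr ?P ?P ?t)" by simp
  also have "\<dots> = (\<integral>\<^sup>+y. G (?t y) \<partial>?P)" by (rule nn_integral_distr) (use G in simp_all)
  finally show ?thesis by simp
qed

context connection_function
begin

subsection \<open>Bounds for the covered volume\<close>

definition ball_volume :: real where
  "ball_volume = measure lborel (cball (0::real^'d) 1)"

lemma measure_cball_translate: "measure lborel (cball (c::real^'d) 1) = ball_volume"
  unfolding ball_volume_def by (simp add: content_cball)

text \<open>Union bound: a point joined to \<open>V\<close> is joined to some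
  \<open>a \<in> V\<close>, and then lies in the unit ball around \<open>x a\<close>.\<close>

lemma one_minus_avoid_le:
  assumes "finite V"
  shows "1 - avoid psi V x y \<le> (\<Sum>a\<in>V. indicator (cball (x a) 1) y)"
  using assms
proof (induction V rule: finite_induct)
  case (insert a V)
  have "avoid psi (insert a V) x y = (1 - psi (x a - y)) * avoid psi V x y"
    using insert by (simp add: avoid_def)
  moreover have "(1 - psi (x a - y)) * avoid psi V x y \<ge> avoid psi V x y - psi (x a - y)"
    using mult_left_le[OF avoid01(2)[of V x y], of "psi (x a - y)"] psi01[of "x a - y"] by (simp add: algebra_simps)
  moreover have "psi (x a - y) \<le> indicator (cball (x a) 1) y"
    using psi01[of "x a - y"] psi_supp[of "x a - y"] by (cases "psi (x a - y) = 0") (auto simp: dist_norm)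
  ultimately show ?case using insert by simp
qed (simp add: avoid_def)

lemma integrable_one_minus_avoid:
  assumes "finite V"
  shows "integrable lborel (\<lambda>y. 1 - avoid psi V x y)"
proof (rule Bochner_Integration.integrable_bound)
  show "integrable lborel (\<lambda>y. \<Sum>a\<in>V. indicator (cball (x a) 1) y :: real)"
    by (intro Bochner_Integration.integrable_sum integrable_real_indicator)
      (use emeasure_lborel_cball_finite in auto)
  show "(\<lambda>y. 1 - avoid psi V x y) \<in> borel_measurable lborel"
    using measurable_avoid_const[of V x] by simp
  show "AE y in lborel. norm (1 - avoid psi V x y) \<le> norm (\<Sum>a\<in>V. indicator (cball (x a) 1) y :: real)"
  proof (rule AE_I2)
    fix y
    have "norm (1 - avoid psi V x y) = 1 - avoid psi V x y" using avoid01(2)[of V x y] by simp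
    also have "\<dots> \<le> (\<Sum>a\<in>V. indicator (cball (x a) 1) y)" by (rule one_minus_avoid_le[OF assms])
    also have "\<dots> \<le> norm (\<Sum>a\<in>V. indicator (cball (x a) 1) y :: real)" by simp
    finally show "norm (1 - avoid psi V x y) \<le> norm (\<Sum>a\<in>V. indicator (cball (x a) 1) y :: real)" .
  qed
qed

lemma cover_nonneg: "0 \<le> cover psi V x"
  unfolding cover_def using avoid01(2)[of V x] by (intro Bochner_Integration.integral_nonneg) auto

text \<open>The growth is linear in the number of points and uniform in the positions; dividing by
  that number makes \<open>ball_volume\<close> the Lipschitz constant of
  \<open>Z lam + ln lam\<close>.\<close>

lemma cover_le:
  assumes "finite V"
  shows "cover psi V x \<le> real (card V) * ball_volume"
proof -
  have fin: "emeasure lborel (cball (c::real^'d) 1) < \<infinity>" for c by (rule emeasure_lborel_cball_finite)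
  have "cover psi V x \<le> (LINT y|lborel. (\<Sum>a\<in>V. indicator (cball (x a) 1) y))"
    unfolding cover_def
    by (intro integral_mono integrable_one_minus_avoid assms one_minus_avoid_le
        Bochner_Integration.integrable_sum integrable_real_indicator) (use fin in auto)
  also have "\<dots> = (\<Sum>a\<in>V. LINT y|lborel. indicator (cball (x a) 1) y)"
    by (rule Bochner_Integration.integral_sum) (use fin in \<open>auto intro!: integrable_real_indicator\<close>)
  also have "\<dots> = (\<Sum>a\<in>V. ball_volume)"
    by (intro sum.cong refl) (simp add: measure_cball_translate)
  finally show ?thesis by simp
qed

text \<open>Pointwise \<open>1 - p * q \<le> (1 - p) + (1 - q)\<close> on \<open>[0,1]\<close>. It
  makes the exponential factor of \<open>weight\<close> supermultiplicative under gluing.\<close>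

lemma cover_Un_le:
  assumes "finite X" "finite Y" "X \<inter> Y = {}"
  shows "cover psi (X \<union> Y) x \<le> cover psi X x + cover psi Y x"
proof -
  have "cover psi X x + cover psi Y x = (LINT y|lborel. (1 - avoid psi X x y) + (1 - avoid psi Y x y))"
    unfolding cover_def
    by (rule Bochner_Integration.integral_add[symmetric]) (use assms integrable_one_minus_avoid in auto)
  also have "\<dots> \<ge> cover psi (X \<union> Y) x"
    unfolding cover_def
  proof (rule integral_mono)
    fix y
    have "avoid psi (X \<union> Y) x y = avoid psi X x y * avoid psi Y x y"
      using assms by (simp add: avoid_def prod.union_disjoint)
    moreover have "0 \<le> (1 - avoid psi X x y) * (1 - avoid psi Y x y)"
      using avoid01(2)[of X x y] avoid01(2)[of Y x y] by simp
    ultimately show "1 - avoid psi (X \<union> Y) x y \<le> (1 - avoid psi X x y) + (1 - avoid psi Y x y)"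
      by (simp add: algebra_simps)
  qed (rule Bochner_Integration.integrable_add integrable_one_minus_avoid finite_UnI assms)+
  finally show ?thesis .
qed

lemma cover_translate: "cover psi V (\<lambda>v. x v + u) = cover psi V x"
proof -
  have "cover psi V (\<lambda>v. x v + u) = (LINT y|distr lborel borel ((+) u). 1 - avoid psi V (\<lambda>v. x v + u) y)"
    unfolding cover_def by (simp add: lborel_distr_plus)
  also have "\<dots> = (LINT y|lborel. 1 - avoid psi V (\<lambda>v. x v + u) (u + y))"
    using measurable_avoid_const[of V "\<lambda>v. x v + u"] by (intro integral_distr) auto
  also have "\<dots> = cover psi V x"
    unfolding cover_def avoid_def by (simp add: add.commute)
  finally show ?thesis .
qed

lemma cover_cong: "(\<And>v. v \<in> V \<Longrightarrow> x v = x' v) \<Longrightarrow> cover psi V x = cover psi V x'"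
  by (simp add: cover_def avoid_def)

subsection \<open>Gluing clusters\<close>

lemma weight_nonneg: "0 \<le> weight lam V x"
  by (simp add: weight_def conn_weight_nonneg)

lemma weight_cong:
  assumes "\<And>v. v \<in> V \<Longrightarrow> x v = x' v + u"
  shows "weight lam V x = weight lam V x'"
proof -
  have "cover psi V x = cover psi V (\<lambda>v. x' v + u)" by (rule cover_cong) (use assms in auto)
  moreover have "conn_weight psi V x = conn_weight psi V x'" by (rule conn_weight_cong) (simp add: assms)
  ultimately show ?thesis by (simp add: weight_def cover_translate)
qed

lemma measurable_weight:
  assumes "finite V" "\<And>v. v \<in> V \<Longrightarrow> (\<lambda>w. x w v) \<in> borel_measurable M"
  shows "(\<lambda>w. weight lam V (x w)) \<in> borel_measurable M"
proof -
  have [measurable]: "(\<lambda>w. conn_weight psi V (x w)) \<in> borel_measurable M" "(\<lambda>w. cover psi V (x w)) \<in> borel_measurable M"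
    using assms by (auto intro: measurable_conn_weight measurable_cover)
  show ?thesis unfolding weight_def by measurable
qed

lemma weight_Un:
  assumes fin: "finite X" "finite Y" "X \<inter> Y = {}" and ab: "a \<in> X" "b \<in> Y" and lam: "0 \<le> lam"
  shows "weight lam X x * weight lam Y x * psi (x a - x b) \<le> weight lam (X \<union> Y) x"
proof -
  have "weight lam X x * weight lam Y x * psi (x a - x b) =
    (conn_weight psi X x * conn_weight psi Y x * psi (x a - x b)) * exp (- lam * (cover psi X x + cover psi Y x))"
    by (simp add: weight_def exp_add[symmetric] algebra_simps)
  also have "\<dots> \<le> conn_weight psi (X \<union> Y) x * exp (- lam * cover psi (X \<union> Y) x)"
  proof (rule mult_mono)
    show "conn_weight psi X x * conn_weight psi Y x * psi (x a - x b) \<le> conn_weight psi (X \<union> Y) x"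
      using gwt_gconn_Un[OF fin, of "edge_prob psi x", OF edge_prob01 ab] by (simp add: conn_weight_def)
    show "exp (- lam * (cover psi X x + cover psi Y x)) \<le> exp (- lam * cover psi (X \<union> Y) x)"
      using mult_left_mono[OF cover_Un_le[OF fin, of x] lam] by simp
  qed (auto simp: conn_weight_nonneg)
  finally show ?thesis by (simp add: weight_def)
qed

text \<open>Half of the integral of \<open>psi\<close>, by symmetry and because the hyperplane
  \<open>u $ i = 0\<close> is null; see the proof of \<open>right_mass_pos\<close>.\<close>

definition right_mass :: "'d \<Rightarrow> ennreal" where
  "right_mass i = (\<integral>\<^sup>+u. indicator {u. 0 < u $ i} u * ennreal (psi u) \<partial>lborel)"

text \<open>The integral of the cluster size formula. By \<open>rooted_eq\<close> it depends on
  \<open>L\<close> and \<open>r\<close> only through \<open>card L\<close>, which allows arbitrary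
  label sets and roots when gluing.\<close>

abbreviation rooted :: "real \<Rightarrow> 'l set \<Rightarrow> 'l \<Rightarrow> ennreal" where
  "rooted lam L r \<equiv> \<integral>\<^sup>+x. ennreal (weight lam (insert r L) (x(r := 0))) \<partial>PiM L (\<lambda>_. lborel)"

definition left_of :: "'d \<Rightarrow> 'l set \<Rightarrow> 'l set \<Rightarrow> ('l \<Rightarrow> real^'d) \<Rightarrow> bool" where
  "left_of i X Y x \<longleftrightarrow> (\<forall>a\<in>X. \<forall>b\<in>Y. x a $ i < x b $ i)"

lemma left_of_cong: "(\<And>v. v \<in> X \<union> Y \<Longrightarrow> x v = x' v) \<Longrightarrow> left_of i X Y x = left_of i X Y x'"
  by (simp add: left_of_def)

lemma rooted_meas:
  assumes "finite L"
  shows "(\<lambda>x. weight lam (insert r L) (x(r := 0))) \<in> borel_measurable (PiM L (\<lambda>_. lborel))"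
proof (rule measurable_weight)
  fix v assume "v \<in> insert r L"
  then show "(\<lambda>x. (x(r := (0::real^'d))) v) \<in> borel_measurable (PiM L (\<lambda>_. lborel))"
    using measurable_upd[of v r L] by (simp cong: measurable_cong_sets sets_PiM_cong)
qed (use assms in simp)

lemma measurable_left_of:
  assumes "finite X" "finite Y" "\<And>v. v \<in> X \<union> Y \<Longrightarrow> (\<lambda>w. x w v) \<in> borel_measurable M"
  shows "Measurable.pred M (\<lambda>w. left_of i X Y (x w))"
  unfolding left_of_def
proof (intro pred_intros_finite assms)
  fix a b assume "a \<in> X" "b \<in> Y"
  then have "(\<lambda>w. x w a) \<in> borel_measurable M" "(\<lambda>w. x w b) \<in> borel_measurable M"
    using assms by auto
  then have [measurable]: "(\<lambda>w. x w a $ i) \<in> borel_measurable M" "(\<lambda>w. x w b $ i) \<in> borel_measurable M"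
    by (auto intro: measurable_compose[OF _ borel_measurable_nth])
  show "Measurable.pred M (\<lambda>w. x w a $ i < x w b $ i)" by measurable
qed

text \<open>The right block is translated rigidly: integrating its translation vector first, the edge
  from the rightmost vertex of the left block to the leftmost vertex of the right block contributes
  the constant factor \<open>right_mass i\<close>, whatever the two blocks look like.\<close>

lemma glue_translates:
  fixes x z :: "'l \<Rightarrow> real^'d"
  assumes fin: "finite X" "X \<noteq> {}" "finite Y" "Y \<noteq> {}" "X \<inter> Y = {}" and lam: "0 \<le> lam"
  defines "c \<equiv> \<lambda>u v. if v \<in> Y then z v + u else x v"
  shows "ennreal (weight lam X x) * ennreal (weight lam Y z) * right_mass i \<le>
    (\<integral>\<^sup>+u. of_bool (left_of i X Y (c u)) * ennreal (weight lam (X \<union> Y) (c u)) \<partial>lborel)"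
proof -
  obtain a where a: "a \<in> X" "\<And>a'. a' \<in> X \<Longrightarrow> x a' $ i \<le> x a $ i"
    using obtains_MAX[OF fin(1,2), of "\<lambda>a. x a $ i"] by (metis Max_ge finite_imageI fin(1) imageI)
  obtain b where b: "b \<in> Y" "\<And>b'. b' \<in> Y \<Longrightarrow> z b $ i \<le> z b' $ i"
    using obtains_MIN[OF fin(3,4), of "\<lambda>a. z a $ i"] by (metis Min_le finite_imageI fin(3) imageI)
  define h where "h u = indicator {u. 0 < u $ i} u * ennreal (psi u)" for u :: "real^'d"
  have hm [measurable]: "h \<in> borel_measurable borel" unfolding h_def by measurable
  let ?C = "ennreal (weight lam X x) * ennreal (weight lam Y z)"
  \<comment> \<open>The shift makes the argument of \<open>h\<close> the difference between the
    leftmost vertex \<open>b\<close> of the translated right block and the rightmost vertex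
    \<open>a\<close> of the left one; it has positive \<open>i\<close>-th coordinate exactly when
    the blocks are separated.\<close>
  have "?C * right_mass i = ?C * (\<integral>\<^sup>+u. h (u + (z b - x a)) \<partial>lborel)"
    unfolding right_mass_def h_def[symmetric] by (subst nn_integral_lborel_translate[OF hm]) simp
  also have "\<dots> = (\<integral>\<^sup>+u. ?C * h (u + (z b - x a)) \<partial>lborel)"
    by (rule nn_integral_cmult[symmetric]) simp
  also have "\<dots> \<le> (\<integral>\<^sup>+u. of_bool (left_of i X Y (c u)) * ennreal (weight lam (X \<union> Y) (c u)) \<partial>lborel)"
  proof (rule nn_integral_mono)
    fix u
    show "?C * h (u + (z b - x a)) \<le> of_bool (left_of i X Y (c u)) * ennreal (weight lam (X \<union> Y) (c u))"
    proof (cases "0 < (u + (z b - x a)) $ i")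
      case True
      have "left_of i X Y (c u)"
        unfolding left_of_def
      proof (intro ballI)
        fix a' b' assume a': "a' \<in> X" and b': "b' \<in> Y"
        then have "a' \<notin> Y" using fin(5) by auto
        then show "c u a' $ i < c u b' $ i"
          using True a(2)[OF a'] b(2)[OF b'] b' by (simp add: c_def)
      qed
      moreover have "?C * h (u + (z b - x a)) \<le> ennreal (weight lam (X \<union> Y) (c u))"
      proof -
        have "a \<notin> Y" using a fin by auto
        then have "psi (c u a - c u b) = psi (u + (z b - x a))"
          using b by (simp add: c_def psi_minus[of "x a"] algebra_simps)
        moreover have "weight lam X (c u) = weight lam X x"
          using fin(5) by (intro weight_cong[where u = 0]) (auto simp: c_def)
        moreover have "weight lam Y (c u) = weight lam Y z"
          by (rule weight_cong[where u = u]) (simp add: c_def)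
        ultimately have "weight lam X x * weight lam Y z * psi (u + (z b - x a)) \<le>
            weight lam (X \<union> Y) (c u)"
          using weight_Un[OF fin(1,3,5) a(1) b(1) lam, of "c u"] by simp
        then have "ennreal (weight lam X x * weight lam Y z * psi (u + (z b - x a))) \<le>
            ennreal (weight lam (X \<union> Y) (c u))" by (rule ennreal_leI)
        then show ?thesis using True psi01
          by (simp add: h_def ennreal_mult weight_nonneg)
      qed
      ultimately show ?thesis by simp
    qed (simp add: h_def)
  qed
  finally show ?thesis .
qed

text \<open>The right block is parametrised by the position \<open>u\<close> of its anchor
  \<open>b\<close> and the shape relative to \<open>b\<close>. After Fubini the integral over
  \<open>u\<close> is innermost, and \<open>glue_translates\<close> applies for each fixed pair of
  shapes.\<close>

lemma rooted_glue:
  fixes A B :: "'l set"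
  assumes fin: "finite A" "finite B" and disj: "A \<inter> insert b B = {}" "b \<notin> B" "r \<notin> A \<union> insert b B"
    and lam: "0 \<le> lam"
  shows "rooted lam A r * rooted lam B b * right_mass i \<le>
    (\<integral>\<^sup>+x. of_bool (left_of i (insert r A) (insert b B) (x(r := 0))) *
       ennreal (weight lam (insert r (A \<union> insert b B)) (x(r := 0))) \<partial>PiM (A \<union> insert b B) (\<lambda>_. lborel))"
proof -
  interpret product_sigma_finite "\<lambda>_::'l. lborel :: (real^'d) measure" by (rule product_sigma_finite_lborel)
  let ?P = "\<lambda>L. PiM L (\<lambda>_::'l. lborel :: (real^'d) measure)"
  let ?Y = "insert b B" and ?X = "insert r A"
  let ?f = "\<lambda>x. ennreal (weight lam ?X (x(r := 0)))" and ?h = "\<lambda>y. ennreal (weight lam ?Y (y(b := 0)))"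
  have finY: "finite ?Y" using fin by simp
  have XY: "?X \<inter> ?Y = {}" using disj by auto
  have XYeq: "?X \<union> ?Y = insert r (A \<union> ?Y)" by auto
  define G where "G x = of_bool (left_of i ?X ?Y (x(r := 0))) *
       ennreal (weight lam (?X \<union> ?Y) (x(r := 0)))" for x :: "'l \<Rightarrow> real^'d"
  have comp: "(\<lambda>x. (x(r := 0)) v) \<in> borel_measurable (?P (A \<union> ?Y))" if "v \<in> insert r (A \<union> ?Y)" for v
    using measurable_upd[OF that] by (simp cong: measurable_cong_sets sets_PiM_cong)
  have Gm: "G \<in> borel_measurable (?P (A \<union> ?Y))"
  proof -
    have [measurable]: "Measurable.pred (?P (A \<union> ?Y)) (\<lambda>x. left_of i ?X ?Y (x(r := 0)))"
      by (rule measurable_left_of) (use fin comp in auto)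
    have [measurable]: "(\<lambda>x. weight lam (?X \<union> ?Y) (x(r := 0))) \<in> borel_measurable (?P (A \<union> ?Y))"
      by (rule measurable_weight) (use fin comp in auto)
    show ?thesis unfolding G_def by measurable
  qed
  have inner: "?f x * (rooted lam B b * right_mass i) \<le>
      (\<integral>\<^sup>+y. G (merge A ?Y (x, y)) \<partial>?P ?Y)" if x: "x \<in> space (?P A)" for x
  proof -
    define H where "H = (\<lambda>y. G (merge A ?Y (x, y)))"
    have Hm: "H \<in> borel_measurable (?P ?Y)"
    proof -
      have "(\<lambda>y. (x, y)) \<in> measurable (?P ?Y) (?P A \<Otimes>\<^sub>M ?P ?Y)" using x by (rule measurable_Pair1')
      from measurable_compose[OF measurable_compose[OF this measurable_merge] Gm]
      show ?thesis by (simp add: H_def)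
    qed
    \<comment> \<open>Places the right block: the anchor at \<open>u\<close> and every other vertex
      at its relative position plus \<open>u\<close>.\<close>
    define T where "T y u = (\<lambda>v\<in>?Y. if v = b then u else y v + u)" for y :: "'l \<Rightarrow> real^'d" and u :: "real^'d"
    have Tm: "(\<lambda>z. T (fst z) (snd z)) \<in> measurable (?P B \<Otimes>\<^sub>M lborel) (?P ?Y)"
      unfolding T_def
    proof (rule measurable_restrict)
      fix v assume v: "v \<in> ?Y"
      show "(\<lambda>z. if v = b then snd z else fst z v + snd z) \<in> measurable (?P B \<Otimes>\<^sub>M lborel) lborel"
      proof (cases "v = b")
        case False
        then have "v \<in> B" using v by simp
        then have "(\<lambda>y. y v) \<in> measurable (?P B) lborel" by (rule measurable_component_singleton)
        then have "(\<lambda>y. y v) \<in> borel_measurable (?P B)" by simp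
        from measurable_compose[OF measurable_fst this]
        have "(\<lambda>z. fst z v) \<in> borel_measurable (?P B \<Otimes>\<^sub>M (lborel :: (real^'d) measure))" .
        moreover have "snd \<in> borel_measurable (?P B \<Otimes>\<^sub>M (lborel :: (real^'d) measure))" by simp
        ultimately have "(\<lambda>z. fst z v + snd z) \<in> borel_measurable (?P B \<Otimes>\<^sub>M lborel)"
          by (rule borel_measurable_add)
        then show ?thesis using False by simp
      qed simp
    qed
    have HTm: "(\<lambda>(y, u). H (T y u)) \<in> borel_measurable (?P B \<Otimes>\<^sub>M lborel)"
      using measurable_compose[OF Tm Hm] by (simp add: case_prod_unfold)
    have "(\<integral>\<^sup>+y. H y \<partial>?P ?Y) = (\<integral>\<^sup>+u. (\<integral>\<^sup>+y. H (y(b := u)) \<partial>?P B) \<partial>lborel)"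
      by (rule product_nn_integral_insert_rev[OF fin(2) disj(2) Hm])
    also have "\<dots> = (\<integral>\<^sup>+u. (\<integral>\<^sup>+y. H (T y u) \<partial>?P B) \<partial>lborel)"
    proof (rule nn_integral_cong)
      fix u :: "real^'d"
      have "(\<lambda>y. y(b := u)) \<in> measurable (?P B) (?P ?Y)"
        by (rule measurable_fun_upd[where J = B]) auto
      then have m: "(\<lambda>y. H (y(b := u))) \<in> borel_measurable (?P B)" by (rule measurable_compose[OF _ Hm])
      have "(\<integral>\<^sup>+y. H (y(b := u)) \<partial>?P B) = (\<integral>\<^sup>+y. H ((\<lambda>v\<in>B. y v + u)(b := u)) \<partial>?P B)"
        by (rule nn_integral_PiM_lborel_translate[OF fin(2) m, symmetric])
      also have "\<dots> = (\<integral>\<^sup>+y. H (T y u) \<partial>?P B)"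
      proof (intro nn_integral_cong arg_cong[where f = H])
        fix y show "(\<lambda>v\<in>B. y v + u)(b := u) = T y u" using disj by (auto simp: T_def fun_eq_iff)
      qed
      finally show "(\<integral>\<^sup>+y. H (y(b := u)) \<partial>?P B) = (\<integral>\<^sup>+y. H (T y u) \<partial>?P B)" .
    qed
    also have "\<dots> = (\<integral>\<^sup>+y. (\<integral>\<^sup>+u. H (T y u) \<partial>lborel) \<partial>?P B)"
    proof -
      interpret pair_sigma_finite "?P B" "lborel :: (real^'d) measure"
        using sigma_finite[OF fin(2)] by (simp add: pair_sigma_finite_def sigma_finite_lborel)
      show ?thesis using HTm by (rule Fubini')
    qed
    also have "\<dots> \<ge> (\<integral>\<^sup>+y. (?f x * right_mass i) *
        ?h y \<partial>?P B)"
    proof (rule nn_integral_mono)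
      fix y
      let ?c = "\<lambda>u v. if v \<in> ?Y then (y(b := 0)) v + u else (x(r := 0)) v"
      have HT: "H (T y u) = of_bool (left_of i ?X ?Y (?c u)) * ennreal (weight lam (?X \<union> ?Y) (?c u))" for u
      proof -
        have eq: "((merge A ?Y (x, T y u))(r := 0)) v = ?c u v" if "v \<in> ?X \<union> ?Y" for v
          using that XY disj by (auto simp: merge_def T_def)
        have "left_of i ?X ?Y ((merge A ?Y (x, T y u))(r := 0)) = left_of i ?X ?Y (?c u)"
          by (rule left_of_cong) (rule eq)
        moreover have "weight lam (?X \<union> ?Y) ((merge A ?Y (x, T y u))(r := 0)) = weight lam (?X \<union> ?Y) (?c u)"
          by (rule weight_cong[where u = 0]) (use eq in simp)
        ultimately show ?thesis by (simp only: H_def G_def)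
      qed
      show "(?f x * right_mass i) * ?h y \<le>
          (\<integral>\<^sup>+u. H (T y u) \<partial>lborel)"
        unfolding HT
        using glue_translates[of ?X ?Y lam "x(r := 0)" "y(b := 0)" i] fin XY lam
        by (simp add: mult_ac)
    qed
    also have "(\<integral>\<^sup>+y. (?f x * right_mass i) *
        ?h y \<partial>?P B) =
        (?f x * right_mass i) * rooted lam B b"
      by (rule nn_integral_cmult) (rule measurable_compose[OF rooted_meas[OF fin(2)] measurable_ennreal])
    finally show ?thesis by (simp add: H_def mult_ac)
  qed
  have "rooted lam A r * (rooted lam B b * right_mass i) =
      (\<integral>\<^sup>+x. ?f x * (rooted lam B b * right_mass i) \<partial>?P A)"
    by (rule nn_integral_multc[symmetric]) (rule measurable_compose[OF rooted_meas[OF fin(1)] measurable_ennreal])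
  also have "\<dots> \<le> (\<integral>\<^sup>+x. (\<integral>\<^sup>+y. G (merge A ?Y (x, y)) \<partial>?P ?Y) \<partial>?P A)"
    by (rule nn_integral_mono) (rule inner)
  also have "\<dots> = (\<integral>\<^sup>+x. G x \<partial>?P (A \<union> ?Y))"
    by (rule product_nn_integral_fold[OF _ fin(1) finY Gm, symmetric]) (use disj in auto)
  finally show ?thesis unfolding G_def XYeq by (simp add: mult.assoc)
qed

text \<open>For a given configuration at most one set \<open>A\<close> of a given size lies to the left of its
  complement, so the contributions of different \<open>A\<close> add up.\<close>

lemma rooted_supermult:
  fixes L :: "'l set"
  assumes L: "finite L" "r \<notin> L" "card L = k + Suc l" and lam: "0 \<le> lam"
    and J: "\<And>A. A \<subseteq> L \<Longrightarrow> card A = k \<Longrightarrow> rooted lam A r = Jk"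
      "\<And>B b. insert b B \<subseteq> L \<Longrightarrow> b \<notin> B \<Longrightarrow> card B = l \<Longrightarrow> rooted lam B b = Jl"
  shows "of_nat (card L choose k) * (Jk * Jl * right_mass i) \<le> rooted lam L r"
proof -
  let ?S = "{A. A \<subseteq> L \<and> card A = k}"
  let ?F = "\<lambda>x. ennreal (weight lam (insert r L) (x(r := 0)))"
  let ?ev = "\<lambda>A x. left_of i (insert r A) (L - A) (x(r := (0::real^'d)))"
  have finS: "finite ?S" using L by simp
  have each: "Jk * Jl * right_mass i \<le> (\<integral>\<^sup>+x. of_bool (?ev A x) * ?F x \<partial>PiM L (\<lambda>_. lborel))" if A: "A \<in> ?S" for A
  proof -
    have fA: "finite A" using A L by (auto intro: finite_subset)
    have "card (L - A) = Suc l" using A L fA by (simp add: card_Diff_subset)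
    \<comment> \<open>Any vertex of the right block may serve as its anchor, since \<open>J\<close>
      gives the same value for every choice. Using a single anchor per \<open>A\<close> is where the
      factor \<open>1/n\<close> is lost.\<close>
    then obtain b B where bB: "L - A = insert b B" "b \<notin> B" "card B = l" by (auto simp: card_Suc_eq)
    have fB: "finite B" using bB L by (metis finite_Diff finite_insert)
    have L_eq: "L = A \<union> insert b B" using A bB by auto
    have "rooted lam A r * rooted lam B b * right_mass i \<le>
      (\<integral>\<^sup>+x. of_bool (left_of i (insert r A) (insert b B) (x(r := 0))) *
       ennreal (weight lam (insert r (A \<union> insert b B)) (x(r := 0))) \<partial>PiM (A \<union> insert b B) (\<lambda>_. lborel))"
    proof (rule rooted_glue[OF fA fB _ bB(2) _ lam])
      show "A \<inter> insert b B = {}" unfolding bB(1)[symmetric] by blast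
      show "r \<notin> A \<union> insert b B" unfolding bB(1)[symmetric] using L(2) A by blast
    qed
    moreover have "rooted lam A r = Jk" using A by (intro J) auto
    moreover have "rooted lam B b = Jl" using bB by (intro J) auto
    ultimately show ?thesis unfolding bB(1) L_eq[symmetric] by (simp only:)
  qed
  have le1: "(\<Sum>A\<in>?S. of_bool (?ev A x)) \<le> (1::ennreal)" for x
  proof -
    \<comment> \<open>Two different sets of equal size each contain an element missing from the
      other, and the two events order these elements in opposite ways.\<close>
    have uniq: "A = A'" if "A \<in> ?S" "A' \<in> ?S" "?ev A x" "?ev A' x" for A A'
    proof (rule ccontr)
      assume ne: "A \<noteq> A'"
      have fin: "finite A" "finite A'" using that L by (auto intro: finite_subset)
      have "\<not> A \<subseteq> A'" using card_subset_eq[OF fin(2), of A] that ne by auto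
      moreover have "\<not> A' \<subseteq> A" using card_subset_eq[OF fin(1), of A'] that ne by auto
      ultimately obtain a a' where a: "a \<in> A" "a \<notin> A'" "a' \<in> A'" "a' \<notin> A" by blast
      then have "a \<in> L" "a' \<in> L" using that(1,2) by auto
      then have "(x(r := 0)) a $ i < (x(r := 0)) a' $ i" "(x(r := 0)) a' $ i < (x(r := 0)) a $ i"
        using that(3)[unfolded left_of_def, THEN bspec, THEN bspec, of a a']
          that(4)[unfolded left_of_def, THEN bspec, THEN bspec, of a' a] a by simp_all
      then show False by (rule less_asym)
    qed
    have "(\<Sum>A\<in>?S. of_bool (?ev A x) :: ennreal) = of_nat (card {A\<in>?S. ?ev A x})"
      using finS by (subst sum_of_bool_eq) (auto simp: Int_def)
    moreover have "card {A\<in>?S. ?ev A x} \<le> 1"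
    proof (subst card_le_Suc0_iff_eq[folded One_nat_def])
      show "finite {A\<in>?S. ?ev A x}" by (rule finite_subset[OF _ finS]) auto
      show "\<forall>A\<in>{A\<in>?S. ?ev A x}. \<forall>A'\<in>{A\<in>?S. ?ev A x}. A = A'" using uniq by blast
    qed
    then have "(of_nat (card {A\<in>?S. ?ev A x}) :: ennreal) \<le> of_nat 1" by (rule of_nat_mono)
    ultimately show ?thesis by simp
  qed
  have comp: "(\<lambda>x. (x(r := 0)) v) \<in> borel_measurable (PiM L (\<lambda>_. lborel :: (real^'d) measure))" if "v \<in> insert r L" for v
    using measurable_upd[OF that] by (simp cong: measurable_cong_sets sets_PiM_cong)
  have Fm: "?F \<in> borel_measurable (PiM L (\<lambda>_. lborel))"
    by (rule measurable_compose[OF rooted_meas[OF L(1)] measurable_ennreal])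
  have evm: "(\<lambda>x. of_bool (?ev A x) * ?F x) \<in> borel_measurable (PiM L (\<lambda>_. lborel))" if "A \<in> ?S" for A
  proof -
    have [measurable]: "Measurable.pred (PiM L (\<lambda>_. lborel)) (\<lambda>x. ?ev A x)"
      by (rule measurable_left_of) (use that L comp in \<open>auto intro: finite_subset\<close>)
    show ?thesis using Fm by measurable
  qed
  have "of_nat (card L choose k) * (Jk * Jl * right_mass i) = (\<Sum>A\<in>?S. Jk * Jl * right_mass i)"
    using n_subsets[OF L(1), of k] by simp
  also have "\<dots> \<le> (\<Sum>A\<in>?S. \<integral>\<^sup>+x. of_bool (?ev A x) * ?F x \<partial>PiM L (\<lambda>_. lborel))"
    by (rule sum_mono) (rule each)
  also have "\<dots> = (\<integral>\<^sup>+x. (\<Sum>A\<in>?S. of_bool (?ev A x) * ?F x) \<partial>PiM L (\<lambda>_. lborel))"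
    by (rule nn_integral_sum[symmetric]) (rule evm)
  also have "\<dots> \<le> (\<integral>\<^sup>+x. ?F x \<partial>PiM L (\<lambda>_. lborel))"
  proof (rule nn_integral_mono)
    fix x
    have "(\<Sum>A\<in>?S. of_bool (?ev A x) * ?F x) = (\<Sum>A\<in>?S. of_bool (?ev A x)) * ?F x"
      by (rule sum_distrib_right[symmetric])
    also have "\<dots> \<le> 1 * ?F x" by (rule mult_right_mono[OF le1]) simp
    finally show "(\<Sum>A\<in>?S. of_bool (?ev A x) * ?F x) \<le> ?F x" by simp
  qed
  finally show ?thesis .
qed

end

subsection \<open>Tails of a sequence with an exponential rate\<close>

text \<open>\<open>P n \<le> T n\<close> gives one bound. For the other,
  \<open>P n \<le> exp (- s) ^ n\<close> eventually with some \<open>s > 0\<close>, and the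
  geometric tail costs only a constant factor.\<close>

lemma tail_exponential_rate:
  fixes P T :: "nat \<Rightarrow> real"
  assumes P: "\<And>n. 0 < n \<Longrightarrow> 0 < P n" and T: "\<And>n. (\<lambda>m. P (n + m)) sums T n" "\<And>n. T n \<le> 1"
    and rate: "(\<lambda>n. - ln (P n) / real n) \<longlonglongrightarrow> z"
  shows "(\<lambda>n. - ln (T n) / real n) \<longlonglongrightarrow> z"
proof (rule order_tendstoI)
  have P_le: "P n \<le> T n" if n: "0 < n" for n
  proof -
    have "sum (\<lambda>m. P (n + m)) {0} \<le> (\<Sum>m. P (n + m))"
      by (rule sum_le_suminf) (use T(1)[of n] P n in \<open>auto simp: sums_iff less_imp_le\<close>)
    then show ?thesis using T(1)[of n] by (simp add: sums_iff)
  qed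
  have T_pos: "0 < T n" if "0 < n" for n using P[OF that] P_le[OF that] by linarith
  {
    fix a assume "z < a"
    with rate have "\<forall>\<^sub>F n in sequentially. - ln (P n) / real n < a" by (rule order_tendstoD)
    then show "\<forall>\<^sub>F n in sequentially. - ln (T n) / real n < a"
      using eventually_gt_at_top[of 0]
    proof eventually_elim
      case (elim n)
      have "ln (P n) \<le> ln (T n)" using P[of n] P_le[of n] T_pos[of n] elim by simp
      then have "- ln (T n) / real n \<le> - ln (P n) / real n" by (intro divide_right_mono) auto
      with elim show ?case by linarith
    qed
  next
    fix a assume a: "a < z"
    show "\<forall>\<^sub>F n in sequentially. a < - ln (T n) / real n"
    \<comment> \<open>A geometric series needs a rate \<open>s > 0\<close> between \<open>a\<close>
      and \<open>z\<close>, which exists if \<open>a \<ge> 0\<close>; for negative \<open>a\<close>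
      the trivial bound \<open>T n \<le> 1\<close> is enough.\<close>
    proof (cases "a < 0")
      case True
      show ?thesis using eventually_gt_at_top[of 0]
      proof eventually_elim
        case (elim n)
        have "ln (T n) \<le> 0" using T_pos[OF elim] T(2)[of n] by simp
        then have "0 \<le> - ln (T n) / real n" by (intro divide_nonneg_nonneg) auto
        with True show ?case by linarith
      qed
    next
      case False
      obtain s where s: "a < s" "s < z" using a dense by blast
      then have s0: "0 < s" using False by linarith
      have "\<forall>\<^sub>F n in sequentially. s < - ln (P n) / real n" using rate s(2) by (rule order_tendstoD)
      then obtain M where M: "\<And>n. M \<le> n \<Longrightarrow> s < - ln (P n) / real n" by (auto simp: eventually_sequentially)
      have P_small: "P n \<le> exp (- s) ^ n" if "Suc M \<le> n" for n
      proof -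
        have n: "0 < n" "M \<le> n" using that by auto
        have "ln (P n) < - s * real n" using M[OF n(2)] n by (simp add: field_simps)
        then have "exp (ln (P n)) < exp (- s * real n)" by (simp only: exp_less_mono)
        then have "P n < exp (- s * real n)" using P[OF n(1)] by simp
        also have "exp (- s * real n) = exp (- s) ^ n" by (simp add: exp_of_nat_mult[symmetric] mult.commute)
        finally show ?thesis by simp
      qed
      \<comment> \<open>Minus the logarithm of the geometric sum \<open>1 / (1 - exp (- s))\<close>;
        divided by \<open>n\<close> it tends to 0.\<close>
      define c where "c = ln (1 - exp (- s))"
      have e1: "exp (- s) < 1" using s0 by simp
      have lower: "s + c / real n \<le> - ln (T n) / real n" if n: "Suc M \<le> n" for n
      proof -
        have geo: "(\<lambda>m. exp (- s) ^ n * exp (- s) ^ m) sums (exp (- s) ^ n * (1 / (1 - exp (- s))))"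
          by (intro sums_mult geometric_sums) (use e1 in simp)
        have "T n \<le> exp (- s) ^ n * (1 / (1 - exp (- s)))"
        proof (rule sums_le[OF _ T(1) geo])
          fix m show "P (n + m) \<le> exp (- s) ^ n * exp (- s) ^ m"
            using P_small[of "n + m"] n by (simp add: power_add)
        qed
        also have "\<dots> = exp (- s * real n - c)"
          using e1 by (simp add: c_def exp_diff exp_of_nat_mult[symmetric] mult.commute)
        finally have "ln (T n) \<le> ln (exp (- s * real n - c))"
          using T_pos[of n] n by (subst ln_le_cancel_iff) auto
        then have "ln (T n) \<le> - s * real n - c" by simp
        then have "(s * real n + c) / real n \<le> - ln (T n) / real n" by (intro divide_right_mono) auto
        moreover have "(s * real n + c) / real n = s + c / real n" using n by (simp add: add_divide_distrib)
        ultimately show ?thesis by simp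
      qed
      have "(\<lambda>n. s + c / real n) \<longlonglongrightarrow> s + 0" by (intro tendsto_add tendsto_const lim_const_over_n)
      then have "\<forall>\<^sub>F n in sequentially. a < s + c / real n" by (rule order_tendstoD) (use s in simp)
      then show ?thesis using eventually_ge_at_top[of "Suc M"]
      proof eventually_elim
        case (elim n)
        then show ?case using lower[of n] by linarith
      qed
    qed
  }
qed

subsection \<open>Monotone coupling in the intensity\<close>

lemma poisson_pmf_add:
  assumes l: "0 < l" and d: "0 < d"
  shows "map_pmf (\<lambda>(a, b). a + b) (pair_pmf (poisson_pmf l) (poisson_pmf d)) = poisson_pmf (l + d)"
proof (rule pmf_eqI)
  fix n :: nat
  let ?q = "pair_pmf (poisson_pmf l) (poisson_pmf d)"
  have ld: "0 < l + d" using assms by simp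
  have inj: "inj_on (\<lambda>i. (i, n - i)) {..n}" by (auto simp: inj_on_def)
  have set: "(\<lambda>(a, b). a + b) -` {n} = (\<lambda>i. (i, n - i)) ` {..n}" by (auto simp: image_iff)
  have "pmf (map_pmf (\<lambda>(a, b). a + b) ?q) n = measure (measure_pmf ?q) ((\<lambda>i. (i, n - i)) ` {..n})"
    by (simp add: pmf_map set)
  also have "\<dots> = (\<Sum>i\<le>n. pmf ?q (i, n - i))"
    by (subst measure_measure_pmf_finite) (simp_all add: sum.reindex[OF inj])
  also have "\<dots> = (\<Sum>i\<le>n. real (n choose i) * l ^ i * d ^ (n - i)) * (exp (- (l + d)) / fact n)"
    unfolding sum_distrib_right
  proof (intro sum.cong refl)
    fix i assume i: "i \<in> {..n}"
    have "real (n choose i) = fact n / (fact i * fact (n - i))" using i by (intro binomial_fact) simp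
    then show "pmf ?q (i, n - i) = real (n choose i) * l ^ i * d ^ (n - i) * (exp (- (l + d)) / fact n)"
    proof -
      have "exp (- l) * exp (- d) = exp (- (l + d))" by (simp add: exp_add[symmetric])
      moreover have "pmf ?q (i, n - i) = (l ^ i * d ^ (n - i)) / (fact i * fact (n - i)) * (exp (- l) * exp (- d))"
        using l d by (simp add: pmf_pair)
      ultimately show ?thesis
        unfolding \<open>real (n choose i) = fact n / (fact i * fact (n - i))\<close> by simp
    qed
  qed
  also have "(\<Sum>i\<le>n. real (n choose i) * l ^ i * d ^ (n - i)) = (l + d) ^ n"
    by (rule binomial_ring[symmetric])
  also have "(l + d) ^ n * (exp (- (l + d)) / fact n) = pmf (poisson_pmf (l + d)) n"
    using ld by simp
  finally show "pmf (map_pmf (\<lambda>(a, b). a + b) ?q) n = pmf (poisson_pmf (l + d)) n" .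
qed

lemma PiM_map_pmf:
  fixes q :: "'a pmf" and h :: "'a \<Rightarrow> 'b"
  shows "PiM UNIV (\<lambda>k::'k. measure_pmf (map_pmf h q)) =
    distr (PiM UNIV (\<lambda>k::'k. measure_pmf q)) (PiM UNIV (\<lambda>k::'k. measure_pmf (map_pmf h q))) (\<lambda>v k. h (v k))"
    (is "?P = distr ?Q ?P ?h")
proof -
  interpret P: product_prob_space "\<lambda>k::'k. measure_pmf (map_pmf h q)" UNIV
    by (rule product_prob_spaceI) (rule prob_space_measure_pmf)
  interpret Q: product_prob_space "\<lambda>k::'k. measure_pmf q" UNIV
    by (rule product_prob_spaceI) (rule prob_space_measure_pmf)
  have h_meas: "?h \<in> measurable ?Q ?P"
  proof (rule measurable_PiM_single')
    fix k
    have "(\<lambda>v. v k) \<in> measurable ?Q (measure_pmf q)" by (rule measurable_component_singleton) simp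
    then show "(\<lambda>v. h (v k)) \<in> measurable ?Q (measure_pmf (map_pmf h q))"
      by (rule measurable_compose) simp
  qed simp
  show ?thesis
  proof (rule P.PiM_eq[symmetric])
    fix J :: "'k set" and F :: "'k \<Rightarrow> 'b set"
    assume J: "finite J"
    let ?E = "prod_emb UNIV (\<lambda>k::'k. measure_pmf (map_pmf h q)) J (Pi\<^sub>E J F)"
    have E: "?E \<in> sets ?P" by (rule sets_PiM_I) (use J in auto)
    have "emeasure (distr ?Q ?P ?h) ?E = emeasure ?Q (?h -` ?E \<inter> space ?Q)"
      by (rule emeasure_distr[OF h_meas E])
    also have "?h -` ?E \<inter> space ?Q = {v \<in> space ?Q. \<forall>j\<in>J. v j \<in> h -` F j}"
      by (auto simp: prod_emb_def space_PiM PiE_iff)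
    also have "emeasure ?Q \<dots> = (\<Prod>j\<in>J. emeasure (measure_pmf q) (h -` F j))"
      by (rule Q.emeasure_PiM_Collect) (use J in auto)
    also have "\<dots> = (\<Prod>j\<in>J. emeasure (measure_pmf (map_pmf h q)) (F j))" by simp
    finally show "emeasure (distr ?Q ?P ?h) ?E = (\<Prod>j\<in>J. emeasure (measure_pmf (map_pmf h q)) (F j))" .
  qed simp
qed

text \<open>Coupling: in each cube take independent Poisson counts \<open>a\<close> and
  \<open>b\<close> of intensities \<open>l\<close> and \<open>l' - l\<close>. Then \<open>a\<close>
  has the smaller law and \<open>a + b\<close> the larger one, so both sides become integrals over
  the same pairs.\<close>

lemma nn_integral_poisson_counts_mono:
  fixes G :: "(int^'d::finite \<Rightarrow> nat) \<Rightarrow> ennreal"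
  assumes l: "0 < l" "l < l'" and mono: "\<And>N N'. (\<And>k. N k \<le> N' k) \<Longrightarrow> G N \<le> G N'"
    and meas: "G \<in> borel_measurable (poisson_counts l)"
  shows "(\<integral>\<^sup>+N. G N \<partial>poisson_counts l) \<le> (\<integral>\<^sup>+N. G N \<partial>poisson_counts l')"
proof -
  define q where "q = pair_pmf (poisson_pmf l) (poisson_pmf (l' - l))"
  let ?Q = "PiM UNIV (\<lambda>k::int^'d. measure_pmf q)"
  have image: "(\<integral>\<^sup>+N. G N \<partial>poisson_counts m) = (\<integral>\<^sup>+v. G (\<lambda>k. h (v k)) \<partial>?Q)"
    if m: "poisson_pmf m = map_pmf h q" for h m
  proof -
    let ?P = "PiM UNIV (\<lambda>k::int^'d. measure_pmf (map_pmf h q))"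
    have sets: "sets ?P = sets (poisson_counts l)"
      unfolding poisson_counts_def by (rule sets_PiM_cong) auto
    have G: "G \<in> borel_measurable ?P" using meas by (simp add: measurable_cong_sets[OF sets refl])
    have h_meas: "(\<lambda>v k. h (v k)) \<in> measurable ?Q ?P"
    proof (rule measurable_PiM_single')
      fix k
      have "(\<lambda>v. v k) \<in> measurable ?Q (measure_pmf q)" by (rule measurable_component_singleton) simp
      then show "(\<lambda>v. h (v k)) \<in> measurable ?Q (measure_pmf (map_pmf h q))"
        by (rule measurable_compose) simp
    qed simp
    have "(\<integral>\<^sup>+N. G N \<partial>poisson_counts m) = (\<integral>\<^sup>+N. G N \<partial>?P)"
      by (simp add: poisson_counts_def m)
    also have "\<dots> = (\<integral>\<^sup>+v. G (\<lambda>k. h (v k)) \<partial>?Q)"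
      by (subst PiM_map_pmf, rule nn_integral_distr[OF h_meas]) (use G in simp)
    finally show ?thesis .
  qed
  have "(\<integral>\<^sup>+N. G N \<partial>poisson_counts l) = (\<integral>\<^sup>+v. G (\<lambda>k. fst (v k)) \<partial>?Q)"
    by (rule image) (simp add: q_def map_fst_pair_pmf)
  also have "\<dots> \<le> (\<integral>\<^sup>+v. G (\<lambda>k. (\<lambda>(a, b). a + b) (v k)) \<partial>?Q)"
    by (intro nn_integral_mono mono) (simp add: case_prod_unfold)
  also have "\<dots> = (\<integral>\<^sup>+N. G N \<partial>poisson_counts l')"
    by (rule image[symmetric]) (use poisson_pmf_add[of l "l' - l"] l in \<open>simp add: q_def\<close>)
  finally show ?thesis .
qed

context connection_function
begin

text \<open>Infinite clusters are included on purpose: being finite with at least \<open>n\<close>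
  vertices is not preserved by adding points, being large in this sense is.\<close>

definition large_cluster :: "nat \<Rightarrow> 'd rcm_outcome \<Rightarrow> bool" where
  "large_cluster n w \<longleftrightarrow> infinite (rcm_cluster psi w) \<or> n \<le> card (rcm_cluster psi w)"

lemma pred_large_cluster [measurable]: "Measurable.pred (rcm_space lam) (large_cluster n)"
proof -
  have "large_cluster n = (\<lambda>w. \<not> (finite (rcm_cluster psi w) \<and> card (rcm_cluster psi w) < n))"
    by (auto simp: large_cluster_def fun_eq_iff)
  then show ?thesis
    using sets.sets_Collect_neg[OF pred_cluster_finite_card[of "\<lambda>c. c < n" lam, unfolded pred_def]]
    by (simp add: pred_def)
qed

text \<open>Raising the counts only activates further indices; positions and edge variables of the
  old ones do not change, so every old edge persists.\<close>

lemma large_cluster_mono: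
  assumes N: "\<And>k. N k \<le> N' k" and large: "large_cluster n ((N, X), U)"
  shows "large_cluster n ((N', X), U)"
proof -
  have edge: "rcm_edge psi ((N, X), U) a b \<Longrightarrow> rcm_edge psi ((N', X), U) a b" for a b
    using N by (auto simp: rcm_edge_def rcm_vertices_def rcm_pos_def intro: less_le_trans)
  have "rcm_cluster psi ((N, X), U) \<subseteq> rcm_cluster psi ((N', X), U)"
    unfolding rcm_cluster_def
    by (auto elim!: rtranclp_mono[THEN predicate2D, rotated] intro: edge)
  then show ?thesis using large unfolding large_cluster_def
    by (meson card_mono finite_subset le_trans)
qed

lemma emeasure_large_cluster_mono:
  assumes l: "0 < l" "l < l'"
  shows "emeasure (rcm_space l) {w \<in> space (rcm_space l). large_cluster n w} \<le>
    emeasure (rcm_space l') {w \<in> space (rcm_space l'). large_cluster n w}"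
proof -
  interpret E: prob_space edge_space by (rule prob_space_edge_space)
  interpret P: prob_space pos_space by (rule prob_space_pos_space)
  let ?I = "\<lambda>w. indicator {w. large_cluster n w} w :: ennreal"
  define G where "G N = (\<integral>\<^sup>+X. \<integral>\<^sup>+U. ?I ((N, X), U) \<partial>edge_space \<partial>pos_space)" for N
  have meas: "?I \<in> borel_measurable (rcm_space m)" for m by measurable
  have "emeasure (rcm_space m) {w \<in> space (rcm_space m). large_cluster n w} = (\<integral>\<^sup>+N. G N \<partial>poisson_counts m)" for m
  proof -
    have "emeasure (rcm_space m) {w \<in> space (rcm_space m). large_cluster n w} = (\<integral>\<^sup>+w. ?I w \<partial>rcm_space m)"
    proof -
      have "emeasure (rcm_space m) {w \<in> space (rcm_space m). large_cluster n w} =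
          (\<integral>\<^sup>+w. indicator {w \<in> space (rcm_space m). large_cluster n w} w \<partial>rcm_space m)"
        using pred_large_cluster[of n m] by (intro nn_integral_indicator[symmetric]) (simp add: pred_def)
      also have "\<dots> = (\<integral>\<^sup>+w. ?I w \<partial>rcm_space m)"
        by (rule nn_integral_cong) (simp add: indicator_def)
      finally show ?thesis .
    qed
    then show ?thesis unfolding G_def nn_integral_rcm_space[OF meas] .
  qed
  moreover have "(\<integral>\<^sup>+N. G N \<partial>poisson_counts l) \<le> (\<integral>\<^sup>+N. G N \<partial>poisson_counts l')"
  proof (rule nn_integral_poisson_counts_mono[OF l])
    fix N N' :: "int^'d \<Rightarrow> nat" assume "\<And>k. N k \<le> N' k"
    then show "G N \<le> G N'" unfolding G_def
      by (intro nn_integral_mono) (auto simp: indicator_def intro: large_cluster_mono)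
  next
    have "?I \<in> borel_measurable ((poisson_counts l \<Otimes>\<^sub>M pos_space) \<Otimes>\<^sub>M edge_space)"
      using meas[of l] by (simp add: rcm_space_eq)
    from P.borel_measurable_nn_integral_fst[OF E.borel_measurable_nn_integral_fst[OF this]]
    show "G \<in> borel_measurable (poisson_counts l)" by (simp add: G_def[abs_def])
  qed
  ultimately show ?thesis by simp
qed

subsection \<open>Absence of infinite clusters below the critical intensity\<close>

lemma box_Lambda_mono: "s \<le> t \<Longrightarrow> box_Lambda s \<subseteq> (box_Lambda t :: (real^'d) set)"
  unfolding box_Lambda_def by (auto simp: mem_box_cart) (smt (verit) divide_right_mono)+

lemma pred_cluster_leaves_box [measurable]:
  "Measurable.pred (rcm_space lam) (\<lambda>w. \<exists>b\<in>rcm_cluster psi w. rcm_pos w b \<notin> box_Lambda t)"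
proof -
  have [measurable]: "box_Lambda t \<in> sets (borel :: (real^'d) measure)" by (simp add: box_Lambda_def)
  have "(\<lambda>w. \<exists>b\<in>rcm_cluster psi w. rcm_pos w b \<notin> box_Lambda t) =
      (\<lambda>w. \<exists>b. b \<in> rcm_cluster psi w \<and> rcm_pos w b \<notin> box_Lambda t)" by (auto simp: fun_eq_iff)
  then show ?thesis by simp
qed

text \<open>A bounded box meets only finitely many cubes, and each cube holds finitely many
  points.\<close>

lemma infinite_cluster_leaves_box:
  assumes X: "\<And>b. X b \<in> hcube (fst b)" and inf: "infinite (rcm_cluster psi ((N, X), U))"
  shows "\<exists>b\<in>rcm_cluster psi ((N, X), U). rcm_pos ((N, X), U) b \<notin> box_Lambda t"
proof (rule ccontr)
  assume neg: "\<not> ?thesis"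
  have "bounded (box_Lambda t :: (real^'d) set)" by (simp add: box_Lambda_def)
  then obtain R where R: "\<And>y. y \<in> (box_Lambda t :: (real^'d) set) \<Longrightarrow> norm y \<le> R" by (auto simp: bounded_iff)
  define n where "n = nat \<lceil>max R 1\<rceil>"
  have n: "R \<le> real n" "1 \<le> real n" unfolding n_def by linarith+
  have "real n \<le> real (n ^ 2)" using n(2) by (simp add: power2_eq_square)
  then have Rn: "R \<le> real (n ^ 2) + 1" using n by linarith
  have "rcm_cluster psi ((N, X), U) \<subseteq> insert None (Some ` box_points (near_cubes n) N)"
  proof
    fix b assume b: "b \<in> rcm_cluster psi ((N, X), U)"
    show "b \<in> insert None (Some ` box_points (near_cubes n) N)"
    proof (cases b)
      case (Some kj)
      have "rcm_pos ((N, X), U) b \<in> box_Lambda t" using neg b by auto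
      then have "norm (X kj) \<le> real (n ^ 2) + 1" using R[of "X kj"] Rn Some by simp
      then have "fst kj \<in> near_cubes n" by (rule hcube_near_cubes[OF X])
      moreover have "snd kj < N (fst kj)"
        using subsetD[OF rcm_cluster_subset b] Some by (auto simp: rcm_vertices_def)
      ultimately show ?thesis using Some by (simp add: box_points_def case_prod_unfold)
    qed simp
  qed
  then have "finite (rcm_cluster psi ((N, X), U))" by (rule finite_subset) simp
  with inf show False by contradiction
qed

lemma measure_infinite_le:
  "measure (rcm_space lam) {w \<in> space (rcm_space lam). infinite (rcm_cluster psi w)} \<le>
   measure (rcm_space lam) {w \<in> space (rcm_space lam). \<exists>b\<in>rcm_cluster psi w. rcm_pos w b \<notin> box_Lambda t}"
    (is "measure _ ?I \<le> measure _ ?O")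
proof -
  interpret prob_space "rcm_space lam :: 'd rcm_outcome measure" by (rule prob_space_rcm_space)
  have I: "?I \<in> sets (rcm_space lam)"
    using pred_cluster_finite_card[of "\<lambda>_. True" lam] by simp
  have O: "?O \<in> sets (rcm_space lam)" using pred_cluster_leaves_box[of lam t] by (simp add: pred_def)
  have "emeasure (rcm_space lam) (?I - ?O) = (\<integral>\<^sup>+w. indicator (?I - ?O) w \<partial>rcm_space lam)"
    using I O by simp
  also have "\<dots> = (\<integral>\<^sup>+N. \<integral>\<^sup>+X. \<integral>\<^sup>+U. indicator (?I - ?O) ((N, X), U) \<partial>edge_space \<partial>pos_space \<partial>poisson_counts lam)"
    using I O by (intro nn_integral_rcm_space) auto
  also have "\<dots> = (\<integral>\<^sup>+(N :: int^'d \<Rightarrow> nat). \<integral>\<^sup>+(X :: (int^'d) \<times> nat \<Rightarrow> real^'d). 0 \<partial>pos_space \<partial>poisson_counts lam)"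
  proof (rule nn_integral_cong, rule nn_integral_cong_AE)
    fix N :: "int^'d \<Rightarrow> nat"
    show "AE X in pos_space. (\<integral>\<^sup>+U. indicator (?I - ?O) ((N, X), U) \<partial>edge_space) = 0"
      using AE_pos_space
    proof eventually_elim
      case (elim X)
      have "indicator (?I - ?O) ((N, X), U) = (0 :: ennreal)" for U
        using infinite_cluster_leaves_box[of X N U t] elim by (auto simp: indicator_def)
      then show ?case by simp
    qed
  qed
  finally have "emeasure (rcm_space lam) (?I - ?O) = 0" by simp
  then have "?I - ?O \<in> null_sets (rcm_space lam)" using I O by (auto intro: null_setsI)
  from AE_not_in[OF this] have "AE w in rcm_space lam. w \<in> ?I \<longrightarrow> w \<in> ?O" by eventually_elim auto
  then show ?thesis by (rule finite_measure_mono_AE[OF _ O])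
qed

text \<open>\<open>theta\<close> is given by \<open>Lim\<close>, which carries information only once
  convergence is known. The probabilities decrease in \<open>t\<close> and are bounded below, so the
  limit is their infimum, and each of them dominates the probability of an infinite cluster.\<close>

lemma theta_ge_infinite:
  "measure (rcm_space lam) {w \<in> space (rcm_space lam). infinite (rcm_cluster psi w)} \<le> theta TYPE('d) psi lam"
proof -
  interpret prob_space "rcm_space lam :: 'd rcm_outcome measure" by (rule prob_space_rcm_space)
  define f where "f t = measure (rcm_space lam :: 'd rcm_outcome measure)
       {w \<in> space (rcm_space lam). \<exists>b\<in>rcm_cluster psi w. rcm_pos w b \<notin> box_Lambda t}" for t
  define l where "l = Inf (range f)"
  have bdd: "bdd_below (range f)" by (rule bdd_belowI[of _ 0]) (auto simp: f_def)
  have anti: "f t \<le> f s" if "s \<le> t" for s t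
    unfolding f_def
  proof (rule finite_measure_mono)
    show "{w \<in> space (rcm_space lam). \<exists>b\<in>rcm_cluster psi w. rcm_pos w b \<notin> box_Lambda s} \<in> sets (rcm_space lam)"
      using pred_cluster_leaves_box[of lam s] by (simp add: pred_def)
  qed (use box_Lambda_mono[OF that] in blast)
  have "(f \<longlongrightarrow> l) at_top"
  proof (rule order_tendstoI)
    fix a assume "a < l"
    moreover have "l \<le> f t" for t unfolding l_def by (rule cInf_lower[OF _ bdd]) simp
    ultimately have "a < f t" for t by (rule less_le_trans)
    then show "\<forall>\<^sub>F t in at_top. a < f t" by simp
  next
    fix a assume "l < a"
    then obtain s where "f s < a" using cInf_lessD[of "range f" a] by (auto simp: l_def)
    then show "\<forall>\<^sub>F t in at_top. f t < a"
      using anti by (auto simp: eventually_at_top_linorder intro: le_less_trans)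
  qed
  then have "theta TYPE('d) psi lam = l"
    unfolding theta_def f_def[symmetric] by (rule tendsto_Lim[rotated]) simp
  moreover have "measure (rcm_space lam) {w \<in> space (rcm_space lam). infinite (rcm_cluster psi w)} \<le> l"
    unfolding l_def by (rule cInf_greatest) (use measure_infinite_le in \<open>auto simp: f_def\<close>)
  ultimately show ?thesis by simp
qed

lemma measure_infinite_subcritical:
  assumes "0 < lam" "ereal lam < lambda_c TYPE('d) psi"
  shows "measure (rcm_space lam) {w \<in> space (rcm_space lam). infinite (rcm_cluster psi w)} = 0"
proof -
  have "\<not> 0 < theta TYPE('d) psi lam"
  proof
    assume "0 < theta TYPE('d) psi lam"
    then have "lambda_c TYPE('d) psi \<le> ereal lam"
      unfolding lambda_c_def using assms(1) by (intro Inf_lower) auto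
    with assms(2) show False by simp
  qed
  with theta_ge_infinite[of lam] show ?thesis
    by (smt (verit) measure_nonneg)
qed

text \<open>Passes through \<open>large_cluster\<close>, which is monotone in the intensity.
  Returning to finite clusters at the upper intensity \<open>l'\<close> costs the probability of an
  infinite cluster there, which is 0 below \<open>lambda_c\<close>.\<close>

lemma prob_cluster_ge_fin_mono:
  assumes l: "0 < l" "l < l'" and crit: "ereal l' < lambda_c TYPE('d) psi"
  shows "prob_cluster_ge_fin TYPE('d) psi l n \<le> prob_cluster_ge_fin TYPE('d) psi l' n"
proof -
  interpret P: prob_space "rcm_space m :: 'd rcm_outcome measure" for m by (rule prob_space_rcm_space)
  let ?L = "\<lambda>m. {w \<in> space (rcm_space m). large_cluster n w}"
  let ?F = "\<lambda>m. {w \<in> space (rcm_space m). finite (rcm_cluster psi w) \<and> n \<le> card (rcm_cluster psi w)}"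
  let ?I = "\<lambda>m. {w \<in> space (rcm_space m). infinite (rcm_cluster psi w)}"
  have sets: "?L m \<in> sets (rcm_space m)" "?F m \<in> sets (rcm_space m)" "?I m \<in> sets (rcm_space m)" for m
    using pred_large_cluster[of n m] pred_cluster_finite_card[of "\<lambda>_. True" m]
      pred_cluster_finite_card[of "\<lambda>c. n \<le> c" m] by (simp_all add: pred_def)
  have "measure (rcm_space l) (?F l) \<le> measure (rcm_space l) (?L l)"
    by (rule P.finite_measure_mono) (use sets in \<open>auto simp: large_cluster_def\<close>)
  also have "\<dots> \<le> measure (rcm_space l') (?L l')"
    using emeasure_large_cluster_mono[OF l, of n] by (simp add: P.emeasure_eq_measure)
  also have "\<dots> \<le> measure (rcm_space l') (?F l' \<union> ?I l')"
    by (rule P.finite_measure_mono) (use sets in \<open>auto simp: large_cluster_def\<close>)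
  also have "\<dots> \<le> measure (rcm_space l') (?F l') + measure (rcm_space l') (?I l')"
    by (rule measure_Un_le) (use sets in auto)
  also have "measure (rcm_space l') (?I l') = 0"
    by (rule measure_infinite_subcritical) (use l crit in auto)
  finally show ?thesis by (simp add: prob_cluster_ge_fin_def)
qed

subsection \<open>The correlation length\<close>

abbreviation P :: "real \<Rightarrow> nat \<Rightarrow> real" where
  "P \<equiv> prob_cluster_eq TYPE('d) psi"

abbreviation T :: "real \<Rightarrow> nat \<Rightarrow> real" where
  "T \<equiv> prob_cluster_ge_fin TYPE('d) psi"

abbreviation Z :: "real \<Rightarrow> real" where
  "Z \<equiv> zeta TYPE('d) psi"

lemma rooted_eq:
  assumes L: "finite L" "r \<notin> L" and lam: "0 < lam"
  shows "rooted lam L r = ennreal (fact (card L) * P lam (Suc (card L)) / lam ^ card L)"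
proof -
  interpret prob_space "rcm_space lam :: 'd rcm_outcome measure" by (rule prob_space_rcm_space)
  have P0: "0 \<le> P lam (Suc (card L))" by (simp add: prob_cluster_eq_def)
  have "ennreal (lam ^ card L) * rooted lam L r = of_nat (fact (card L)) * ennreal (P lam (Suc (card L)))"
    unfolding cluster_size_formula[OF L lam, symmetric] by (simp add: prob_cluster_eq_def emeasure_eq_measure)
  also have "\<dots> = ennreal (fact (card L) * P lam (Suc (card L)))"
    using P0 by (simp add: ennreal_mult ennreal_of_nat_eq_real_of_nat)
  finally have eq: "ennreal (lam ^ card L) * rooted lam L r = ennreal (fact (card L) * P lam (Suc (card L)))" .
  show ?thesis
  proof (cases "rooted lam L r" rule: ennreal_cases)
    case (real q)
    then have "lam ^ card L * q = fact (card L) * P lam (Suc (card L))"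
      using eq lam P0 by (simp add: ennreal_mult[symmetric])
    then have "q = fact (card L) * P lam (Suc (card L)) / lam ^ card L"
      using lam by (simp add: eq_divide_eq mult.commute)
    then show ?thesis using real by simp
  next
    case top
    then show ?thesis using eq lam by (simp add: ennreal_mult_top)
  qed
qed

lemma right_mass_finite: "right_mass i < \<infinity>"
proof -
  have "right_mass i \<le> (\<integral>\<^sup>+u. indicator (cball (0::real^'d) 1) u \<partial>lborel)"
    unfolding right_mass_def
  proof (rule nn_integral_mono)
    fix u
    show "indicator {u. 0 < u $ i} u * ennreal (psi u) \<le> indicator (cball 0 1) u"
      using psi01[of u] psi_supp[of u] by (cases "psi u = 0") (auto simp: indicator_def)
  qed
  also have "\<dots> = emeasure lborel (cball (0::real^'d) 1)" by simp
  also have "\<dots> < \<infinity>" by (rule emeasure_lborel_cball_finite)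
  finally show ?thesis .
qed

context
  assumes nontriv: "0 < (\<integral>\<^sup>+x. ennreal (psi x) \<partial>lborel)"
begin

text \<open>Reflection at the origin maps one open half-space to the other, and the hyperplane
  between them is null; so \<open>right_mass i\<close> taken twice is the integral of
  \<open>psi\<close>.\<close>

lemma right_mass_pos:
  shows "0 < right_mass i"
proof -
  have neg: "(\<integral>\<^sup>+u. indicator {u. u $ i < 0} u * ennreal (psi u) \<partial>lborel) = right_mass i"
  proof -
    have "(lborel :: (real^'d) measure) = distr lborel borel uminus"
      using lborel_affine[of "-1" "0 :: real^'d"] by (simp add: density_1)
    then have "right_mass i = (\<integral>\<^sup>+u. indicator {u. 0 < u $ i} u * ennreal (psi u) \<partial>distr lborel borel uminus)"
      by (simp only: right_mass_def)
    also have "\<dots> = (\<integral>\<^sup>+u. indicator {u. 0 < u $ i} (- u) * ennreal (psi (- u)) \<partial>lborel)"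
      by (rule nn_integral_distr) auto
    finally show ?thesis by (simp add: psi_symm indicator_def)
  qed
  have "(\<integral>\<^sup>+x. ennreal (psi x) \<partial>lborel) =
     (\<integral>\<^sup>+u. indicator {u. 0 < u $ i} u * ennreal (psi u) + indicator {u. u $ i < 0} u * ennreal (psi u) \<partial>lborel)"
  proof (rule nn_integral_cong_AE)
    show "AE u in lborel. ennreal (psi u) =
      indicator {u. 0 < u $ i} u * ennreal (psi u) + indicator {u. u $ i < 0} u * ennreal (psi u)"
      using AE_lborel_component_neq[of i 0] by eventually_elim (auto simp: indicator_def)
  qed
  also have "\<dots> = right_mass i + right_mass i"
    unfolding right_mass_def neg[unfolded right_mass_def, symmetric]
    by (subst nn_integral_add) (auto simp: neg[unfolded right_mass_def])
  finally show ?thesis using nontriv by (metis add_0 not_gr_zero)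
qed

text \<open>With \<open>m = Suc k\<close> and \<open>n = Suc l\<close> the binomial coefficient
  contributes \<open>1 / (k! * (l+1)!)\<close>, whereas the two rooted integrals carry
  \<open>k! * l!\<close>; the quotient is \<open>1 / n\<close>. The powers of \<open>lam\<close>
  differ by one, for the vertex that is the root of the right block but a label in the
  union.\<close>

lemma prob_cluster_eq_supermult:
  assumes lam: "0 < lam" and mn: "0 < m" "0 < n"
  shows "lam * enn2real (right_mass i) / real n * (P lam m * P lam n) \<le> P lam (m + n)"
proof -
  obtain k l where kl: "m = Suc k" "n = Suc l" using mn gr0_implies_Suc by metis
  \<comment> \<open>The labels of the glued cluster, with 0 as root: \<open>k\<close> of them join
    the root in the left block of size \<open>m\<close>, the other \<open>Suc l\<close> form the
    right block of size \<open>n\<close>.\<close>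
  let ?L = "{1..<m + n}"
  define c where "c = enn2real (right_mass i)"
  have c: "right_mass i = ennreal c" "0 \<le> c" using right_mass_finite[of i] by (auto simp: c_def ennreal_enn2real_if)
  define j where "j s = fact s * P lam (Suc s) / lam ^ s" for s
  have P0: "0 \<le> P lam s" for s by (simp add: prob_cluster_eq_def)
  have j0: "0 \<le> j s" for s using lam P0 by (simp add: j_def)
  have card_L: "card ?L = k + Suc l" by (simp add: kl)
  have "of_nat (card ?L choose k) * (ennreal (j k) * ennreal (j l) * right_mass i) \<le> rooted lam ?L 0"
  proof (rule rooted_supermult)
    fix A :: "nat set" assume A: "A \<subseteq> ?L" "card A = k"
    moreover have "0 \<notin> A" using A by auto
    ultimately show "rooted lam A 0 = ennreal (j k)"
      using rooted_eq[of A 0 lam] lam finite_subset[of A ?L] by (auto simp: j_def)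
  next
    fix B and b :: nat assume "insert b B \<subseteq> ?L" "b \<notin> B" "card B = l"
    then show "rooted lam B b = ennreal (j l)"
      using rooted_eq[of B b lam] lam finite_subset[of B ?L] by (auto simp: j_def)
  qed (use card_L lam in auto)
  also have "rooted lam ?L 0 = ennreal (j (k + Suc l))"
    using rooted_eq[of ?L 0 lam] lam card_L by (simp add: j_def)
  also have "of_nat (card ?L choose k) * (ennreal (j k) * ennreal (j l) * right_mass i) =
      ennreal (real ((k + Suc l) choose k) * (j k * j l * c))"
    unfolding card_L c(1) using j0 c(2) by (simp add: ennreal_mult ennreal_of_nat_eq_real_of_nat)
  finally have "real ((k + Suc l) choose k) * (j k * j l * c) \<le> j (k + Suc l)"
    using j0 by simp
  moreover have "real ((k + Suc l) choose k) = fact (k + Suc l) / (fact k * fact (Suc l))"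
    by (subst binomial_fact) auto
  ultimately have "fact (k + Suc l) / (fact k * fact (Suc l)) * (j k * j l * c) * (lam ^ (k + Suc l) / fact (k + Suc l)) \<le>
      j (k + Suc l) * (lam ^ (k + Suc l) / fact (k + Suc l))"
    using lam by (intro mult_right_mono) auto
  moreover have "j (k + Suc l) * (lam ^ (k + Suc l) / fact (k + Suc l)) = P lam (m + n)"
    using lam by (simp add: j_def kl)
  moreover have "fact (k + Suc l) / (fact k * fact (Suc l)) * (j k * j l * c) * (lam ^ (k + Suc l) / fact (k + Suc l)) =
      lam * c / real n * (P lam m * P lam n)"
  proof -
    have "fact (k + Suc l) / (fact k * fact (Suc l)) * (j k * j l * c) * (lam ^ (k + Suc l) / fact (k + Suc l)) =
       (j k / fact k) * (j l / fact (Suc l)) * c * lam ^ (k + Suc l)"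
      by simp
    also have "\<dots> = (P lam m / lam ^ k) * (P lam n / (real n * lam ^ l)) * c * (lam ^ k * (lam * lam ^ l))"
      by (simp add: j_def kl power_add)
    also have "\<dots> = lam * c / real n * (P lam m * P lam n)"
      using lam by (simp add: field_simps)
    finally show ?thesis .
  qed
  ultimately show ?thesis by (simp add: c_def)
qed

lemma prob_cluster_eq_1_pos:
  assumes lam: "0 < lam"
  shows "0 < P lam 1"
proof -
  interpret product_sigma_finite "\<lambda>_::nat. lborel :: (real^'d) measure" by (rule product_sigma_finite_lborel)
  have pairs: "vpairs {0::nat} = {}" by (auto simp: vpairs_def)
  have "ennreal (P lam 1) = rooted lam ({} :: nat set) 0"
    using rooted_eq[of "{}" "0::nat" lam] lam by simp
  also have "\<dots> = ennreal (weight lam {0::nat} ((\<lambda>_. undefined)(0 := 0)))"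
    by (rule nn_integral_empty) simp
  also have "\<dots> > 0"
    by (simp add: weight_def conn_weight_def pairs gwt_def gconn_def)
  finally show ?thesis by simp
qed

text \<open>Vertices are added one at a time: gluing with a single vertex multiplies by a positive
  constant, since \<open>right_mass\<close> is positive and finite.\<close>

lemma prob_cluster_eq_pos:
  assumes lam: "0 < lam" and n: "0 < n"
  shows "0 < P lam n"
proof -
  have c: "0 < enn2real (right_mass i)" for i
    using right_mass_pos[of i] right_mass_finite[of i] by (simp add: enn2real_positive_iff)
  have "0 < P lam (Suc m)" for m
  proof (induction m)
    case 0 show ?case using prob_cluster_eq_1_pos[OF lam] by simp
  next
    case (Suc m)
    have "0 < lam * enn2real (right_mass undefined) / real 1 * (P lam (Suc m) * P lam 1)"
      using lam c[of undefined] Suc prob_cluster_eq_1_pos[OF lam] by simp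
    also have "\<dots> \<le> P lam (Suc m + 1)" by (rule prob_cluster_eq_supermult) (use lam in auto)
    finally show ?case by simp
  qed
  then show ?thesis using n gr0_implies_Suc by metis
qed

lemma prob_cluster_eq_le_1: "P lam n \<le> 1"
proof -
  interpret prob_space "rcm_space lam :: 'd rcm_outcome measure" by (rule prob_space_rcm_space)
  show ?thesis by (simp add: prob_cluster_eq_def)
qed

lemma zeta_tendsto:
  assumes lam: "0 < lam"
  shows "(\<lambda>n. - ln (P lam n) / real n) \<longlonglongrightarrow> Z lam" "0 \<le> Z lam"
proof -
  define c where "c = lam * enn2real (right_mass undefined)"
  have c: "0 < c" using right_mass_pos[of undefined] right_mass_finite[of undefined] lam
    by (simp add: c_def enn2real_positive_iff)
  note pos = prob_cluster_eq_pos[OF lam]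
  have "\<exists>l\<ge>0. (\<lambda>n. - ln (P lam n) / real n) \<longlonglongrightarrow> l"
  proof (rule fekete_with_error)
    fix n :: nat assume n: "0 < n"
    show "0 \<le> - ln (P lam n)" using pos[OF n] prob_cluster_eq_le_1[of lam n] by simp
    \<comment> \<open>The error is minus the logarithm of \<open>c / n\<close>, up to the absolute
      value that keeps it nonnegative as Fekete's argument requires.\<close>
    show "0 \<le> ln (real n) + \<bar>ln c\<bar>" using n by simp
  next
    fix m n :: nat assume mn: "0 < m" "0 < n"
    have "ln (c / real n * (P lam m * P lam n)) \<le> ln (P lam (m + n))"
      using prob_cluster_eq_supermult[OF lam mn, of undefined] c pos mn by (simp add: c_def)
    moreover have "ln (c / real n * (P lam m * P lam n)) = ln c - ln (real n) + (ln (P lam m) + ln (P lam n))"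
      using c pos[OF mn(1)] pos[OF mn(2)] mn by (simp add: ln_mult ln_div)
    ultimately show "- ln (P lam (m + n)) \<le> - ln (P lam m) + - ln (P lam n) + (ln (real n) + \<bar>ln c\<bar>)"
      by linarith
  next
    have "(\<lambda>n. ln (real n) / real n + \<bar>ln c\<bar> / real n) \<longlonglongrightarrow> 0 + 0"
      by (intro tendsto_add lim_ln_over_n lim_const_over_n)
    then show "(\<lambda>n. (ln (real n) + \<bar>ln c\<bar>) / real n) \<longlonglongrightarrow> 0" by (simp add: add_divide_distrib)
  qed
  then obtain l where l: "0 \<le> l" "(\<lambda>n. - ln (P lam n) / real n) \<longlonglongrightarrow> l" by blast
  have "Z lam = l" unfolding zeta_def using l(2) by (rule limI)
  with l show "(\<lambda>n. - ln (P lam n) / real n) \<longlonglongrightarrow> Z lam" "0 \<le> Z lam"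
    by simp_all
qed

lemma prob_cluster_ge_fin_sums:
  "(\<lambda>m. P lam (n + m)) sums T lam n"
proof -
  interpret prob_space "rcm_space lam :: 'd rcm_outcome measure" by (rule prob_space_rcm_space)
  let ?A = "\<lambda>m. {w \<in> space (rcm_space lam). finite (rcm_cluster psi w) \<and> card (rcm_cluster psi w) = n + m}"
  have "(\<lambda>m. measure (rcm_space lam) (?A m)) sums measure (rcm_space lam) (\<Union>m. ?A m)"
  proof (rule finite_measure_UNION)
    show "range ?A \<subseteq> sets (rcm_space lam)"
      using pred_cluster_finite_card[of "\<lambda>c. c = _" lam] by (auto simp: pred_def)
  qed (auto simp: disjoint_family_on_def)
  also have "(\<Union>m. ?A m) = {w \<in> space (rcm_space lam). finite (rcm_cluster psi w) \<and> n \<le> card (rcm_cluster psi w)}"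
    by (auto simp: le_iff_add)
  finally show ?thesis by (simp add: prob_cluster_eq_def prob_cluster_ge_fin_def)
qed

lemma zeta_tendsto_ge_fin:
  assumes lam: "0 < lam"
  shows "(\<lambda>n. - ln (T lam n) / real n) \<longlonglongrightarrow> Z lam"
proof (rule tail_exponential_rate[OF _ prob_cluster_ge_fin_sums _ zeta_tendsto(1)[OF assms]])
  interpret prob_space "rcm_space lam :: 'd rcm_outcome measure" by (rule prob_space_rcm_space)
  show "T lam n \<le> 1" for n by (simp add: prob_cluster_ge_fin_def)
qed (rule prob_cluster_eq_pos[OF assms])

lemma zeta_antimono:
  assumes l: "0 < l" "l < l'" and crit: "ereal l' < lambda_c TYPE('d) psi"
   
  shows "Z l' \<le> Z l"
proof (rule LIMSEQ_le)
  show "(\<lambda>n. - ln (T l' n) / real n) \<longlonglongrightarrow> Z l'"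
    by (rule zeta_tendsto_ge_fin) (use l in auto)
  show "(\<lambda>n. - ln (T l n) / real n) \<longlonglongrightarrow> Z l"
    by (rule zeta_tendsto_ge_fin) (use l in auto)
  show "\<exists>M. \<forall>n\<ge>M. - ln (T l' n) / real n \<le> - ln (T l n) / real n"
  proof (intro exI allI impI)
    fix n :: nat assume n: "1 \<le> n"
    have "P l n \<le> T l n"
    proof -
      have "sum (\<lambda>m. P l (n + m)) {0} \<le> (\<Sum>m. P l (n + m))"
        by (rule sum_le_suminf) (use prob_cluster_ge_fin_sums[of l n] in \<open>auto simp: sums_iff prob_cluster_eq_def\<close>)
      then show ?thesis using prob_cluster_ge_fin_sums[of l n] by (simp add: sums_iff)
    qed
    \<comment> \<open>Positivity is needed before taking logarithms, because \<open>ln\<close> is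
      monotone only on the positive reals.\<close>
    then have "0 < T l n" using prob_cluster_eq_pos[OF l(1), of n] n by linarith
    moreover have "T l n \<le> T l' n" by (rule prob_cluster_ge_fin_mono[OF l crit])
    ultimately have "ln (T l n) \<le> ln (T l' n)" by simp
    then show "- ln (T l' n) / real n \<le> - ln (T l n) / real n" by (intro divide_right_mono) auto
  qed
qed

text \<open>Dividing by the power of the intensity leaves it only in the factor
  \<open>exp (- lam * cover)\<close>. There \<open>cover\<close> lies between 0 and
  \<open>Suc k * ball_volume\<close>, so the integrands, and hence the integrals, are comparable in
  both directions.\<close>

lemma prob_cluster_eq_compare:
  assumes l: "0 < l" "l \<le> l'"
  shows "P l' (Suc k) / l' ^ k \<le> P l (Suc k) / l ^ k"
    and "P l (Suc k) / l ^ k \<le> exp ((l' - l) * (real (Suc k) * ball_volume)) * (P l' (Suc k) / l' ^ k)"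
proof -
  let ?L = "{1..k}" and ?V = "insert 0 {1..k}"
  let ?e = "exp ((l' - l) * (real (Suc k) * ball_volume))"
  have l': "0 < l'" using l by simp
  have R: "rooted m ?L 0 = ennreal (fact k * (P m (Suc k) / m ^ k))" if "0 < m" for m
    using rooted_eq[of ?L 0 m] that by simp
  have nn: "0 \<le> P m (Suc k) / m ^ k" if "0 < m" for m using that by (simp add: prob_cluster_eq_def)
  have cardV: "card ?V = Suc k" by simp
  have le1: "weight l' ?V x \<le> weight l ?V x" for x
    unfolding weight_def
    using l by (intro mult_left_mono conn_weight_nonneg) (simp_all add: cover_nonneg mult_right_mono)
  have le2: "weight l ?V x \<le> ?e * weight l' ?V x" for x
  proof -
    have "(l' - l) * cover psi ?V x \<le> (l' - l) * (real (Suc k) * ball_volume)"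
      using cover_le[of ?V x] l cardV by (intro mult_left_mono) auto
    then have "- l * cover psi ?V x \<le> (l' - l) * (real (Suc k) * ball_volume) + - l' * cover psi ?V x"
      by (simp add: algebra_simps)
    then have "exp (- l * cover psi ?V x) \<le> ?e * exp (- l' * cover psi ?V x)"
      by (simp only: exp_add[symmetric] exp_le_cancel_iff)
    from mult_left_mono[OF this conn_weight_nonneg[of ?V x]] show ?thesis
      by (simp add: weight_def mult_ac)
  qed
  have "rooted l' ?L 0 \<le> rooted l ?L 0"
    by (intro nn_integral_mono ennreal_leI le1)
  then have "fact k * (P l' (Suc k) / l' ^ k) \<le> fact k * (P l (Suc k) / l ^ k)"
    unfolding R[OF l'] R[OF l(1)] by (subst (asm) ennreal_le_iff) (intro mult_nonneg_nonneg nn l, simp_all)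
  then show "P l' (Suc k) / l' ^ k \<le> P l (Suc k) / l ^ k" by (rule mult_left_le_imp_le) simp
  have "rooted l ?L 0 \<le> (\<integral>\<^sup>+x. ennreal ?e * ennreal (weight l' ?V (x(0 := 0))) \<partial>PiM ?L (\<lambda>_. lborel))"
  proof (rule nn_integral_mono)
    fix x
    show "ennreal (weight l ?V (x(0 := 0))) \<le> ennreal ?e * ennreal (weight l' ?V (x(0 := 0)))"
      using ennreal_leI[OF le2[of "x(0 := 0)"]] by (simp only: ennreal_mult weight_nonneg exp_ge_zero)
  qed
  also have "\<dots> = ennreal ?e * rooted l' ?L 0"
    by (rule nn_integral_cmult) (rule measurable_compose[OF rooted_meas measurable_ennreal], simp)
  also have "\<dots> = ennreal (fact k * (?e * (P l' (Suc k) / l' ^ k)))"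
    unfolding R[OF l'] mult.left_commute[of "fact k" ?e] by (rule ennreal_mult'[symmetric]) simp
  finally have "fact k * (P l (Suc k) / l ^ k) \<le> fact k * (?e * (P l' (Suc k) / l' ^ k))"
    unfolding R[OF l(1)] by (subst (asm) ennreal_le_iff) (intro mult_nonneg_nonneg nn l', simp_all)
  then show "P l (Suc k) / l ^ k \<le> ?e * (P l' (Suc k) / l' ^ k)" by (rule mult_left_le_imp_le) simp
qed

lemma zeta_compare:
  assumes l: "0 < l" "l \<le> l'"
  shows "Z l + ln l \<le> Z l' + ln l'"
    and "Z l' + ln l' \<le> Z l + ln l + (l' - l) * ball_volume"
proof -
  define g where "g m k = - ln (P m (Suc k) / m ^ k) / real (Suc k)" for m k
  have pos: "0 < P m (Suc k)" if "0 < m" for m k by (rule prob_cluster_eq_pos[OF that]) simp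
  have lim: "g m \<longlonglongrightarrow> Z m + ln m" if m: "0 < m" for m
  proof -
    \<comment> \<open>A cluster of \<open>Suc k\<close> vertices carries only the power
      \<open>m ^ k\<close>, as the origin is not a Poisson point; the ratio \<open>k / Suc k\<close>
      tends to 1.\<close>
    have "(\<lambda>k. - ln (P m (Suc k)) / real (Suc k) + real k / real (Suc k) * ln m) \<longlonglongrightarrow> Z m + 1 * ln m"
      by (intro tendsto_add tendsto_mult tendsto_const LIMSEQ_Suc[OF zeta_tendsto(1)[OF m]] LIMSEQ_n_over_Suc_n)
    also have "(\<lambda>k. - ln (P m (Suc k)) / real (Suc k) + real k / real (Suc k) * ln m) = g m"
    proof
      fix k
      have "ln (P m (Suc k) / m ^ k) = ln (P m (Suc k)) - real k * ln m"
        using pos[OF m, of k] m by (subst ln_div) (simp_all add: ln_realpow)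
      then show "- ln (P m (Suc k)) / real (Suc k) + real k / real (Suc k) * ln m = g m k"
        by (simp add: g_def diff_divide_distrib)
    qed
    finally show ?thesis by simp
  qed
  have l': "0 < l'" using l by simp
  have q: "0 < P m (Suc k) / m ^ k" if "0 < m" for m k using pos[OF that] that by simp
  show "Z l + ln l \<le> Z l' + ln l'"
  proof (rule LIMSEQ_le[OF lim[OF l(1)] lim[OF l']], intro exI allI impI)
    fix k
    have "ln (P l' (Suc k) / l' ^ k) \<le> ln (P l (Suc k) / l ^ k)"
      using prob_cluster_eq_compare(1)[OF l] q[OF l(1)] q[OF l'] by (subst ln_le_cancel_iff)
    then show "g l k \<le> g l' k" unfolding g_def by (intro divide_right_mono) auto
  qed
  have "(\<lambda>k. g l k + (l' - l) * ball_volume) \<longlonglongrightarrow> Z l + ln l + (l' - l) * ball_volume"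
    by (intro tendsto_add lim l tendsto_const)
  with lim[OF l'] show "Z l' + ln l' \<le> Z l + ln l + (l' - l) * ball_volume"
  proof (rule LIMSEQ_le, intro exI allI impI)
    fix k
    let ?c = "(l' - l) * (real (Suc k) * ball_volume)"
    have "ln (P l (Suc k) / l ^ k) \<le> ln (exp ?c * (P l' (Suc k) / l' ^ k))"
      using prob_cluster_eq_compare(2)[OF l, of k] q[OF l(1), of k]
      by (subst ln_le_cancel_iff) (simp_all only: mult_pos_pos exp_gt_zero q[OF l'])
    also have "\<dots> = ?c + ln (P l' (Suc k) / l' ^ k)"
      by (subst ln_mult_pos[OF exp_gt_zero q[OF l']]) simp
    finally have "- ln (P l' (Suc k) / l' ^ k) \<le> - ln (P l (Suc k) / l ^ k) + ?c" by simp
    then have "- ln (P l' (Suc k) / l' ^ k) / real (Suc k) \<le> (- ln (P l (Suc k) / l ^ k) + ?c) / real (Suc k)"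
      by (rule divide_right_mono) simp
    also have "\<dots> = - ln (P l (Suc k) / l ^ k) / real (Suc k) + (l' - l) * ball_volume"
      by (simp add: add_divide_distrib diff_divide_distrib del: of_nat_Suc)
    finally show "g l' k \<le> g l k + (l' - l) * ball_volume" by (simp add: g_def)
  qed
qed

lemma continuous_on_zeta:
  shows "continuous_on {0<..} Z"
proof -
  let ?Z = "\<lambda>l. Z l + ln l"
  have bv: "0 \<le> ball_volume" by (simp add: ball_volume_def)
  have "ball_volume-lipschitz_on {0<..} ?Z"
  proof (rule lipschitz_onI[OF _ bv])
    have *: "dist (?Z x) (?Z y) \<le> ball_volume * dist x y" if "0 < x" "x \<le> y" for x y
      using zeta_compare[OF that] that by (simp add: dist_real_def abs_le_iff mult.commute)
    fix x y :: real assume "x \<in> {0<..}" "y \<in> {0<..}"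
    then show "dist (?Z x) (?Z y) \<le> ball_volume * dist x y"
      using *[of x y] *[of y x] by (cases "x \<le> y") (auto simp: dist_commute)
  qed
  then have "continuous_on {0<..} ?Z" by (rule lipschitz_on_continuous_on)
  then have "continuous_on {0<..} (\<lambda>l. ?Z l - ln l)"
    by (rule continuous_on_diff) (auto intro!: continuous_on_ln continuous_on_id)
  then show ?thesis by simp
qed

text \<open>Comparison with the reference intensity 1 gives
  \<open>Z l \<ge> Z 1 - ball_volume - ln l\<close> for \<open>l < 1\<close>. The reference may lie
  above \<open>lambda_c\<close>, since the rate exists at every positive intensity.\<close>

lemma zeta_at_0:
  shows "filterlim Z at_top (at_right 0)"
proof (rule filterlim_at_top_mono)
  let ?c = "Z 1 - ball_volume"
  have "filterlim (\<lambda>l. - ln l) at_top (at_right (0::real))"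
    using ln_at_0 by (simp add: filterlim_uminus_at_top)
  then show "filterlim (\<lambda>l. ?c + - ln l) at_top (at_right (0::real))"
    by (rule filterlim_tendsto_add_at_top[OF tendsto_const])
  show "\<forall>\<^sub>F l in at_right 0. ?c + - ln l \<le> Z l"
    unfolding eventually_at_right[OF zero_less_one]
  proof (intro exI conjI allI impI)
    fix l :: real assume l: "0 < l" "l < 1"
    have bv: "0 \<le> ball_volume" by (simp add: ball_volume_def)
    have "Z 1 + ln 1 \<le> Z l + ln l + (1 - l) * ball_volume"
      by (rule zeta_compare(2)) (use l in auto)
    moreover have "(1 - l) * ball_volume \<le> 1 * ball_volume" using l bv by (intro mult_right_mono) auto
    ultimately show "?c + - ln l \<le> Z l" by simp
  qed simp
qed

end

end

text \<open>Finiteness of the rates is expressed by convergence to a real number. The condition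
  \<open>nontriv\<close> excludes \<open>psi = 0\<close> almost everywhere, where the origin is
  almost surely isolated and no finite rate exists; it guarantees
  \<open>right_mass i > 0\<close>.\<close>

theorem mainTheorem6:
  fixes psi :: "real^'d::finite \<Rightarrow> real"
  assumes meas: "psi \<in> borel_measurable borel"
    and range01: "\<And>x. 0 \<le> psi x \<and> psi x \<le> 1"
    and symm: "\<And>x. psi (- x) = psi x"
    and supp: "\<And>x. psi x \<noteq> 0 \<Longrightarrow> norm x \<le> 1"
    and nontriv: "(\<integral>\<^sup>+ x. ennreal (psi x) \<partial>lborel) > 0"
  shows "(\<forall>lam. 0 < lam \<and> ereal lam < lambda_c TYPE('d) psi \<longrightarrow>
            (\<lambda>n. - ln (prob_cluster_eq TYPE('d) psi lam n) / real n)
               \<longlonglongrightarrow> zeta TYPE('d) psi lam \<and>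
            (\<lambda>n. - ln (prob_cluster_ge_fin TYPE('d) psi lam n) / real n)
               \<longlonglongrightarrow> zeta TYPE('d) psi lam)
       \<and> continuous_on {lam. 0 < lam \<and> ereal lam < lambda_c TYPE('d) psi} (zeta TYPE('d) psi)
       \<and> antimono_on {lam. 0 < lam \<and> ereal lam < lambda_c TYPE('d) psi} (zeta TYPE('d) psi)
       \<and> filterlim (zeta TYPE('d) psi) at_top (at_right 0)"
proof -
  interpret connection_function psi
    by unfold_locales (use assms in auto)
  have "continuous_on {lam. 0 < lam \<and> ereal lam < lambda_c TYPE('d) psi} (zeta TYPE('d) psi)"
    by (rule continuous_on_subset[OF continuous_on_zeta[OF nontriv]]) auto
  moreover have "antimono_on {lam. 0 < lam \<and> ereal lam < lambda_c TYPE('d) psi} (zeta TYPE('d) psi)"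
  proof (rule monotone_onI)
    fix l l' assume "l \<in> {lam. 0 < lam \<and> ereal lam < lambda_c TYPE('d) psi}"
      "l' \<in> {lam. 0 < lam \<and> ereal lam < lambda_c TYPE('d) psi}" "l \<le> l'"
    then show "zeta TYPE('d) psi l' \<le> zeta TYPE('d) psi l"
      using zeta_antimono[OF nontriv, of l l'] by (cases "l = l'") auto
  qed
  ultimately show ?thesis
    using zeta_tendsto(1)[OF nontriv] zeta_tendsto_ge_fin[OF nontriv] zeta_at_0[OF nontriv] by blast
qed

end
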